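(* Let $U : \mathcal{A}\to\mathcal{B}$ be a functor with $\mathcal{A}$ and $\mathcal{B}$ locally finitely multipresentable categories. Then $U$ is a right multi-adjoint if and only if it is accessible and preserves connected limits.
   Context: A multi-initial family in a category $\mathcal{C}$ is a family of objects $(X_i)_{i\in I}$ such that for any object $C$ of $\mathcal{C}$ there is a unique $i\in I$ and a unique arrow $X_i\to C$. A functor $U:\mathcal{A}\to\mathcal{B}$ is a right multi-adjoint if for every object $B$ of $\mathcal{B}$ the comma category $B\downarrow U$ (objects: arrows $B\to U(A)$) has a small (set-indexed) multi-initial family. A multicolimit of a small diagram $F : I\to\mathcal{A}$ is a small multi-initial family in the category of cocones over $F$. A category is multicocomplete if every small diagram has a multicolimit. A category $\mathcal{A}$ is locally finitely multipresentable if it has filtered colimits, it has a small generator $\mathcal{A}_\omega$ of finitely presented objects such that every object $A$ is the filtered colimit of the canonical diagram $\mathcal{A}_\omega\downarrow A\to\mathcal{A}$, and it is multicocomplete. A functor is accessible if it preserves $\lambda$-filtered colimits for some regular cardinal $\lambda$ (not necessarily $\aleph_0$). A connected limit is a limit indexed by a (small) connected category. *)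

theory Defs
  imports Main "HOL-Library.FuncSet"
begin

unbundle cardinal_syntax

section \<open>Size\<close>

text \<open>
  Sizes are measured by a type \<open>'u\<close> playing the role of a Grothendieck universe: its
  cardinality is strongly inaccessible (uncountable, regular, strong limit), and "small" means "of cardinality below that of \<open>'u\<close>".
  Up to isomorphism every small category lives on \<open>'u\<close>, so quantification over all small
  categories is quantification over the categories of type \<open>('u, 'u) cat\<close> that are small.
\<close>

definition universe :: "'u itself \<Rightarrow> bool" where
  "universe T \<longleftrightarrow>
     natLeq <o |UNIV :: 'u set| \<and>
     regularCard |UNIV :: 'u set| \<and>
     (\<forall>S :: 'u set. |S| <o |UNIV :: 'u set| \<longrightarrow> |Pow S| <o |UNIV :: 'u set| )"

definition small :: "'u itself \<Rightarrow> 'x set \<Rightarrow> bool" where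
  "small T S \<longleftrightarrow> |S| <o |UNIV :: 'u set|"

definition small_regular_cardinal :: "'u rel \<Rightarrow> bool" where
  "small_regular_cardinal lam \<longleftrightarrow>
     Card_order lam \<and> infinite (Field lam) \<and> regularCard lam \<and> lam <o |UNIV :: 'u set|"

section \<open>Categories and functors\<close>

text \<open>\<open>Comp C g f\<close> is the composite of \<open>g\<close> after \<open>f\<close>.\<close>

record ('o, 'm) cat =
  Obj :: "'o set"
  Arr :: "'m set"
  Dom :: "'m \<Rightarrow> 'o"
  Cod :: "'m \<Rightarrow> 'o"
  Ident :: "'o \<Rightarrow> 'm"
  Comp :: "'m \<Rightarrow> 'm \<Rightarrow> 'm"

definition Hom :: "('o, 'm) cat \<Rightarrow> 'o \<Rightarrow> 'o \<Rightarrow> 'm set" where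
  "Hom C x y = {f \<in> Arr C. Dom C f = x \<and> Cod C f = y}"

locale category =
  fixes C :: "('o, 'm) cat"
  assumes Dom_in_Obj: "f \<in> Arr C \<Longrightarrow> Dom C f \<in> Obj C"
    and Cod_in_Obj: "f \<in> Arr C \<Longrightarrow> Cod C f \<in> Obj C"
    and Ident_in_Hom: "x \<in> Obj C \<Longrightarrow> Ident C x \<in> Hom C x x"
    and Comp_in_Hom: "f \<in> Hom C x y \<Longrightarrow> g \<in> Hom C y z \<Longrightarrow> Comp C g f \<in> Hom C x z"
    and Comp_Ident: "f \<in> Hom C x y \<Longrightarrow> Comp C f (Ident C x) = f"
    and Ident_Comp: "f \<in> Hom C x y \<Longrightarrow> Comp C (Ident C y) f = f"
    and Comp_assoc: "f \<in> Hom C w x \<Longrightarrow> g \<in> Hom C x y \<Longrightarrow> h \<in> Hom C y z \<Longrightarrow>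
      Comp C h (Comp C g f) = Comp C (Comp C h g) f"

record ('o1, 'm1, 'o2, 'm2) ftor =
  FObj :: "'o1 \<Rightarrow> 'o2"
  FArr :: "'m1 \<Rightarrow> 'm2"

locale cat_functor = source: category A + target: category B
  for A :: "('o1, 'm1) cat" and B :: "('o2, 'm2) cat" +
  fixes F :: "('o1, 'm1, 'o2, 'm2) ftor"
  assumes FObj_in_Obj: "x \<in> Obj A \<Longrightarrow> FObj F x \<in> Obj B"
    and FArr_in_Hom: "f \<in> Hom A x y \<Longrightarrow> FArr F f \<in> Hom B (FObj F x) (FObj F y)"
    and FArr_Ident: "x \<in> Obj A \<Longrightarrow> FArr F (Ident A x) = Ident B (FObj F x)"
    and FArr_Comp: "f \<in> Hom A x y \<Longrightarrow> g \<in> Hom A y z \<Longrightarrow>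
      FArr F (Comp A g f) = Comp B (FArr F g) (FArr F f)"

definition comp_ftor ::
  "('o2, 'm2, 'o3, 'm3) ftor \<Rightarrow> ('o1, 'm1, 'o2, 'm2) ftor \<Rightarrow> ('o1, 'm1, 'o3, 'm3) ftor" where
  "comp_ftor G F = \<lparr>FObj = FObj G \<circ> FObj F, FArr = FArr G \<circ> FArr F\<rparr>"

definition op_cat :: "('o, 'm) cat \<Rightarrow> ('o, 'm) cat" where
  "op_cat C = C\<lparr>Dom := Cod C, Cod := Dom C, Comp := (\<lambda>g f. Comp C f g)\<rparr>"

definition small_category :: "'u itself \<Rightarrow> ('o, 'm) cat \<Rightarrow> bool" where
  "small_category T C \<longleftrightarrow> category C \<and> small T (Obj C) \<and> small T (Arr C)"

definition locally_small :: "'u itself \<Rightarrow> ('o, 'm) cat \<Rightarrow> bool" where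
  "locally_small T C \<longleftrightarrow> (\<forall>x \<in> Obj C. \<forall>y \<in> Obj C. small T (Hom C x y))"

text \<open>
  The category with object set \<open>X\<close> in which an arrow from \<open>x\<close> to \<open>y\<close> is an element \<open>h\<close> of
  \<open>H x y\<close>, tagged with its domain and codomain. In \<open>c x g f\<close>, the object \<open>x\<close> is the domain
  of \<open>f\<close>.
\<close>

definition cat_of_homs ::
  "'o set \<Rightarrow> ('o \<Rightarrow> 'o \<Rightarrow> 'h set) \<Rightarrow> ('o \<Rightarrow> 'h) \<Rightarrow> ('o \<Rightarrow> 'h \<Rightarrow> 'h \<Rightarrow> 'h)
    \<Rightarrow> ('o, 'o \<times> 'h \<times> 'o) cat" where
  "cat_of_homs X H i c =
     \<lparr>Obj = X,
      Arr = {(x, h, y). x \<in> X \<and> y \<in> X \<and> h \<in> H x y},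
      Dom = (\<lambda>(x, h, y). x),
      Cod = (\<lambda>(x, h, y). y),
      Ident = (\<lambda>x. (x, i x, x)),
      Comp = (\<lambda>(y', g, z) (x, f, y). (x, c x g f, z))\<rparr>"

section \<open>Multi-initial families and right multi-adjoints\<close>

definition multi_initial :: "('o, 'm) cat \<Rightarrow> 'i set \<Rightarrow> ('i \<Rightarrow> 'o) \<Rightarrow> bool" where
  "multi_initial C I X \<longleftrightarrow>
     (\<forall>i \<in> I. X i \<in> Obj C) \<and>
     (\<forall>c \<in> Obj C. \<exists>!(i, f). i \<in> I \<and> f \<in> Hom C (X i) c)"

definition has_small_multi_initial_family :: "'u itself \<Rightarrow> ('o, 'm) cat \<Rightarrow> bool" where
  "has_small_multi_initial_family T C \<longleftrightarrow>
     (\<exists>(I :: 'u set) X. small T I \<and> multi_initial C I X)"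

text \<open>The comma category of arrows from \<open>b\<close> to objects in the image of \<open>U\<close>.\<close>

definition comma_under ::
  "('oa, 'ma) cat \<Rightarrow> ('ob, 'mb) cat \<Rightarrow> ('oa, 'ma, 'ob, 'mb) ftor \<Rightarrow> 'ob
    \<Rightarrow> ('oa \<times> 'mb, ('oa \<times> 'mb) \<times> 'ma \<times> ('oa \<times> 'mb)) cat" where
  "comma_under A B U b =
     cat_of_homs {(a, f). a \<in> Obj A \<and> f \<in> Hom B b (FObj U a)}
       (\<lambda>(a, f) (a', f'). {h \<in> Hom A a a'. Comp B (FArr U h) f = f'})
       (\<lambda>(a, f). Ident A a)
       (\<lambda>_. Comp A)"

definition right_multi_adjoint ::
  "'u itself \<Rightarrow> ('oa, 'ma) cat \<Rightarrow> ('ob, 'mb) cat \<Rightarrow> ('oa, 'ma, 'ob, 'mb) ftor \<Rightarrow> bool" where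
  "right_multi_adjoint T A B U \<longleftrightarrow>
     (\<forall>b \<in> Obj B. has_small_multi_initial_family T (comma_under A B U b))"

section \<open>Cocones, colimits, limits, multicolimits\<close>

text \<open>
  A cocone over \<open>D : J \<rightarrow> C\<close> is a pair of an apex and a family of legs; the family is
  extensional so that it is determined by its values on the objects of \<open>J\<close>.
\<close>

definition cocones ::
  "('j, 'k) cat \<Rightarrow> ('o, 'm) cat \<Rightarrow> ('j, 'k, 'o, 'm) ftor
    \<Rightarrow> ('o \<times> ('j \<Rightarrow> 'm), ('o \<times> ('j \<Rightarrow> 'm)) \<times> 'm \<times> ('o \<times> ('j \<Rightarrow> 'm))) cat" where
  "cocones J C D =
     cat_of_homs
       {(c, l). c \<in> Obj C \<and> l \<in> (\<Pi>\<^sub>E j \<in> Obj J. Hom C (FObj D j) c) \<and>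
                (\<forall>u \<in> Arr J. Comp C (l (Cod J u)) (FArr D u) = l (Dom J u))}
       (\<lambda>(c, l) (c', l'). {h \<in> Hom C c c'. \<forall>j \<in> Obj J. Comp C h (l j) = l' j})
       (\<lambda>(c, l). Ident C c)
       (\<lambda>_. Comp C)"

definition initial_object :: "('o, 'm) cat \<Rightarrow> 'o \<Rightarrow> bool" where
  "initial_object C x \<longleftrightarrow> x \<in> Obj C \<and> (\<forall>y \<in> Obj C. \<exists>!f. f \<in> Hom C x y)"

definition is_colimit ::
  "('j, 'k) cat \<Rightarrow> ('o, 'm) cat \<Rightarrow> ('j, 'k, 'o, 'm) ftor \<Rightarrow> 'o \<times> ('j \<Rightarrow> 'm) \<Rightarrow> bool" where
  "is_colimit J C D c \<longleftrightarrow> initial_object (cocones J C D) c"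

text \<open>A limit is a colimit in the opposite category; the functor data are unchanged.\<close>

definition is_limit ::
  "('j, 'k) cat \<Rightarrow> ('o, 'm) cat \<Rightarrow> ('j, 'k, 'o, 'm) ftor \<Rightarrow> 'o \<times> ('j \<Rightarrow> 'm) \<Rightarrow> bool" where
  "is_limit J C D c \<longleftrightarrow> is_colimit (op_cat J) (op_cat C) D c"

text \<open>The image under \<open>F\<close> of a cone or cocone on a diagram with index category \<open>J\<close>.\<close>

definition image_cocone ::
  "('j, 'k) cat \<Rightarrow> ('o1, 'm1, 'o2, 'm2) ftor \<Rightarrow> 'o1 \<times> ('j \<Rightarrow> 'm1) \<Rightarrow> 'o2 \<times> ('j \<Rightarrow> 'm2)" where
  "image_cocone J F = (\<lambda>(c, l). (FObj F c, \<lambda>j \<in> Obj J. FArr F (l j)))"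

definition preserves_colimits_of_shape ::
  "('j, 'k) cat \<Rightarrow> ('o1, 'm1) cat \<Rightarrow> ('o2, 'm2) cat \<Rightarrow> ('o1, 'm1, 'o2, 'm2) ftor \<Rightarrow> bool" where
  "preserves_colimits_of_shape J A B F \<longleftrightarrow>
     (\<forall>D c. cat_functor J A D \<and> is_colimit J A D c \<longrightarrow>
            is_colimit J B (comp_ftor F D) (image_cocone J F c))"

definition preserves_limits_of_shape ::
  "('j, 'k) cat \<Rightarrow> ('o1, 'm1) cat \<Rightarrow> ('o2, 'm2) cat \<Rightarrow> ('o1, 'm1, 'o2, 'm2) ftor \<Rightarrow> bool" where
  "preserves_limits_of_shape J A B F \<longleftrightarrow>
     (\<forall>D c. cat_functor J A D \<and> is_limit J A D c \<longrightarrow>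
            is_limit J B (comp_ftor F D) (image_cocone J F c))"

definition multicocomplete :: "'u itself \<Rightarrow> ('o, 'm) cat \<Rightarrow> bool" where
  "multicocomplete T C \<longleftrightarrow>
     (\<forall>(J :: ('u, 'u) cat) D. small_category T J \<and> cat_functor J C D \<longrightarrow>
        has_small_multi_initial_family T (cocones J C D))"

section \<open>Filtered and connected categories\<close>

text \<open>
  Every diagram with fewer than \<open>lam\<close> arrows has a cocone. The empty diagram makes filtered
  categories nonempty. The cardinal \<open>lam\<close> is assumed to be at most that of \<open>'u\<close>, so that it
  suffices to consider diagrams indexed by categories living on \<open>'u\<close>.
\<close>

definition lam_filtered :: "'u itself \<Rightarrow> 'l rel \<Rightarrow> ('o, 'm) cat \<Rightarrow> bool" where
  "lam_filtered T lam J \<longleftrightarrow>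
     category J \<and>
     (\<forall>(K :: ('u, 'u) cat) D. cat_functor K J D \<and> |Arr K| <o lam \<longrightarrow> Obj (cocones K J D) \<noteq> {})"

abbreviation filtered :: "'u itself \<Rightarrow> ('o, 'm) cat \<Rightarrow> bool" where
  "filtered T J \<equiv> lam_filtered T natLeq J"

definition connected_category :: "('o, 'm) cat \<Rightarrow> bool" where
  "connected_category J \<longleftrightarrow>
     category J \<and> Obj J \<noteq> {} \<and>
     (\<forall>x \<in> Obj J. \<forall>y \<in> Obj J.
        (x, y) \<in> ({(Dom J f, Cod J f) |f. f \<in> Arr J} \<union> {(Cod J f, Dom J f) |f. f \<in> Arr J})\<^sup>*)"

definition has_filtered_colimits :: "'u itself \<Rightarrow> ('o, 'm) cat \<Rightarrow> bool" where
  "has_filtered_colimits T C \<longleftrightarrow>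
     (\<forall>(J :: ('u, 'u) cat) D. small_category T J \<and> filtered T J \<and> cat_functor J C D \<longrightarrow>
        (\<exists>c. is_colimit J C D c))"

definition preserves_lam_filtered_colimits ::
  "'u itself \<Rightarrow> 'l rel \<Rightarrow> ('o1, 'm1) cat \<Rightarrow> ('o2, 'm2) cat \<Rightarrow> ('o1, 'm1, 'o2, 'm2) ftor \<Rightarrow> bool"
  where
  "preserves_lam_filtered_colimits T lam A B F \<longleftrightarrow>
     (\<forall>J :: ('u, 'u) cat. small_category T J \<and> lam_filtered T lam J \<longrightarrow>
        preserves_colimits_of_shape J A B F)"

definition accessible ::
  "'u itself \<Rightarrow> ('o1, 'm1) cat \<Rightarrow> ('o2, 'm2) cat \<Rightarrow> ('o1, 'm1, 'o2, 'm2) ftor \<Rightarrow> bool" where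
  "accessible T A B F \<longleftrightarrow>
     (\<exists>lam :: 'u rel. small_regular_cardinal lam \<and> preserves_lam_filtered_colimits T lam A B F)"

definition preserves_connected_limits ::
  "'u itself \<Rightarrow> ('o1, 'm1) cat \<Rightarrow> ('o2, 'm2) cat \<Rightarrow> ('o1, 'm1, 'o2, 'm2) ftor \<Rightarrow> bool" where
  "preserves_connected_limits T A B F \<longleftrightarrow>
     (\<forall>J :: ('u, 'u) cat. small_category T J \<and> connected_category J \<longrightarrow>
        preserves_limits_of_shape J A B F)"

section \<open>Locally finitely multipresentable categories\<close>

text \<open>The category of small subsets of \<open>'x\<close> and all functions between them.\<close>

definition set_cat ::
  "'u itself \<Rightarrow> ('x set, 'x set \<times> ('x \<Rightarrow> 'x) \<times> 'x set) cat" where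
  "set_cat T =
     cat_of_homs {S. small T S} (\<lambda>S S'. S \<rightarrow>\<^sub>E S') (\<lambda>S. \<lambda>s \<in> S. s) (\<lambda>S g f. compose S g f)"

text \<open>
  The covariant hom functor of \<open>x\<close> takes values in the category of small subsets of
  \<open>'m + 'u\<close>: this contains the hom-sets (by \<open>Inl\<close>) and a copy of every small set (by \<open>Inr\<close>),
  so it is equivalent to the category of all small sets, whatever the cardinality of \<open>'m\<close>.
\<close>

definition hom_ftor ::
  "'u itself \<Rightarrow> ('o, 'm) cat \<Rightarrow> 'o \<Rightarrow>
    ('o, 'm, ('m + 'u) set, ('m + 'u) set \<times> ('m + 'u \<Rightarrow> 'm + 'u) \<times> ('m + 'u) set) ftor" where
  "hom_ftor T C x =
     \<lparr>FObj = (\<lambda>y. Inl ` Hom C x y),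
      FArr = (\<lambda>f. (Inl ` Hom C x (Dom C f),
                   \<lambda>s \<in> Inl ` Hom C x (Dom C f). Inl (Comp C f (projl s)),
                   Inl ` Hom C x (Cod C f)))\<rparr>"

definition finitely_presented :: "'u itself \<Rightarrow> ('o, 'm) cat \<Rightarrow> 'o \<Rightarrow> bool" where
  "finitely_presented T C x \<longleftrightarrow>
     x \<in> Obj C \<and> preserves_lam_filtered_colimits T natLeq C (set_cat T) (hom_ftor T C x)"

definition generator :: "('o, 'm) cat \<Rightarrow> 'o set \<Rightarrow> bool" where
  "generator C G \<longleftrightarrow>
     G \<subseteq> Obj C \<and>
     (\<forall>x \<in> Obj C. \<forall>y \<in> Obj C. \<forall>f \<in> Hom C x y. \<forall>g \<in> Hom C x y.
        (\<forall>s \<in> G. \<forall>h \<in> Hom C s x. Comp C f h = Comp C g h) \<longrightarrow> f = g)"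

text \<open>
  For a set \<open>G\<close> of objects, viewed as a full subcategory, the comma category of arrows from
  objects in \<open>G\<close> to \<open>x\<close>, its projection to \<open>C\<close>, and the canonical cocone with apex \<open>x\<close>.
\<close>

definition comma_over ::
  "('o, 'm) cat \<Rightarrow> 'o set \<Rightarrow> 'o \<Rightarrow> ('o \<times> 'm, ('o \<times> 'm) \<times> 'm \<times> ('o \<times> 'm)) cat" where
  "comma_over C G x =
     cat_of_homs {(s, f). s \<in> G \<and> f \<in> Hom C s x}
       (\<lambda>(s, f) (s', f'). {h \<in> Hom C s s'. Comp C f' h = f})
       (\<lambda>(s, f). Ident C s)
       (\<lambda>_. Comp C)"

definition canonical_diagram :: "('o \<times> 'm, ('o \<times> 'm) \<times> 'm \<times> ('o \<times> 'm), 'o, 'm) ftor" where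
  "canonical_diagram = \<lparr>FObj = fst, FArr = (\<lambda>(p, h, q). h)\<rparr>"

definition canonical_cocone ::
  "('o, 'm) cat \<Rightarrow> 'o set \<Rightarrow> 'o \<Rightarrow> 'o \<times> ('o \<times> 'm \<Rightarrow> 'm)" where
  "canonical_cocone C G x = (x, \<lambda>p \<in> Obj (comma_over C G x). snd p)"

definition locally_finitely_multipresentable :: "'u itself \<Rightarrow> ('o, 'm) cat \<Rightarrow> bool" where
  "locally_finitely_multipresentable T C \<longleftrightarrow>
     category C \<and> locally_small T C \<and>
     has_filtered_colimits T C \<and>
     (\<exists>G. small T G \<and> generator C G \<and> (\<forall>s \<in> G. finitely_presented T C s) \<and>
        (\<forall>x \<in> Obj C. filtered T (comma_over C G x) \<and>
           is_colimit (comma_over C G x) C canonical_diagram (canonical_cocone C G x))) \<and>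
     multicocomplete T C"

end

theory Submission
  imports Defs
begin

text \<open>
  If \<open>U\<close> is a right multi-adjoint, then \<open>Hom b (U a)\<close> is the disjoint sum of the \<open>Hom (X i) a\<close>
  over the multi-initial family \<open>X\<close> of \<open>b \<down> U\<close>. A cone from \<open>b\<close> over the image of a connected
  diagram stays in a single summand, and \<open>\<lambda>\<close>-filtered colimits commute with the sum as soon as all
  \<open>X i\<close>, for \<open>b\<close> in the dense generator, are \<open>\<lambda>\<close>-presentable.

  Conversely, the domain category has all connected limits: the limit of a connected diagram is the
  component, common to all its vertices, of the multicolimit of the cones whose apex is in the
  generator. Hence every small connected full subcategory of \<open>b \<down> U\<close> has a limit, and it remains to
  bound weakly initial families. An object \<open>x\<close> is the \<open>\<kappa>\<^sup>+\<close>-filtered colimit, over the sets \<open>S\<close> of at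
  most \<open>\<kappa>\<close> arrows from the generator to \<open>x\<close>, of the component over \<open>x\<close> of the multicolimit of the
  diagram spanned by \<open>S\<close>. Up to isomorphism only a small set of objects occurs here, and for \<open>\<kappa>\<close>
  large every \<open>b \<rightarrow> U x\<close> factors through the image of one of them.
\<close>

section \<open>Small sets\<close>

text \<open>The definition supplies multicolimits and a dense generator but neither limits nor
  presentation ranks, so both are read off from elements, the arrows from the generator. The set
  \<open>el_arr C G x\<close> of arrows between the elements of \<open>x\<close> acts as a
  presentation: \<open>x\<close> is presentable for every infinite cardinal, up to that of the
  universe, that exceeds its size. In the converse, \<open>b\<close> may be presentable only for
  some \<open>lam\<close> above the cardinal whose filtered colimits \<open>U\<close> preserves;
  preservation passes to the larger cardinal, and \<open>\<kappa>\<close> is taken at least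
  \<open>lam\<close>. The component shared by the vertices of a connected diagram carries
  projections, but could a priori have elements that come from no cone; an endomorphism that fixes
  its legs excludes them. The component over \<open>x\<close> of a multicolimit depends on
  \<open>x\<close>, not just on the diagram. Smallness comes from collecting all components for all
  diagrams of bounded size up to relabelling, a small set as the universe is a strong limit. In the
  comma category, cones whose only compatible endomorphism is the identity turn a weakly initial set
  into a multi-initial family, as in Freyd's construction of initial objects.\<close>

lemma small_subset: "S \<subseteq> S' \<Longrightarrow> small T S' \<Longrightarrow> small T S"
  unfolding small_def by (rule ordLeq_ordLess_trans[OF card_of_mono1])

lemma small_image: "small T S \<Longrightarrow> small T (f ` S)"
  unfolding small_def by (rule ordLeq_ordLess_trans[OF card_of_image])

lemma small_inj_on:
  assumes "inj_on f S" "f ` S \<subseteq> S'" "small T S'"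
  shows "small T S"
proof -
  have "|S| \<le>o |S'|" using assms(1,2) card_of_ordLeq by blast
  thus ?thesis using assms(3) unfolding small_def by (rule ordLeq_ordLess_trans)
qed

lemma small_embedding:
  fixes T :: "'u itself"
  assumes "small T S"
  shows "\<exists>e :: _ \<Rightarrow> 'u. inj_on e S"
proof -
  have "|S| \<le>o |UNIV :: 'u set|" using assms unfolding small_def by (rule ordLess_imp_ordLeq)
  thus ?thesis using card_of_ordLeq[of S "UNIV :: 'u set"] by blast
qed

context
  fixes T :: "'u itself"
  assumes univ: "universe T"
begin

lemma universe_cinfinite: "cinfinite |UNIV :: 'u set|"
  using univ unfolding universe_def cinfinite_def
  by (metis Field_natLeq card_of_Card_order finite_iff_ordLess_natLeq infinite_UNIV_nat
      not_ordLess_ordLeq ordLess_imp_ordLeq ordLess_transitive card_of_Field_ordIso card_of_unique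
      Field_card_of)

lemma small_countable: "|S| \<le>o natLeq \<Longrightarrow> small T S"
  using univ unfolding universe_def small_def using ordLeq_ordLess_trans by blast

lemma small_finite: "finite S \<Longrightarrow> small T S"
  using small_countable finite_iff_ordLess_natLeq ordLess_imp_ordLeq by blast

lemma small_UNION: "small T I \<Longrightarrow> (\<And>i. i \<in> I \<Longrightarrow> small T (F i)) \<Longrightarrow> small T (\<Union>i\<in>I. F i)"
  using univ universe_cinfinite unfolding universe_def small_def
  by (metis regularCard_UNION_bound card_of_Card_order)

lemma small_Un: "small T S \<Longrightarrow> small T S' \<Longrightarrow> small T (S \<union> S')"
  using small_UNION[of "UNIV :: bool set" "\<lambda>b. if b then S else S'"]
  by (simp add: small_finite Un_commute UNIV_bool)

lemma small_Pow:
  assumes "small T S"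
  shows "small T (Pow S)"
proof -
  obtain e :: "_ \<Rightarrow> 'u" where e: "inj_on e S" using small_embedding[OF assms] by blast
  have "small T (e ` S)" by (rule small_image[OF assms])
  hence "small T (Pow (e ` S))" using univ unfolding universe_def small_def by blast
  moreover have "inj_on ((`) e) (Pow S)" using e by (rule inj_on_image_Pow)
  moreover have "((`) e) ` Pow S \<subseteq> Pow (e ` S)" by blast
  ultimately show ?thesis by (metis small_inj_on)
qed

lemma small_Sigma:
  assumes "small T I" "\<And>i. i \<in> I \<Longrightarrow> small T (F i)"
  shows "small T (Sigma I F)"
proof -
  have "Sigma I F = (\<Union>i\<in>I. Pair i ` F i)" by blast
  thus ?thesis using assms by (simp add: small_UNION small_image)
qed

text \<open>Extensional functions are determined by their graphs, and graphs are subsets of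
  \<open>Sigma I F\<close>; the strong limit property enters through
  \<open>small_Pow\<close>.\<close>

lemma small_PiE:
  assumes "small T I" "\<And>i. i \<in> I \<Longrightarrow> small T (F i)"
  shows "small T (PiE I F)"
proof (rule small_inj_on)
  show "small T (Pow (Sigma I F))" using assms by (intro small_Pow small_Sigma)
  show "(\<lambda>f. {(i, f i) |i. i \<in> I}) ` PiE I F \<subseteq> Pow (Sigma I F)" by auto
  show "inj_on (\<lambda>f. {(i, f i) |i. i \<in> I}) (PiE I F)"
  proof (rule inj_onI)
    fix f g
    assume f: "f \<in> PiE I F" and g: "g \<in> PiE I F"
      and eq: "{(i, f i) |i. i \<in> I} = {(i, g i) |i. i \<in> I}"
    show "f = g" using f g by (rule PiE_ext) (use eq in blast)
  qed
qed

lemma small_infinite_superset: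
  assumes "small T S"
  obtains K :: "'u set" where "infinite K" "small T K" "|S| \<le>o |K|"
proof -
  have inf: "infinite (UNIV :: 'u set)" using universe_cinfinite unfolding cinfinite_def
    by (simp add: Field_card_of)
  have "natLeq <o |UNIV :: 'u set|" using univ unfolding universe_def by blast
  then have "small T (UNIV :: nat set)" by (meson card_of_nat small_countable ordIso_iff_ordLeq)
  \<comment> \<open>The copy of the naturals makes the set infinite; the disjoint sum is then
    relabelled by elements of \<open>'u\<close>.\<close>
  hence "small T ((Inl :: 'a \<Rightarrow> 'a + nat) ` S \<union> Inr ` (UNIV :: nat set))"
    using assms by (intro small_Un small_image)
  then obtain e :: "'a + nat \<Rightarrow> 'u" where e: "inj_on e (Inl ` S \<union> Inr ` UNIV)"
    using small_embedding by blast
  have sm: "small T (e ` (Inl ` S \<union> Inr ` UNIV))"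
    using \<open>small T (Inl ` S \<union> Inr ` UNIV)\<close> by (rule small_image)
  have "infinite (e ` (Inl ` S \<union> Inr ` (UNIV :: nat set)))"
  proof
    assume "finite (e ` (Inl ` S \<union> Inr ` (UNIV :: nat set)))"
    hence "finite (Inl ` S \<union> Inr ` (UNIV :: nat set))" using e finite_image_iff by blast
    hence "finite ((Inr :: nat \<Rightarrow> 'a + nat) ` UNIV)" by simp
    thus False by (simp add: finite_image_iff)
  qed
  moreover have "|S| \<le>o |e ` (Inl ` S \<union> Inr ` (UNIV :: nat set))|"
  proof -
    have "inj_on (e \<circ> Inl) S"
      by (rule comp_inj_on) (use e in \<open>auto intro: inj_on_subset\<close>)
    moreover have "(e \<circ> Inl) ` S \<subseteq> e ` (Inl ` S \<union> Inr ` UNIV)" by auto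
    ultimately show ?thesis using card_of_ordLeq by blast
  qed
  ultimately show thesis using that sm by blast
qed

text \<open>The successor of an infinite cardinal is regular, and it stays small because it is
  bounded by a power set.\<close>

lemma small_regular_cardinal_above:
  assumes "small T S"
  obtains lam :: "'u rel" where "small_regular_cardinal lam" "|S| <o lam"
proof -
  obtain K :: "'u set" where K: "infinite K" "small T K" "|S| \<le>o |K|"
    using small_infinite_superset[OF assms] .
  define r where "r = cardSuc |K|"
  have co: "Card_order r" unfolding r_def by (rule cardSuc_Card_order[OF card_of_Card_order])
  have inf: "infinite (Field r)"
    unfolding r_def using K(1) cardSuc_finite[OF card_of_Card_order[of K]]
      by (simp add: Field_card_of)
  have reg: "regularCard r"
    unfolding r_def by (rule infinite_cardSuc_regularCard[OF _ card_of_Card_order]) (use K(1) in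
      \<open>simp add: Field_card_of\<close>)
  have "r \<le>o |Pow K|"
    unfolding r_def by (rule cardSuc_least[OF card_of_Card_order card_of_Card_order card_of_Pow])
  moreover have "|Pow K| <o |UNIV :: 'u set|" using small_Pow[OF K(2)] unfolding small_def .
  ultimately have less: "r <o |UNIV :: 'u set|" by (rule ordLeq_ordLess_trans)
  have Fr: "|Field r| =o r" using co by (rule card_of_Field_ordIso)
  \<comment> \<open>The successor cardinal is a relation on sets of elements of \<open>'u\<close>,
    whereas \<open>small_regular_cardinal\<close> speaks of relations on \<open>'u\<close>; hence
    the relabelling by \<open>e\<close>.\<close>
  have "small T (Field r)" unfolding small_def using ordIso_ordLess_trans[OF Fr less] .
  then obtain e :: "_ \<Rightarrow> 'u" where e: "inj_on e (Field r)" using small_embedding by blast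
  define lam where "lam = |e ` Field r|"
  have "|Field r| =o lam" unfolding lam_def using e card_of_ordIso inj_on_imp_bij_betw by blast
  hence iso: "r =o lam" using Fr ordIso_symmetric ordIso_transitive by blast
  have ci: "Cinfinite r" using co inf unfolding cinfinite_def by blast
  have "regularCard lam" using regularCard_ordIso[OF iso ci reg] .
  moreover have "Card_order lam" unfolding lam_def by (rule card_of_Card_order)
  moreover have "infinite (Field lam)"
    using inf e unfolding lam_def by (simp_all add: Field_card_of finite_image_iff)
  moreover have "lam <o |UNIV :: 'u set|"
    using iso less ordIso_ordLess_trans ordIso_symmetric by blast
  ultimately have "small_regular_cardinal lam" unfolding small_regular_cardinal_def by blast
  moreover have "|S| <o lam"
  proof -
    have "|K| <o r" unfolding r_def by (rule cardSuc_greater[OF card_of_Card_order])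
    thus ?thesis using K(3) iso ordLeq_ordLess_trans ordLess_ordIso_trans by blast
  qed
  ultimately show thesis using that by blast
qed

end

section \<open>Categories, cocones and cones\<close>

lemma Hom_iff: "f \<in> Hom C x y \<longleftrightarrow> f \<in> Arr C \<and> Dom C f = x \<and> Cod C f = y"
  unfolding Hom_def by blast

lemma HomD: "f \<in> Hom C x y \<Longrightarrow> f \<in> Arr C" "f \<in> Hom C x y \<Longrightarrow> Dom C f = x"
  "f \<in> Hom C x y \<Longrightarrow> Cod C f = y"
  unfolding Hom_def by blast+

context category
begin

lemma Hom_Dom_Cod: "f \<in> Arr C \<Longrightarrow> f \<in> Hom C (Dom C f) (Cod C f)"
  unfolding Hom_def by blast

lemma Hom_Obj: "f \<in> Hom C x y \<Longrightarrow> x \<in> Obj C" "f \<in> Hom C x y \<Longrightarrow> y \<in> Obj C"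
  unfolding Hom_def using Dom_in_Obj Cod_in_Obj by blast+

lemma Comp_Arr:
  assumes "f \<in> Arr C" "g \<in> Arr C" "Dom C g = Cod C f"
  shows "Comp C g f \<in> Arr C" "Dom C (Comp C g f) = Dom C f" "Cod C (Comp C g f) = Cod C g"
  using Comp_in_Hom[of f "Dom C f" "Cod C f" g "Cod C g"] assms unfolding Hom_def by auto

lemma Ident_Arr:
  assumes "x \<in> Obj C"
  shows "Ident C x \<in> Arr C" "Dom C (Ident C x) = x" "Cod C (Ident C x) = x"
  using Ident_in_Hom[OF assms] unfolding Hom_def by auto

lemma Comp_Ident_Arr: "f \<in> Arr C \<Longrightarrow> Dom C f = x \<Longrightarrow> Comp C f (Ident C x) = f"
  using Comp_Ident unfolding Hom_def by blast

lemma Ident_Comp_Arr: "f \<in> Arr C \<Longrightarrow> Cod C f = y \<Longrightarrow> Comp C (Ident C y) f = f"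
  using Ident_Comp unfolding Hom_def by blast

lemma assoc_Arr:
  assumes "f \<in> Arr C" "g \<in> Arr C" "h \<in> Arr C" "Dom C g = Cod C f" "Dom C h = Cod C g"
  shows "Comp C (Comp C h g) f = Comp C h (Comp C g f)"
  using Comp_assoc[of f "Dom C f" "Cod C f" g "Cod C g" h "Cod C h"] assms
  unfolding Hom_def by auto

lemma assoc: "f \<in> Hom C w x \<Longrightarrow> g \<in> Hom C x y \<Longrightarrow> h \<in> Hom C y z \<Longrightarrow>
    Comp C (Comp C h g) f = Comp C h (Comp C g f)"
  using Comp_assoc by simp

lemmas cat_simps = Comp_Arr Ident_Arr Comp_Ident_Arr Ident_Comp_Arr assoc_Arr
  Dom_in_Obj Cod_in_Obj

end

lemma category_op_cat:
  assumes "category C"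
  shows "category (op_cat C)"
proof -
  interpret category C by fact
  show ?thesis
    by unfold_locales (auto simp: op_cat_def Hom_iff cat_simps)
qed

lemma op_cat_simps [simp]: "Obj (op_cat C) = Obj C" "Arr (op_cat C) = Arr C"
    "Dom (op_cat C) = Cod C"
  "Cod (op_cat C) = Dom C" "Comp (op_cat C) g f = Comp C f g" "Ident (op_cat C) = Ident C"
  by (simp_all add: op_cat_def)

lemma Hom_op_cat [simp]: "Hom (op_cat C) x y = Hom C y x"
  unfolding Hom_def by auto

lemma cat_functor_op_cat:
  assumes "cat_functor A B F"
  shows "cat_functor (op_cat A) (op_cat B) F"
proof -
  interpret cat_functor A B F by fact
  show ?thesis
    by (intro cat_functor.intro cat_functor_axioms.intro category_op_cat source.category_axioms
        target.category_axioms)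
      (auto simp: FObj_in_Obj FArr_in_Hom FArr_Ident FArr_Comp)
qed

lemma comp_ftor_simps [simp]: "FObj (comp_ftor G F) x = FObj G (FObj F x)"
  "FArr (comp_ftor G F) f = FArr G (FArr F f)"
  by (simp_all add: comp_ftor_def)

lemma cat_functor_comp_ftor:
  assumes "cat_functor A B F" "cat_functor B C G"
  shows "cat_functor A C (comp_ftor G F)"
proof -
  interpret F: cat_functor A B F by fact
  interpret G: cat_functor B C G by fact
  show ?thesis
    by unfold_locales
      (auto simp: F.FObj_in_Obj F.FArr_in_Hom F.FArr_Ident G.FObj_in_Obj G.FArr_in_Hom G.FArr_Ident
        F.FArr_Comp G.FArr_Comp[OF F.FArr_in_Hom F.FArr_in_Hom])
qed

context cat_functor
begin

lemma FArr_Arr: "f \<in> Arr A \<Longrightarrow> FArr F f \<in> Arr B" "f \<in> Arr A \<Longrightarrow> Dom B (FArr F f) = FObj F (Dom A f)"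
  "f \<in> Arr A \<Longrightarrow> Cod B (FArr F f) = FObj F (Cod A f)"
  using FArr_in_Hom[of f "Dom A f" "Cod A f"] unfolding Hom_def by auto

end

text \<open>In contrast to the objects of \<open>cocones\<close>, the legs are arbitrary outside
  \<open>Obj J\<close>, so that they can be written as plain functions. The translation back is done
  once, in \<open>multi_initial_cocones\<close> and \<open>is_colimit_iff\<close>.\<close>

definition cocone ::
  "('j, 'k) cat \<Rightarrow> ('o, 'm) cat \<Rightarrow> ('j, 'k, 'o, 'm) ftor \<Rightarrow> 'o \<Rightarrow> ('j \<Rightarrow> 'm) \<Rightarrow> bool" where
  "cocone J C D c l \<longleftrightarrow> c \<in> Obj C \<and> (\<forall>j \<in> Obj J. l j \<in> Hom C (FObj D j) c) \<and>
     (\<forall>u \<in> Arr J. Comp C (l (Cod J u)) (FArr D u) = l (Dom J u))"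

definition cone ::
  "('j, 'k) cat \<Rightarrow> ('o, 'm) cat \<Rightarrow> ('j, 'k, 'o, 'm) ftor \<Rightarrow> 'o \<Rightarrow> ('j \<Rightarrow> 'm) \<Rightarrow> bool" where
  "cone J C D c l \<longleftrightarrow> c \<in> Obj C \<and> (\<forall>j \<in> Obj J. l j \<in> Hom C c (FObj D j)) \<and>
     (\<forall>u \<in> Arr J. Comp C (FArr D u) (l (Dom J u)) = l (Cod J u))"

definition colimit ::
  "('j, 'k) cat \<Rightarrow> ('o, 'm) cat \<Rightarrow> ('j, 'k, 'o, 'm) ftor \<Rightarrow> 'o \<Rightarrow> ('j \<Rightarrow> 'm) \<Rightarrow> bool" where
  "colimit J C D c l \<longleftrightarrow> cocone J C D c l \<and>
     (\<forall>y m. cocone J C D y m \<longrightarrow> (\<exists>!h. h \<in> Hom C c y \<and> (\<forall>j \<in> Obj J. Comp C h (l j) = m j)))"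

definition limit ::
  "('j, 'k) cat \<Rightarrow> ('o, 'm) cat \<Rightarrow> ('j, 'k, 'o, 'm) ftor \<Rightarrow> 'o \<Rightarrow> ('j \<Rightarrow> 'm) \<Rightarrow> bool" where
  "limit J C D c l \<longleftrightarrow> cone J C D c l \<and>
     (\<forall>y m. cone J C D y m \<longrightarrow> (\<exists>!h. h \<in> Hom C y c \<and> (\<forall>j \<in> Obj J. Comp C (l j) h = m j)))"

definition multicolimit ::
  "('j, 'k) cat \<Rightarrow> ('o, 'm) cat \<Rightarrow> ('j, 'k, 'o, 'm) ftor
    \<Rightarrow> 'i set \<Rightarrow> ('i \<Rightarrow> 'o) \<Rightarrow> ('i \<Rightarrow> 'j \<Rightarrow> 'm) \<Rightarrow> bool" where
  "multicolimit J C D I X L \<longleftrightarrow> (\<forall>i \<in> I. cocone J C D (X i) (L i)) \<and>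
     (\<forall>y m. cocone J C D y m \<longrightarrow>
       (\<exists>!(i, h). i \<in> I \<and> h \<in> Hom C (X i) y \<and> (\<forall>j \<in> Obj J. Comp C h (L i j) = m j)))"

lemma multicolimit_cocone: "multicolimit J C D I X L \<Longrightarrow> i \<in> I \<Longrightarrow> cocone J C D (X i) (L i)"
  unfolding multicolimit_def by simp

lemma multicolimit_ex1: "multicolimit J C D I X L \<Longrightarrow> cocone J C D y m \<Longrightarrow>
    \<exists>!(i, h). i \<in> I \<and> h \<in> Hom C (X i) y \<and> (\<forall>j \<in> Obj J. Comp C h (L i j) = m j)"
  unfolding multicolimit_def by simp

lemma multicolimit_factor:
  assumes "multicolimit J C D I X L" "cocone J C D y m"
  obtains i h where "i \<in> I" "h \<in> Hom C (X i) y" "\<And>j. j \<in> Obj J \<Longrightarrow> Comp C h (L i j) = m j"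
  using multicolimit_ex1[OF assms] that by (auto simp: Ex1_def)

lemma multicolimit_unique:
  assumes "multicolimit J C D I X L" "cocone J C D y m"
    and "i \<in> I" "h \<in> Hom C (X i) y" "\<And>j. j \<in> Obj J \<Longrightarrow> Comp C h (L i j) = m j"
    and "i' \<in> I" "h' \<in> Hom C (X i') y" "\<And>j. j \<in> Obj J \<Longrightarrow> Comp C h' (L i' j) = m j"
  shows "i' = i" "h' = h"
proof -
  let ?P = "\<lambda>(i, h). i \<in> I \<and> h \<in> Hom C (X i) y \<and> (\<forall>j \<in> Obj J. Comp C h (L i j) = m j)"
  have "\<exists>!p. ?P p" by (rule multicolimit_ex1[OF assms(1,2)])
  moreover have "?P (i, h)" "?P (i', h')" using assms(3-8) by simp_all
  ultimately have "(i', h') = (i, h)" by blast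
  thus "i' = i" "h' = h" by simp_all
qed

lemma cocone_cong:
  assumes "category J" "\<And>j. j \<in> Obj J \<Longrightarrow> l j = l' j"
  shows "cocone J C D c l \<longleftrightarrow> cocone J C D c l'"
  using assms unfolding cocone_def by (simp add: category.Dom_in_Obj category.Cod_in_Obj)

lemma cone_op_cat [simp]: "cocone (op_cat J) (op_cat C) D c l \<longleftrightarrow> cone J C D c l"
  unfolding cocone_def cone_def by simp

lemma Obj_cat_of_homs [simp]: "Obj (cat_of_homs X H i c) = X"
  by (simp add: cat_of_homs_def)

lemma cat_of_homs_simps [simp]:
  "(x, h, y) \<in> Arr (cat_of_homs X H i c) \<longleftrightarrow> x \<in> X \<and> y \<in> X \<and> h \<in> H x y"
  "Dom (cat_of_homs X H i c) (x, h, y) = x"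
  "Cod (cat_of_homs X H i c) (x, h, y) = y"
  "Ident (cat_of_homs X H i c) x = (x, i x, x)"
  "Comp (cat_of_homs X H i c) (y', g, z) (x, h, y) = (x, c x g h, z)"
  by (simp_all add: cat_of_homs_def)

lemma Arr_cat_of_homs: "Arr (cat_of_homs X H i c) = (\<Union>x\<in>X. \<Union>y\<in>X. (\<lambda>h. (x, h, y)) ` H x y)"
  by (auto simp: cat_of_homs_def)

lemma Hom_cat_of_homs:
  "F \<in> Hom (cat_of_homs X H i c) x y \<longleftrightarrow> x \<in> X \<and> y \<in> X \<and> (\<exists>h\<in>H x y. F = (x, h, y))"
  by (cases F) (auto simp: Hom_iff)

lemma category_cat_of_homs:
  assumes "\<And>x. x \<in> X \<Longrightarrow> i x \<in> H x x"
    and "\<And>x y z f g. \<lbrakk>x \<in> X; y \<in> X; z \<in> X; f \<in> H x y; g \<in> H y z\<rbrakk> \<Longrightarrow> c x g f \<in> H x z"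
    and "\<And>x y f. \<lbrakk>x \<in> X; y \<in> X; f \<in> H x y\<rbrakk> \<Longrightarrow> c x f (i x) = f"
    and "\<And>x y f. \<lbrakk>x \<in> X; y \<in> X; f \<in> H x y\<rbrakk> \<Longrightarrow> c x (i y) f = f"
    and "\<And>w x y z f g h. \<lbrakk>w \<in> X; x \<in> X; y \<in> X; z \<in> X; f \<in> H w x; g \<in> H x y; h \<in> H y z\<rbrakk> \<Longrightarrow>
      c w h (c w g f) = c w (c x h g) f"
  shows "category (cat_of_homs X H i c)"
  by unfold_locales (use assms in \<open>auto simp: Hom_cat_of_homs\<close>)

lemma small_category_cat_of_homs:
  assumes "universe T" "category (cat_of_homs X H i c)" "small T X"
    "\<And>x y. x \<in> X \<Longrightarrow> y \<in> X \<Longrightarrow> small T (H x y)"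
  shows "small_category T (cat_of_homs X H i c)"
  unfolding small_category_def Arr_cat_of_homs
  using assms by (simp add: small_UNION small_image)

lemma ex1_pair_iff: "(\<exists>!(i, h). P i h) \<longleftrightarrow> (\<exists>i h. P i h \<and> (\<forall>i' h'. P i' h' \<longrightarrow> i' = i \<and> h' = h))"
  unfolding Ex1_def by (simp add: split_paired_All split_paired_Ex)

lemma ex1_cat_of_homs:
  assumes "\<And>i. i \<in> I \<Longrightarrow> Y i \<in> X" "x \<in> X"
  shows "(\<exists>!(i, f). i \<in> I \<and> f \<in> Hom (cat_of_homs X H e c) (Y i) x) \<longleftrightarrow>
    (\<exists>!(i, h). i \<in> I \<and> h \<in> H (Y i) x)" (is "?L \<longleftrightarrow> ?R")
proof -
  have eq: "i \<in> I \<and> f \<in> Hom (cat_of_homs X H e c) (Y i) x \<longleftrightarrow> i \<in> I \<and>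
    (\<exists>h\<in>H (Y i) x. f = (Y i, h, x))" for i f
    using assms by (auto simp: Hom_cat_of_homs)
  show ?thesis
    unfolding eq ex1_pair_iff
  proof
    assume "\<exists>i f. (i \<in> I \<and> (\<exists>h\<in>H (Y i) x. f = (Y i, h, x))) \<and>
      (\<forall>i' f'. i' \<in> I \<and> (\<exists>h\<in>H (Y i') x. f' = (Y i', h, x)) \<longrightarrow> i' = i \<and> f' = f)"
    then obtain i h where ih: "i \<in> I" "h \<in> H (Y i) x"
      and uniq: "\<And>i' h'. i' \<in> I \<Longrightarrow> h' \<in> H (Y i') x \<Longrightarrow> i' = i \<and> (Y i', h', x) = (Y i, h, x)"
      by blast
    show "\<exists>i h. (i \<in> I \<and> h \<in> H (Y i) x) \<and> (\<forall>i' h'. i' \<in> I \<and> h' \<in> H (Y i') x \<longrightarrow> i' = i \<and> h' = h)"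
      using ih uniq by (intro exI[of _ i] exI[of _ h]) blast
  next
    assume "\<exists>i h. (i \<in> I \<and> h \<in> H (Y i) x) \<and> (\<forall>i' h'. i' \<in> I \<and> h' \<in> H (Y i') x \<longrightarrow> i' = i \<and> h' = h)"
    then obtain i h where ih: "i \<in> I" "h \<in> H (Y i) x"
      and uniq: "\<And>i' h'. i' \<in> I \<Longrightarrow> h' \<in> H (Y i') x \<Longrightarrow> i' = i \<and> h' = h"
      by blast
    show "\<exists>i f. (i \<in> I \<and> (\<exists>h\<in>H (Y i) x. f = (Y i, h, x))) \<and>
      (\<forall>i' f'. i' \<in> I \<and> (\<exists>h\<in>H (Y i') x. f' = (Y i', h, x)) \<longrightarrow> i' = i \<and> f' = f)"
      using ih uniq by (intro exI[of _ i] exI[of _ "(Y i, h, x)"]) blast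
  qed
qed

lemma multi_initial_cat_of_homs:
  "multi_initial (cat_of_homs X H e c) I Y \<longleftrightarrow>
    (\<forall>i\<in>I. Y i \<in> X) \<and> (\<forall>x\<in>X. \<exists>!(i, h). i \<in> I \<and> h \<in> H (Y i) x)"
proof -
  have "(\<forall>x\<in>X. \<exists>!(i, f). i \<in> I \<and> f \<in> Hom (cat_of_homs X H e c) (Y i) x) \<longleftrightarrow>
      (\<forall>x\<in>X. \<exists>!(i, h). i \<in> I \<and> h \<in> H (Y i) x)" if "\<And>i. i \<in> I \<Longrightarrow> Y i \<in> X"
    by (rule ball_cong[OF refl ex1_cat_of_homs[OF that]])
  thus ?thesis unfolding multi_initial_def Obj_cat_of_homs by (intro conj_cong refl) simp
qed

text \<open>Makes colimits the multicolimits with a one-element index set, so that one translation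
  from \<open>cocones\<close> serves both.\<close>

lemma initial_object_iff_multi_initial: "initial_object C x \<longleftrightarrow> multi_initial C UNIV (\<lambda>_ :: unit. x)"
proof -
  have "(\<exists>!f. f \<in> Hom C x y) \<longleftrightarrow> (\<exists>!(i, f). i \<in> (UNIV :: unit set) \<and> f \<in> Hom C x y)" for y
    by (auto simp: Ex1_def)
  thus ?thesis unfolding initial_object_def multi_initial_def by auto
qed

lemma cocones_eq:
  "cocones J C D = cat_of_homs {(c, l). cocone J C D c l \<and> l \<in> extensional (Obj J)}
       (\<lambda>(c, l) (c', l'). {h \<in> Hom C c c'. \<forall>j \<in> Obj J. Comp C h (l j) = l' j})
       (\<lambda>(c, l). Ident C c)
       (\<lambda>_. Comp C)"
proof -
  have "{(c, l). c \<in> Obj C \<and> l \<in> (\<Pi>\<^sub>E j \<in> Obj J. Hom C (FObj D j) c) \<and>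
                (\<forall>u \<in> Arr J. Comp C (l (Cod J u)) (FArr D u) = l (Dom J u))} =
    {(c, l). cocone J C D c l \<and> l \<in> extensional (Obj J)}"
    unfolding cocone_def PiE_def by blast
  thus ?thesis unfolding cocones_def by simp
qed

text \<open>Restricting the legs of an arbitrary cocone to \<open>Obj J\<close> affects neither the
  cocone equations nor the factorizations, so testing on extensional cocones is the same as testing
  on all.\<close>

lemma multi_initial_cocones:
  assumes "category J"
  shows "multi_initial (cocones J C D) I Y \<longleftrightarrow>
    multicolimit J C D I (fst \<circ> Y) (snd \<circ> Y) \<and> (\<forall>i\<in>I. snd (Y i) \<in> extensional (Obj J))"
    (is "?L \<longleftrightarrow> ?R")
proof -
  let ?P = "\<lambda>m i h y. i \<in> I \<and> h \<in> Hom C (fst (Y i)) y \<and> (\<forall>j\<in>Obj J. Comp C h (snd (Y i) j) = m j)"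
  have "?L \<longleftrightarrow> (\<forall>i\<in>I. cocone J C D (fst (Y i)) (snd (Y i)) \<and> snd (Y i) \<in> extensional (Obj J)) \<and>
      (\<forall>y m. cocone J C D y m \<and> m \<in> extensional (Obj J) \<longrightarrow> (\<exists>!(i, h). ?P m i h y))"
    unfolding cocones_eq multi_initial_cat_of_homs by (auto simp: case_prod_beta)
  also have "(\<forall>y m. cocone J C D y m \<and> m \<in> extensional (Obj J) \<longrightarrow> (\<exists>!(i, h). ?P m i h y)) \<longleftrightarrow>
      (\<forall>y m. cocone J C D y m \<longrightarrow> (\<exists>!(i, h). ?P m i h y))" (is "?L' \<longleftrightarrow> ?R'")
  proof
    assume L: ?L'
    show ?R'
    proof (intro allI impI)
      fix y m assume "cocone J C D y m"
      hence "cocone J C D y (restrict m (Obj J))"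
        by (subst cocone_cong[OF assms, of _ m]) simp_all
      hence "\<exists>!(i, h). ?P (restrict m (Obj J)) i h y"
        using L restrict_extensional[of m "Obj J"] by blast
      thus "\<exists>!(i, h). ?P m i h y" by simp
    qed
  qed blast
  finally show ?thesis unfolding multicolimit_def by auto
qed

lemma limit_op_cat: "colimit (op_cat J) (op_cat C) D c l \<longleftrightarrow> limit J C D c l"
  unfolding colimit_def limit_def by simp

lemma is_colimit_iff:
  assumes "category J"
  shows "is_colimit J C D (c, l) \<longleftrightarrow> colimit J C D c l \<and> l \<in> extensional (Obj J)"
proof -
  have "multicolimit J C D UNIV (\<lambda>_ :: unit. c) (\<lambda>_. l) \<longleftrightarrow> colimit J C D c l"
    unfolding multicolimit_def colimit_def by (auto simp: Ex1_def)
  thus ?thesis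
    unfolding is_colimit_def initial_object_iff_multi_initial multi_initial_cocones[OF assms]
    by (simp add: comp_def)
qed

lemma is_limit_iff:
  assumes "category J"
  shows "is_limit J C D (c, l) \<longleftrightarrow> limit J C D c l \<and> l \<in> extensional (Obj J)"
  unfolding is_limit_def is_colimit_iff[OF category_op_cat[OF assms]] limit_op_cat by simp

lemma colimit_cong:
  assumes "category J" "\<And>j. j \<in> Obj J \<Longrightarrow> l j = l' j"
  shows "colimit J C D c l \<longleftrightarrow> colimit J C D c l'"
proof -
  have "(\<forall>j\<in>Obj J. Comp C h (l j) = m j) \<longleftrightarrow> (\<forall>j\<in>Obj J. Comp C h (l' j) = m j)" for h m
    using assms(2) by simp
  thus ?thesis unfolding colimit_def by (subst cocone_cong[OF assms]) simp_all
qed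

section \<open>Change of index category\<close>

text \<open>The definitions of preservation and multicocompleteness quantify over index categories
  on \<open>'u\<close> only. The index categories of the proof (elements, cones, sets of elements)
  live on other types and are relabelled along injections.\<close>

definition transport_cat :: "('j \<Rightarrow> 'j2) \<Rightarrow> ('k \<Rightarrow> 'k2) \<Rightarrow> ('j, 'k) cat \<Rightarrow> ('j2, 'k2) cat" where
  "transport_cat e e' J = \<lparr>Obj = e ` Obj J, Arr = e' ` Arr J,
     Dom = (\<lambda>f. e (Dom J (inv_into (Arr J) e' f))), Cod = (\<lambda>f. e (Cod J (inv_into (Arr J) e' f))),
     Ident = (\<lambda>x. e' (Ident J (inv_into (Obj J) e x))),
     Comp = (\<lambda>g f. e' (Comp J (inv_into (Arr J) e' g) (inv_into (Arr J) e' f)))\<rparr>"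

definition transport_back ::
  "('j \<Rightarrow> 'j2) \<Rightarrow> ('k \<Rightarrow> 'k2) \<Rightarrow> ('j, 'k) cat \<Rightarrow> ('j2, 'k2, 'j, 'k) ftor" where
  "transport_back e e' J = \<lparr>FObj = inv_into (Obj J) e, FArr = inv_into (Arr J) e'\<rparr>"

lemma transport_cat_op_cat: "transport_cat e e' (op_cat J) = op_cat (transport_cat e e' J)"
  by (simp add: transport_cat_def op_cat_def)

locale transport = category J for J :: "('j, 'k) cat" +
  fixes e :: "'j \<Rightarrow> 'j2" and e' :: "'k \<Rightarrow> 'k2"
  assumes inj_e: "inj_on e (Obj J)" and inj_e': "inj_on e' (Arr J)"
begin

abbreviation "J' \<equiv> transport_cat e e' J"
abbreviation "back \<equiv> transport_back e e' J"

lemma J'_simps [simp]: "Obj J' = e ` Obj J" "Arr J' = e' ` Arr J"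
  "f \<in> Arr J \<Longrightarrow> Dom J' (e' f) = e (Dom J f)" "f \<in> Arr J \<Longrightarrow> Cod J' (e' f) = e (Cod J f)"
  "x \<in> Obj J \<Longrightarrow> Ident J' (e x) = e' (Ident J x)"
  "f \<in> Arr J \<Longrightarrow> g \<in> Arr J \<Longrightarrow> Comp J' (e' g) (e' f) = e' (Comp J g f)"
  using inj_e inj_e' by (simp_all add: transport_cat_def)

lemma back_simps [simp]: "x \<in> Obj J \<Longrightarrow> FObj back (e x) = x" "f \<in> Arr J \<Longrightarrow> FArr back (e' f) = f"
  using inj_e inj_e' by (simp_all add: transport_back_def)

lemma e_eq: "x \<in> Obj J \<Longrightarrow> y \<in> Obj J \<Longrightarrow> e x = e y \<longleftrightarrow> x = y"
  using inj_e by (meson inj_on_eq_iff)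

lemma Hom_J': "F \<in> Hom J' x y \<longleftrightarrow>
    (\<exists>f x0 y0. F = e' f \<and> x = e x0 \<and> y = e y0 \<and> f \<in> Hom J x0 y0)"
  unfolding Hom_iff by (auto simp: cat_simps)

lemma category_J': "category J'"
  by unfold_locales (auto simp: Hom_iff cat_simps e_eq)

lemma cat_functor_back: "cat_functor J' J back"
  by (intro cat_functor.intro category_J' category_axioms cat_functor_axioms.intro)
    (auto simp: Hom_iff cat_simps e_eq)

lemma cocone_J':
  "cocone J' C (comp_ftor D back) y m \<longleftrightarrow> cocone J C D y (\<lambda>j. m (e j))"
  unfolding cocone_def by auto

lemma cocone_J'_back:
  "cocone J C D y m \<longleftrightarrow> cocone J' C (comp_ftor D back) y (\<lambda>j. m (FObj back j))"
  unfolding cocone_J' by (rule cocone_cong[OF category_axioms]) simp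

lemma colimit_J':
  "colimit J' C (comp_ftor D back) c l \<longleftrightarrow> colimit J C D c (\<lambda>j. l (e j))" (is "?L \<longleftrightarrow> ?R")
proof
  assume L: ?L
  show ?R
    unfolding colimit_def
  proof (intro conjI allI impI)
    show "cocone J C D c (\<lambda>j. l (e j))" using L unfolding colimit_def cocone_J' by blast
    fix y m assume "cocone J C D y m"
    hence "cocone J' C (comp_ftor D back) y (\<lambda>j. m (FObj back j))"
      by (rule iffD1[OF cocone_J'_back])
    from L[unfolded colimit_def, THEN conjunct2, rule_format, OF this]
    show "\<exists>!h. h \<in> Hom C c y \<and> (\<forall>j\<in>Obj J. Comp C h (l (e j)) = m j)"
      by simp
  qed
next
  assume R: ?R
  thus ?L unfolding colimit_def cocone_J' by simp
qed

text \<open>A diagram in the copy is moved back to \<open>J\<close>; the cocone found there is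
  pushed forward along \<open>e\<close> and \<open>e'\<close>.\<close>

lemma lam_filtered_J':
  fixes T :: "'u itself"
  assumes "lam_filtered T lam J"
  shows "lam_filtered T lam J'"
  unfolding lam_filtered_def
proof (intro conjI allI impI category_J')
  fix K :: "('u, 'u) cat" and D assume KD: "cat_functor K J' D \<and> |Arr K| <o lam"
  have f: "cat_functor K J (comp_ftor back D)"
    using KD cat_functor_back cat_functor_comp_ftor by blast
  interpret D: cat_functor K J' D using KD by blast
  from f KD assms have "Obj (cocones K J (comp_ftor back D)) \<noteq> {}"
    unfolding lam_filtered_def by blast
  then obtain y m where m: "cocone K J (comp_ftor back D) y m" unfolding cocones_eq by auto
  have "cocone K J' D (e y) (restrict (\<lambda>k. e' (m k)) (Obj K))"
    unfolding cocone_def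
  proof (intro conjI ballI)
    show "e y \<in> Obj J'" using m unfolding cocone_def by simp
    fix k assume k: "k \<in> Obj K"
    then obtain x where x: "x \<in> Obj J" "FObj D k = e x" using D.FObj_in_Obj[OF k] by auto
    have "m k \<in> Hom J x y" using m k x unfolding cocone_def by auto
    thus "restrict (\<lambda>k. e' (m k)) (Obj K) k \<in> Hom J' (FObj D k) (e y)"
      using k x unfolding Hom_J' by auto
  next
    fix u assume u: "u \<in> Arr K"
    then obtain f where f: "f \<in> Arr J" "FArr D u = e' f" using D.FArr_Arr(1)[OF u] by auto
    have o: "Cod K u \<in> Obj K" "Dom K u \<in> Obj K"
      using u by (simp_all add: D.source.Dom_in_Obj D.source.Cod_in_Obj)
    have "m (Cod K u) \<in> Arr J" using m o unfolding cocone_def Hom_iff by blast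
    moreover have "Comp J (m (Cod K u)) f = m (Dom K u)"
      using m u f unfolding cocone_def by auto
    ultimately show "Comp J' (restrict (\<lambda>k. e' (m k)) (Obj K) (Cod K u)) (FArr D u) =
        restrict (\<lambda>k. e' (m k)) (Obj K) (Dom K u)"
      using f o by simp
  qed
  thus "Obj (cocones K J' D) \<noteq> {}" unfolding cocones_eq by auto
qed

lemma preserves_colimits_J':
  assumes "preserves_colimits_of_shape J' A B F"
  shows "preserves_colimits_of_shape J A B F"
  unfolding preserves_colimits_of_shape_def
proof (intro allI impI)
  fix D c assume D: "cat_functor J A D \<and> is_colimit J A D c"
  obtain c0 l where c: "c = (c0, l)" by (cases c)
  let ?l = "\<lambda>j'\<in>Obj J'. l (FObj back j')"
  have "colimit J A D c0 l" "l \<in> extensional (Obj J)"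
    using D unfolding c is_colimit_iff[OF category_axioms] by blast+
  hence "colimit J A D c0 (\<lambda>j. ?l (e j))"
    by (subst colimit_cong[OF category_axioms, of _ l]) simp_all
  hence "is_colimit J' A (comp_ftor D back) (c0, ?l)"
    unfolding is_colimit_iff[OF category_J'] colimit_J' by simp
  moreover have "cat_functor J' A (comp_ftor D back)"
    using D cat_functor_back cat_functor_comp_ftor by blast
  ultimately have "is_colimit J' B (comp_ftor F (comp_ftor D back)) (image_cocone J' F (c0, ?l))"
    using assms unfolding preserves_colimits_of_shape_def by blast
  moreover have "comp_ftor F (comp_ftor D back) = comp_ftor (comp_ftor F D) back"
    by (simp add: comp_ftor_def comp_assoc)
  ultimately have "colimit J B (comp_ftor F D) (FObj F c0) (\<lambda>j. (\<lambda>j'\<in>Obj J'. FArr F (?l j')) (e j))"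
    unfolding image_cocone_def by (simp add: is_colimit_iff[OF category_J'] colimit_J')
  hence "colimit J B (comp_ftor F D) (FObj F c0) (\<lambda>j\<in>Obj J. FArr F (l j))"
    by (subst (asm) colimit_cong[OF category_axioms, of _ "\<lambda>j\<in>Obj J. FArr F (l j)"]) simp_all
  thus "is_colimit J B (comp_ftor F D) (image_cocone J F c)"
    unfolding image_cocone_def c by (simp add: is_colimit_iff[OF category_axioms])
qed

lemma multicolimit_J':
  assumes "multicolimit J' C (comp_ftor D back) I X L"
  shows "multicolimit J C D I X (\<lambda>i j. L i (e j))"
  unfolding multicolimit_def
proof (intro conjI allI impI ballI)
  fix i assume "i \<in> I" thus "cocone J C D (X i) (\<lambda>j. L i (e j))"
    using multicolimit_cocone[OF assms] unfolding cocone_J' by simp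
next
  fix y m assume "cocone J C D y m"
  hence "cocone J' C (comp_ftor D back) y (\<lambda>j. m (FObj back j))" by (rule iffD1[OF cocone_J'_back])
  from multicolimit_ex1[OF assms this]
  show "\<exists>!(i, h). i \<in> I \<and> h \<in> Hom C (X i) y \<and> (\<forall>j\<in>Obj J. Comp C h (L i (e j)) = m j)"
    by simp
qed

lemma connected_J':
  assumes "connected_category J"
  shows "connected_category J'"
  unfolding connected_category_def
proof (intro conjI ballI category_J')
  show "Obj J' \<noteq> {}" using assms unfolding connected_category_def by simp
  let ?R = "\<lambda>J. {(Dom J f, Cod J f) |f. f \<in> Arr J} \<union> {(Cod J f, Dom J f) |f. f \<in> Arr J}"
  fix x' y' assume "x' \<in> Obj J'" "y' \<in> Obj J'"
  then obtain x y where xy: "x \<in> Obj J" "y \<in> Obj J" "x' = e x" "y' = e y" by auto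
  have "(x, y) \<in> (?R J)\<^sup>*" using assms xy unfolding connected_category_def by blast
  hence "(e x, e y) \<in> (?R J')\<^sup>*"
  proof induction
    case (step y z)
    have "(e y, e z) \<in> ?R J'"
    proof -
      from step.hyps(2) obtain f where "f \<in> Arr J"
        "(y, z) = (Dom J f, Cod J f) \<or> (y, z) = (Cod J f, Dom J f)"
        by blast
      moreover from \<open>f \<in> Arr J\<close> have "e' f \<in> Arr J'" "Dom J' (e' f) = e (Dom J f)"
        "Cod J' (e' f) = e (Cod J f)" by simp_all
      ultimately show ?thesis by (smt (verit) Pair_inject UnI1 UnI2 mem_Collect_eq)
    qed
    thus ?case using step.IH by (rule rtrancl_into_rtrancl[rotated])
  qed simp
  thus "(x', y') \<in> (?R J')\<^sup>*" using xy by simp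
qed

end

lemma small_category_transport:
  fixes T :: "'u itself" and J :: "('j, 'k) cat"
  assumes "small_category T J"
  obtains e :: "'j \<Rightarrow> 'u" and e' :: "'k \<Rightarrow> 'u"
  where "transport J e e'" "small_category T (transport_cat e e' J)"
proof -
  obtain e :: "'j \<Rightarrow> 'u" and e' :: "'k \<Rightarrow> 'u" where "inj_on e (Obj J)" "inj_on e' (Arr J)"
    using assms small_embedding unfolding small_category_def by metis
  hence tr: "transport J e e'"
    using assms unfolding small_category_def transport_def transport_axioms_def by blast
  moreover have "small_category T (transport_cat e e' J)"
    using assms transport.category_J'[OF tr] transport.J'_simps(1,2)[OF tr]
    unfolding small_category_def by (simp add: small_image)
  ultimately show thesis using that by blast
qed

lemma multicocomplete_small:
  fixes T :: "'u itself"
  assumes "multicocomplete T C" "small_category T J" "cat_functor J C D"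
  obtains I :: "'u set" and X L where "small T I" "multicolimit J C D I X L"
proof -
  obtain e :: "_ \<Rightarrow> 'u" and e' :: "_ \<Rightarrow> 'u" where tr: "transport J e e'"
    and sm: "small_category T (transport_cat e e' J)"
    using small_category_transport[OF assms(2)] .
  interpret transport J e e' by (rule tr)
  have "cat_functor J' C (comp_ftor D back)"
    using assms(3) cat_functor_back cat_functor_comp_ftor by blast
  with assms(1) sm have "has_small_multi_initial_family T (cocones J' C (comp_ftor D back))"
    unfolding multicocomplete_def by simp
  then obtain I :: "'u set" and Y where I: "small T I"
    and Y: "multi_initial (cocones J' C (comp_ftor D back)) I Y"
    unfolding has_small_multi_initial_family_def by auto
  from Y have "multicolimit J' C (comp_ftor D back) I (fst \<circ> Y) (snd \<circ> Y)"
    by (simp add: multi_initial_cocones[OF category_J'])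
  from that[OF I multicolimit_J'[OF this]] show thesis .
qed

lemma preserves_lam_filtered_colimits_small:
  fixes T :: "'u itself"
  assumes "preserves_lam_filtered_colimits T lam A B F" "small_category T J" "lam_filtered T lam J"
  shows "preserves_colimits_of_shape J A B F"
proof -
  obtain e :: "_ \<Rightarrow> 'u" and e' :: "_ \<Rightarrow> 'u" where tr: "transport J e e'"
    and sm: "small_category T (transport_cat e e' J)"
    using small_category_transport[OF assms(2)] .
  have "preserves_colimits_of_shape (transport_cat e e' J) A B F"
    using assms(1) sm transport.lam_filtered_J'[OF tr assms(3)]
    unfolding preserves_lam_filtered_colimits_def by simp
  thus ?thesis by (rule transport.preserves_colimits_J'[OF tr])
qed

lemma preserves_connected_limits_small:
  fixes T :: "'u itself"
  assumes "preserves_connected_limits T A B F" "small_category T J" "connected_category J"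
    "cat_functor J A D" "limit J A D c l"
  shows "limit J B (comp_ftor F D) (FObj F c) (\<lambda>j. FArr F (l j))"
proof -
  obtain e :: "_ \<Rightarrow> 'u" and e' :: "_ \<Rightarrow> 'u" where tr: "transport J e e'"
    and sm: "small_category T (transport_cat e e' J)"
    using small_category_transport[OF assms(2)] .
  interpret transport J e e' by (rule tr)
  have op: "transport (op_cat J) e e'"
    by (intro transport.intro transport_axioms.intro category_op_cat category_axioms)
      (simp_all only: op_cat_simps inj_e inj_e')
  have pl: "preserves_limits_of_shape J' A B F"
    using assms(1) sm connected_J'[OF assms(3)] unfolding preserves_connected_limits_def by simp
  \<comment> \<open>\<open>op_cat\<close> is strictly involutive, so the diagrams of shape
    \<open>op_cat J'\<close> in \<open>op_cat A\<close> are exactly those of shape \<open>J'\<close>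
    in \<open>A\<close>. Preservation of limits thereby becomes preservation of colimits, for which
    transport is already proved.\<close>
  have "cat_functor (op_cat (op_cat X)) (op_cat (op_cat Y)) D = cat_functor X Y D" for X Y D
    by (simp add: op_cat_def)
  hence cf: "cat_functor (op_cat J') (op_cat A) D \<longleftrightarrow> cat_functor J' A D" for D
    using cat_functor_op_cat[of J' A D] cat_functor_op_cat[of "op_cat J'" "op_cat A" D] by auto
  have "preserves_colimits_of_shape (op_cat J') (op_cat A) (op_cat B) F"
    using pl unfolding preserves_limits_of_shape_def preserves_colimits_of_shape_def is_limit_def cf
    by (simp add: image_cocone_def)
  hence pc: "preserves_colimits_of_shape (op_cat J) (op_cat A) (op_cat B) F"
    by (rule transport.preserves_colimits_J'[OF op, unfolded transport_cat_op_cat])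
  have cop: "category (op_cat J)" by (rule category_op_cat[OF category_axioms])
  have "limit J A D c (restrict l (Obj J))"
    using assms(5) unfolding limit_op_cat[symmetric]
    by (subst colimit_cong[OF cop, of _ l]) simp_all
  hence "is_colimit (op_cat J) (op_cat A) D (c, restrict l (Obj J))"
    unfolding is_colimit_iff[OF cop] limit_op_cat by simp
  with pc cat_functor_op_cat[OF assms(4)] have "is_colimit (op_cat J) (op_cat B) (comp_ftor F D)
      (image_cocone (op_cat J) F (c, restrict l (Obj J)))"
    unfolding preserves_colimits_of_shape_def by simp
  hence "limit J B (comp_ftor F D) (FObj F c) (\<lambda>j\<in>Obj J. FArr F (restrict l (Obj J) j))"
    by (simp add: image_cocone_def is_colimit_iff[OF cop] limit_op_cat)
  thus ?thesis
    unfolding limit_op_cat[symmetric]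
    by (subst (asm) colimit_cong[OF cop, of _ "\<lambda>j. FArr F (l j)"]) simp_all
qed

lemma ex1_unique: "\<exists>!x. P x \<Longrightarrow> P x \<Longrightarrow> P y \<Longrightarrow> x = y"
  by blast

section \<open>Filtered categories\<close>

text \<open>One hypothesis that covers both \<open>natLeq\<close> and the small regular cardinals.
  The bound by the universe makes sets of size below \<open>lam\<close> small, so that diagrams of
  that size can be relabelled on \<open>'u\<close>.\<close>

definition index_cardinal :: "'u itself \<Rightarrow> 'l rel \<Rightarrow> bool" where
  "index_cardinal T lam \<longleftrightarrow> Cinfinite lam \<and> lam \<le>o |UNIV :: 'u set|"

lemma index_cardinal_small: "index_cardinal T lam \<Longrightarrow> |P| <o lam \<Longrightarrow> small T P"
  unfolding index_cardinal_def small_def by (blast intro: ordLess_ordLeq_trans)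

lemma index_cardinal_natLeq: "universe T \<Longrightarrow> index_cardinal T natLeq"
  unfolding index_cardinal_def universe_def using natLeq_Cinfinite ordLess_imp_ordLeq by blast

lemma index_cardinal_small_regular: "small_regular_cardinal lam \<Longrightarrow>
    index_cardinal (T :: 'u itself) (lam :: 'u rel)"
  unfolding index_cardinal_def small_regular_cardinal_def cinfinite_def
  using ordLess_imp_ordLeq by blast

lemma index_cardinal_finite: "index_cardinal T lam \<Longrightarrow> finite P \<Longrightarrow> |P| <o lam"
  unfolding index_cardinal_def
  by (rule ordLess_ordLeq_trans[OF _ natLeq_ordLeq_cinfinite]) (simp_all add:
    finite_iff_ordLess_natLeq)

lemma index_cardinal_Plus: "index_cardinal T lam \<Longrightarrow> |P| <o lam \<Longrightarrow> |Q| <o lam \<Longrightarrow> |P <+> Q| <o lam"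
  unfolding index_cardinal_def cinfinite_def by (simp add: card_of_Plus_ordLess_infinite_Field)

lemma lam_filtered_mono:
  fixes T :: "'u itself"
  assumes "lam' \<le>o lam" "lam_filtered T lam J"
  shows "lam_filtered T lam' J"
proof -
  have "|S| <o lam" if "|S| <o lam'" for S :: "'u set"
    using ordLess_ordLeq_trans[OF that assms(1)] .
  thus ?thesis using assms(2) unfolding lam_filtered_def by blast
qed

lemma lam_filtered_imp_filtered:
  assumes "index_cardinal T lam" "lam_filtered T lam J"
  shows "filtered T J"
  using assms lam_filtered_mono natLeq_ordLeq_cinfinite unfolding index_cardinal_def by blast

lemma lam_filtered_cocone:
  fixes T :: "'u itself"
  assumes "lam_filtered T lam J" "small_category T K" "|Arr K| <o lam" "cat_functor K J D"
  obtains y m where "cocone K J D y m"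
proof -
  obtain e :: "_ \<Rightarrow> 'u" and e' :: "_ \<Rightarrow> 'u" where tr: "transport K e e'"
    using small_category_transport[OF assms(2)] by blast
  interpret transport K e e' by (rule tr)
  have "cat_functor J' J (comp_ftor D back)"
    by (rule cat_functor_comp_ftor[OF cat_functor_back assms(4)])
  moreover have "|Arr J'| <o lam" using card_of_image[of e' "Arr K"]
    assms(3) ordLeq_ordLess_trans by auto
  ultimately have "Obj (cocones J' J (comp_ftor D back)) \<noteq> {}"
    using assms(1) unfolding lam_filtered_def by simp
  then obtain y m where "cocone J' J (comp_ftor D back) y m" unfolding cocones_eq by auto
  hence "cocone K J D y (\<lambda>j. m (e j))" unfolding cocone_J' .
  thus thesis by (rule that)
qed

text \<open>The free category on a bipartite graph with edges from \<open>V\<close> to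
  \<open>W\<close>. Two edges are never composable, so in every composite one factor is an identity.
  Upper bounds, completions of several arrows out of one object, and coequalized parallel pairs all
  arise as cocones over such diagrams.\<close>

definition bipartite_cat ::
  "'v set \<Rightarrow> 'w set \<Rightarrow> 'e set \<Rightarrow> ('e \<Rightarrow> 'v) \<Rightarrow> ('e \<Rightarrow> 'w) \<Rightarrow> ('v + 'w, ('v + 'w) + 'e) cat" where
  "bipartite_cat V W E s t = \<lparr>Obj = V <+> W, Arr = (V <+> W) <+> E,
     Dom = case_sum (\<lambda>x. x) (\<lambda>e. Inl (s e)), Cod = case_sum (\<lambda>x. x) (\<lambda>e. Inr (t e)),
     Ident = Inl, Comp = (\<lambda>g f. case g of Inl _ \<Rightarrow> f | Inr _ \<Rightarrow> g)\<rparr>"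

lemma lam_filtered_bipartite:
  fixes dV :: "'v \<Rightarrow> 'j" and dW :: "'w \<Rightarrow> 'j"
  assumes lam: "index_cardinal T lam" and J: "lam_filtered T lam J"
    and VWE: "|V| <o lam" "|W| <o lam" "|E| <o lam"
    and dV: "\<And>v. v \<in> V \<Longrightarrow> dV v \<in> Obj J" and dW: "\<And>w. w \<in> W \<Longrightarrow> dW w \<in> Obj J"
    and s: "\<And>e. e \<in> E \<Longrightarrow> s e \<in> V" and t: "\<And>e. e \<in> E \<Longrightarrow> t e \<in> W"
    and d: "\<And>e. e \<in> E \<Longrightarrow> d e \<in> Hom J (dV (s e)) (dW (t e))"
  obtains y mV mW where "y \<in> Obj J" "\<And>v. v \<in> V \<Longrightarrow> mV v \<in> Hom J (dV v) y"
    "\<And>w. w \<in> W \<Longrightarrow> mW w \<in> Hom J (dW w) y" "\<And>e. e \<in> E \<Longrightarrow> Comp J (mW (t e)) (d e) = mV (s e)"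
proof -
  let ?K = "bipartite_cat V W E s t"
  let ?D = "\<lparr>FObj = case_sum dV dW, FArr = case_sum (\<lambda>x. Ident J (case_sum dV dW x)) d\<rparr>"
  interpret J: category J using J unfolding lam_filtered_def by blast
  have K: "category ?K"
    by unfold_locales (auto simp: bipartite_cat_def Hom_iff s t split: sum.splits)
  have D: "cat_functor ?K J ?D"
    by (intro cat_functor.intro K J.category_axioms cat_functor_axioms.intro)
      (use d in \<open>auto simp: bipartite_cat_def Hom_iff dV dW J.cat_simps\<close>)
  have card: "|Arr ?K| <o lam"
    using VWE by (simp add: bipartite_cat_def index_cardinal_Plus[OF lam])
  have "|Obj ?K| <o lam"
    using VWE by (simp add: bipartite_cat_def index_cardinal_Plus[OF lam])
  from index_cardinal_small[OF lam this] index_cardinal_small[OF lam card] K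
  have "small_category T ?K" unfolding small_category_def by simp
  from lam_filtered_cocone[OF J this card D] obtain y m where m: "cocone ?K J ?D y m" .
  show thesis
  proof (rule that[of y "\<lambda>v. m (Inl v)" "\<lambda>w. m (Inr w)"])
    show "y \<in> Obj J" using m unfolding cocone_def by simp
    have mo: "m j \<in> Hom J (case_sum dV dW j) y" if "j \<in> V <+> W" for j
      using m that unfolding cocone_def by (simp add: bipartite_cat_def)
    show "m (Inl v) \<in> Hom J (dV v) y" if "v \<in> V" for v using mo[OF InlI[OF that]] by simp
    show "m (Inr w) \<in> Hom J (dW w) y" if "w \<in> W" for w using mo[OF InrI[OF that]] by simp
    show "Comp J (m (Inr (t e))) (d e) = m (Inl (s e))" if "e \<in> E" for e
    proof -
      have "Inr e \<in> Arr ?K" using that by (simp add: bipartite_cat_def InrI)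
      with m have "Comp J (m (Cod ?K (Inr e))) (FArr ?D (Inr e)) = m (Dom ?K (Inr e))"
        unfolding cocone_def by blast
      thus ?thesis by (simp add: bipartite_cat_def)
    qed
  qed
qed

lemma lam_filtered_upper_bound:
  fixes f :: "'p \<Rightarrow> 'j"
  assumes "index_cardinal T lam" "lam_filtered T lam J" "|P| <o lam" "\<And>p. p \<in> P \<Longrightarrow> f p \<in> Obj J"
  obtains y v where "y \<in> Obj J" "\<And>p. p \<in> P \<Longrightarrow> v p \<in> Hom J (f p) y"
proof -
  have e: "|{} :: 'p set| <o lam" "|{} :: 'e set| <o lam"
    by (simp_all add: index_cardinal_finite[OF assms(1)])
  show thesis
  proof (rule lam_filtered_bipartite[OF assms(1-3) e(1) e(1),
    of f undefined undefined undefined undefined])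
    fix y mV mW
    assume "y \<in> Obj J" "\<And>v. v \<in> P \<Longrightarrow> mV v \<in> Hom J (f v) y"
    thus thesis by (rule that)
  qed (use assms(4) in auto)
qed

text \<open>The graph is a star: a single source vertex and one edge to a separate vertex for each
  \<open>h\<close>. The leg at the source is the common composite \<open>w\<close>.\<close>

lemma lam_filtered_cospan:
  fixes k :: "'h \<Rightarrow> 'j"
  assumes lam: "index_cardinal T lam" and J: "lam_filtered T lam J" and "|H| <o lam" "j \<in> Obj J"
    and "\<And>h. h \<in> H \<Longrightarrow> u h \<in> Hom J j (k h)"
  obtains y w v where "y \<in> Obj J" "w \<in> Hom J j y" "\<And>h. h \<in> H \<Longrightarrow> v h \<in> Hom J (k h) y"
    "\<And>h. h \<in> H \<Longrightarrow> Comp J (v h) (u h) = w"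
proof -
  have e: "|{()}| <o lam" by (simp add: index_cardinal_finite[OF lam])
  interpret J: category J using J unfolding lam_filtered_def by blast
  have k: "k h \<in> Obj J" if "h \<in> H" for h using assms(5)[OF that] by (rule J.Hom_Obj(2))
  show thesis
  proof (rule lam_filtered_bipartite[OF lam J e assms(3) assms(3), of "\<lambda>_. j" k "\<lambda>_. ()" "\<lambda>h. h" u])
    fix y mV mW
    assume "y \<in> Obj J" "\<And>v. v \<in> {()} \<Longrightarrow> mV v \<in> Hom J j y"
      "\<And>w. w \<in> H \<Longrightarrow> mW w \<in> Hom J (k w) y" "\<And>e. e \<in> H \<Longrightarrow> Comp J (mW e) (u e) = mV ()"
    thus thesis using that[of y "mV ()" mW] by simp
  qed (use assms(4,5) k in auto)
qed

lemma filtered_coequalize: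
  assumes T: "universe T" and J: "filtered T J" and "u \<in> Hom J j k" "v \<in> Hom J j k"
  obtains y w where "w \<in> Hom J k y" "Comp J w u = Comp J w v"
proof -
  have lam: "index_cardinal T natLeq" by (rule index_cardinal_natLeq[OF T])
  have e: "|{()}| <o natLeq" "|UNIV :: bool set| <o natLeq"
    by (simp_all add: index_cardinal_finite[OF lam])
  interpret J: category J using J unfolding lam_filtered_def by blast
  have jk: "j \<in> Obj J" "k \<in> Obj J" using J.Hom_Obj[OF assms(3)] .
  show thesis
  proof (rule lam_filtered_bipartite[OF lam J e(1) e(1) e(2), of "\<lambda>_. j" "\<lambda>_. k" "\<lambda>_. ()" "\<lambda>_. ()"
    "\<lambda>b. if b then u else v"])
    fix y mV mW
    assume mW: "\<And>w. w \<in> {()} \<Longrightarrow> mW w \<in> Hom J k y"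
      and eq: "\<And>e. e \<in> UNIV \<Longrightarrow> Comp J (mW ()) (if e then u else v) = mV ()"
    have "Comp J (mW ()) u = Comp J (mW ()) v" using eq[of True] eq[of False] by simp
    thus thesis using that[of "mW ()" y] mW[of "()"] by simp
  qed (use assms(3,4) jk in auto)
qed

section \<open>Finitely presented objects\<close>

lemma set_cat_Hom: "F \<in> Hom (set_cat T) S S' \<longleftrightarrow> small T S \<and> small T S' \<and>
    (\<exists>h \<in> S \<rightarrow>\<^sub>E S'. F = (S, h, S'))"
  unfolding set_cat_def Hom_cat_of_homs by simp

text \<open>The universal property of a colimit of hom-sets, tested against a small set
  \<open>S\<close> and freed from the domain and codomain tags of \<open>set_cat\<close>: a family
  \<open>\<psi>\<close> that is compatible with the diagram descends to a unique function on
  \<open>Hom C x c\<close>.\<close>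

lemma hom_ftor_cocone:
  fixes T :: "'u itself" and C :: "('o, 'm) cat" and \<psi> :: "'j \<Rightarrow> 'm \<Rightarrow> 'm + 'u"
  assumes ls: "locally_small T C" and x: "x \<in> Obj C" and D: "cat_functor J C D"
    and col: "colimit J (set_cat T) (comp_ftor (hom_ftor T C x) D) (FObj (hom_ftor T C x) c) (\<lambda>j.
      FArr (hom_ftor T C x) (l j))"
    and l: "cocone J C D c l"
    and S: "small T S" and \<psi>: "\<And>j g. j \<in> Obj J \<Longrightarrow> g \<in> Hom C x (FObj D j) \<Longrightarrow> \<psi> j g \<in> S"
    and nat: "\<And>u g. u \<in> Arr J \<Longrightarrow> g \<in> Hom C x (FObj D (Dom J u)) \<Longrightarrow>
      \<psi> (Cod J u) (Comp C (FArr D u) g) = \<psi> (Dom J u) g"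
  shows "\<exists>!\<theta> :: 'm + 'u \<Rightarrow> 'm + 'u. \<theta> \<in> (Inl ` Hom C x c) \<rightarrow>\<^sub>E S \<and>
    (\<forall>j\<in>Obj J. \<forall>g\<in>Hom C x (FObj D j). \<theta> (Inl (Comp C (l j) g)) = \<psi> j g)"
proof -
  interpret D: cat_functor J C D by fact
  let ?H = "hom_ftor T C x"
  define hom where "hom j = (Inl ` Hom C x (FObj D j) :: ('m + 'u) set)" for j
  define m where "m j = (hom j, \<lambda>s\<in>hom j. \<psi> j (projl s), S)" for j
  have hom_small: "small T (hom j)" if "j \<in> Obj J" for j
    using ls that x D.FObj_in_Obj unfolding hom_def locally_small_def by (simp add: small_image)
  have c: "c \<in> Obj C" using l unfolding cocone_def by simp
  have lj: "l j \<in> Hom C (FObj D j) c" if "j \<in> Obj J" for j using l that unfolding cocone_def by simp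
  have Hc: "FObj ?H c = Inl ` Hom C x c" by (simp add: hom_ftor_def)
  have Hl: "FArr ?H (l j) = (hom j, \<lambda>s\<in>hom j. Inl (Comp C (l j) (projl s)), Inl ` Hom C x c)"
    if "j \<in> Obj J" for j
    using lj[OF that] unfolding Hom_iff by (simp add: hom_ftor_def hom_def)
  have Hu: "FArr ?H (FArr D u) = (hom (Dom J u),
    \<lambda>s\<in>hom (Dom J u). Inl (Comp C (FArr D u) (projl s)), hom (Cod J u))"
    if "u \<in> Arr J" for u
    using D.FArr_Arr[OF that] by (simp add: hom_ftor_def hom_def)
  have cc: "cocone J (set_cat T) (comp_ftor ?H D) S m"
    unfolding cocone_def
  proof (intro conjI ballI)
    show "S \<in> Obj (set_cat T)" using S by (simp add: set_cat_def)
    fix j assume j: "j \<in> Obj J"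
    have "FObj (comp_ftor ?H D) j = hom j" by (simp add: hom_ftor_def hom_def)
    thus "m j \<in> Hom (set_cat T) (FObj (comp_ftor ?H D) j) S"
      unfolding set_cat_Hom m_def using hom_small[OF j] S \<psi>[OF j] by (auto simp: hom_def)
  next
    fix u assume u: "u \<in> Arr J"
    have "Comp (set_cat T) (m (Cod J u)) (FArr ?H (FArr D u)) =
      (hom (Dom J u), compose (hom (Dom J u)) (\<lambda>s\<in>hom (Cod J u). \<psi> (Cod J u) (projl s))
         (\<lambda>s\<in>hom (Dom J u). Inl (Comp C (FArr D u) (projl s))), S)"
      unfolding Hu[OF u] m_def set_cat_def by simp
    also have "compose (hom (Dom J u)) (\<lambda>s\<in>hom (Cod J u). \<psi> (Cod J u) (projl s))
         (\<lambda>s\<in>hom (Dom J u). Inl (Comp C (FArr D u) (projl s))) = (\<lambda>s\<in>hom (Dom J u). \<psi> (Dom J u)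
           (projl s))"
    proof
      fix s
      have "Comp C (FArr D u) g \<in> Hom C x (FObj D (Cod J u))"
        if "g \<in> Hom C x (FObj D (Dom J u))" for g
        using that D.FArr_in_Hom[OF D.source.Hom_Dom_Cod[OF u]] D.target.Comp_in_Hom by blast
      thus "compose (hom (Dom J u)) (\<lambda>s\<in>hom (Cod J u). \<psi> (Cod J u) (projl s))
         (\<lambda>s\<in>hom (Dom J u). Inl (Comp C (FArr D u) (projl s))) s = (\<lambda>s\<in>hom (Dom J u). \<psi> (Dom J u)
           (projl s)) s"
        using nat[OF u] by (auto simp: compose_def hom_def)
    qed
    finally show "Comp (set_cat T) (m (Cod J u)) (FArr (comp_ftor ?H D) u) = m (Dom J u)"
      by (simp only: comp_ftor_simps m_def)
  qed
  let ?P = "\<lambda>h. h \<in> Hom (set_cat T) (FObj ?H c) S \<and>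
    (\<forall>j\<in>Obj J. Comp (set_cat T) h (FArr ?H (l j)) = m j)"
  let ?Q = "\<lambda>\<theta> :: 'm + 'u \<Rightarrow> 'm + 'u. \<theta> \<in> (Inl ` Hom C x c) \<rightarrow>\<^sub>E S \<and>
    (\<forall>j\<in>Obj J. \<forall>g\<in>Hom C x (FObj D j). \<theta> (Inl (Comp C (l j) g)) = \<psi> j g)"
  have ex: "\<exists>!h. ?P h" using col cc unfolding colimit_def by simp
  have PQ: "?P (Inl ` Hom C x c, \<theta>, S) \<longleftrightarrow> ?Q \<theta>" for \<theta>
  proof -
    have "Comp (set_cat T) (Inl ` Hom C x c, \<theta>, S) (FArr ?H (l j)) = m j \<longleftrightarrow>
        (\<forall>g\<in>Hom C x (FObj D j). \<theta> (Inl (Comp C (l j) g)) = \<psi> j g)" (is "?l \<longleftrightarrow>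
          ?r") if j: "j \<in> Obj J" for j
    proof -
      have "?l \<longleftrightarrow> compose (hom j) \<theta> (\<lambda>s\<in>hom j. Inl (Comp C (l j) (projl s))) = (\<lambda>s\<in>hom j. \<psi> j (projl
        s))"
        unfolding Hl[OF j] m_def set_cat_def by simp
      also have "\<dots> \<longleftrightarrow> ?r"
        unfolding fun_eq_iff compose_def restrict_def hom_def by auto
      finally show ?thesis .
    qed
    moreover have "small T (Inl ` Hom C x c :: ('m + 'u) set)"
      using ls x c unfolding locally_small_def by (simp add: small_image)
    ultimately show ?thesis unfolding set_cat_Hom Hc using S by simp
  qed
  obtain h where h: "?P h" using ex1_implies_ex[OF ex] by (elim exE)
  from conjunct1[OF this] obtain \<theta> where \<theta>: "h = (Inl ` Hom C x c, \<theta>,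
    S)" unfolding set_cat_Hom Hc by blast
  show ?thesis
  proof (rule ex1I)
    show "?Q \<theta>" using h PQ[of \<theta>] \<theta> by simp
    fix \<theta>' assume "?Q \<theta>'"
    hence "?P (Inl ` Hom C x c, \<theta>', S)" using PQ[of \<theta>'] by simp
    from ex1_unique[OF ex this h] show "\<theta>' = \<theta>" using \<theta> by simp
  qed
qed

text \<open>Both halves of the elementary description of a filtered colimit of sets come from
  functions into a two-element set: uniqueness of the induced function gives the factorization,
  existence gives the identification at a later stage.\<close>

lemma finitely_presented_colimit:
  fixes T :: "'u itself" and C :: "('o, 'm) cat"
  assumes univ: "universe T" and ls: "locally_small T C" and fp: "finitely_presented T C x"
    and J: "small_category T J" and fil: "filtered T J" and D: "cat_functor J C D"
    and col: "colimit J C D c l"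
  shows "f \<in> Hom C x c \<Longrightarrow> \<exists>j\<in>Obj J. \<exists>g\<in>Hom C x (FObj D j). Comp C (l j) g = f"
    and "j \<in> Obj J \<Longrightarrow> g \<in> Hom C x (FObj D j) \<Longrightarrow> g' \<in> Hom C x (FObj D j) \<Longrightarrow>
      Comp C (l j) g = Comp C (l j) g' \<Longrightarrow>
      \<exists>k. \<exists>u\<in>Hom J j k. Comp C (FArr D u) g = Comp C (FArr D u) g'"
proof -
  interpret D: cat_functor J C D by fact
  let ?H = "hom_ftor T C x"
  have x: "x \<in> Obj C" using fp unfolding finitely_presented_def by simp
  have l: "cocone J C D c l" using col unfolding colimit_def by simp
  have pres: "preserves_colimits_of_shape J C (set_cat T) ?H"
    using preserves_lam_filtered_colimits_small[OF _ J fil]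
      fp unfolding finitely_presented_def by blast
  have "colimit J C D c (restrict l (Obj J))"
    using col by (subst colimit_cong[OF D.source.category_axioms, of _ l]) simp_all
  hence "is_colimit J C D (c, restrict l (Obj J))"
    by (simp add: is_colimit_iff[OF D.source.category_axioms])
  hence "is_colimit J (set_cat T) (comp_ftor ?H D) (image_cocone J ?H (c, restrict l (Obj J)))"
    using pres D unfolding preserves_colimits_of_shape_def by simp
  hence "colimit J (set_cat T) (comp_ftor ?H D) (FObj ?H c) (\<lambda>j\<in>Obj J. FArr ?H (restrict l (Obj J)
    j))"
    by (simp add: image_cocone_def is_colimit_iff[OF D.source.category_axioms])
  hence "colimit J (set_cat T) (comp_ftor ?H D) (FObj ?H c) (\<lambda>j. FArr ?H (l j))"
    by (subst (asm) colimit_cong[OF D.source.category_axioms, of _ "\<lambda>j. FArr ?H (l j)"]) simp_all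
  note test = hom_ftor_cocone[OF ls x D this l]
  have "infinite (UNIV :: 'u set)"
    using universe_cinfinite[OF univ] unfolding cinfinite_def by (simp add: Field_card_of)
  then obtain a b :: 'u where ab: "a \<noteq> b" by (metis (full_types) UNIV_eq_I finite.simps singletonI)
  define S :: "('m + 'u) set" where "S = {Inr a, Inr b}"
  have S: "small T S" unfolding S_def by (simp add: small_finite[OF univ])
  {
    assume f: "f \<in> Hom C x c"
    show "\<exists>j\<in>Obj J. \<exists>g\<in>Hom C x (FObj D j). Comp C (l j) g = f"
    proof (rule ccontr)
      assume no: "\<not> ?thesis"
      let ?Q = "\<lambda>\<theta> :: 'm + 'u \<Rightarrow> 'm + 'u. \<theta> \<in> (Inl ` Hom C x c) \<rightarrow>\<^sub>E S \<and>
        (\<forall>j\<in>Obj J. \<forall>g\<in>Hom C x (FObj D j). \<theta> (Inl (Comp C (l j) g)) = Inr a)"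
      \<comment> \<open>If no leg reached \<open>f\<close>, the value at \<open>f\<close> alone
        could be changed without affecting any composite with a leg, against uniqueness.\<close>
      let ?t1 = "(\<lambda>s\<in>Inl ` Hom C x c. Inr a) :: 'm + 'u \<Rightarrow> 'm + 'u"
        and ?t2 = "(\<lambda>s\<in>Inl ` Hom C x c. if s = Inl f then Inr b else Inr a) :: 'm + 'u \<Rightarrow> 'm + 'u"
      have ex: "\<exists>!\<theta>. ?Q \<theta>" by (rule test[OF S, of "\<lambda>_ _. Inr a"]) (simp_all add: S_def)
      have lg: "Comp C (l j) g \<in> Hom C x c" if "j \<in> Obj J" "g \<in> Hom C x (FObj D j)" for j g
        using that l D.target.Comp_in_Hom unfolding cocone_def by blast
      have "?Q ?t1" by (auto simp: S_def lg)
      moreover have "?Q ?t2" using no by (auto simp: S_def lg)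
      ultimately have "?t1 = ?t2" by (rule ex1_unique[OF ex])
      hence "?t1 (Inl f) = ?t2 (Inl f)" by (rule fun_cong)
      thus False using f ab by simp
    qed
  next
    assume j: "j \<in> Obj J" and g: "g \<in> Hom C x (FObj D j)" and g': "g' \<in> Hom C x (FObj D j)"
      and eq: "Comp C (l j) g = Comp C (l j) g'"
    \<comment> \<open>\<open>R k t\<close> says that \<open>t\<close> at stage \<open>k\<close> and
      \<open>g\<close> at stage \<open>j\<close> become equal at some later stage. This predicate is
      invariant under the transition maps, so its characteristic function descends to the colimit
      and cannot separate \<open>g\<close> from \<open>g'\<close>.\<close>
    define R where "R k t \<longleftrightarrow> (\<exists>p v w. v \<in> Hom J j p \<and> w \<in> Hom J k p \<and>
      Comp C (FArr D v) g = Comp C (FArr D w) t)" for k t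
    define \<psi> :: "_ \<Rightarrow> 'm \<Rightarrow> 'm + 'u" where "\<psi> k t = (if R k t then Inr a else Inr b)" for k t
    have DC: "Comp C (FArr D (Comp J v u)) t = Comp C (FArr D v) (Comp C (FArr D u) t)"
      if "u \<in> Hom J p q" "v \<in> Hom J q r" "t \<in> Hom C x (FObj D p)" for u v t p q r
      using D.FArr_Comp[OF that(1,2)] D.target.assoc[OF that(3) D.FArr_in_Hom[OF that(1)]
        D.FArr_in_Hom[OF that(2)]]
      by simp
    have nat: "R k' (Comp C (FArr D u) t) \<longleftrightarrow> R k t" if u: "u \<in> Hom J k k'"
      and t: "t \<in> Hom C x (FObj D k)" for u k k' t
    proof
      assume "R k' (Comp C (FArr D u) t)"
      then obtain p v w where *: "v \<in> Hom J j p" "w \<in> Hom J k' p"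
        "Comp C (FArr D v) g = Comp C (FArr D w) (Comp C (FArr D u) t)" unfolding R_def by blast
      moreover have "Comp J w u \<in> Hom J k p" using u *(2) by (rule D.source.Comp_in_Hom)
      moreover have "Comp C (FArr D v) g = Comp C (FArr D (Comp J w u)) t"
        using DC[OF u *(2) t] *(3) by simp
      ultimately show "R k t" unfolding R_def using *(1) by blast
    next
      assume "R k t"
      then obtain p v w where *: "v \<in> Hom J j p" "w \<in> Hom J k p"
        "Comp C (FArr D v) g = Comp C (FArr D w) t" unfolding R_def by blast
      have bl: "|UNIV :: bool set| <o natLeq"
        by (simp add: index_cardinal_finite[OF index_cardinal_natLeq[OF univ]])
      have kO: "k \<in> Obj J" using u D.source.Hom_Obj by blast
      \<comment> \<open>The stage \<open>p\<close> witnessing \<open>R k t\<close> and the target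
        \<open>k'\<close> of \<open>u\<close> are both reached from \<open>k\<close>; filteredness
        completes \<open>w\<close> and \<open>u\<close> to a commuting square.\<close>
      obtain y z q where q: "y \<in> Obj J" "z \<in> Hom J k y"
        "\<And>h. h \<in> UNIV \<Longrightarrow> q h \<in> Hom J (if h then p else k') y"
        "\<And>h. h \<in> UNIV \<Longrightarrow> Comp J (q h) (if h then w else u) = z"
        by (rule lam_filtered_cospan[OF index_cardinal_natLeq[OF univ] fil bl,
          of k "\<lambda>h. if h then w else u" "\<lambda>h. if h then p else k'"])
          (use *(2) u kO in auto)
      have q1: "q True \<in> Hom J p y" and q2: "q False \<in> Hom J k' y"
        using q(3)[of True] q(3)[of False] by simp_all
      have qq: "Comp J (q True) w = Comp J (q False) u" using q(4)[of True] q(4)[of False] by simp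
      have "Comp C (FArr D (Comp J (q True) v)) g = Comp C (FArr D (q True)) (Comp C (FArr D w) t)"
        using DC[OF *(1) q1 g] *(3) by simp
      also have "\<dots> = Comp C (FArr D (q False)) (Comp C (FArr D u) t)"
        using DC[OF *(2) q1 t] DC[OF u q2 t] qq by simp
      finally show "R k' (Comp C (FArr D u) t)"
        unfolding R_def using D.source.Comp_in_Hom[OF *(1) q1] q2 by blast
    qed
    have ex: "\<exists>!\<theta> :: 'm + 'u \<Rightarrow> 'm + 'u. \<theta> \<in> (Inl ` Hom C x c) \<rightarrow>\<^sub>E S \<and>
        (\<forall>k\<in>Obj J. \<forall>t\<in>Hom C x (FObj D k). \<theta> (Inl (Comp C (l k) t)) = \<psi> k t)"
    proof (rule test[OF S])
      show "\<psi> k t \<in> S" for k t unfolding \<psi>_def S_def by simp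
      show "\<psi> (Cod J u) (Comp C (FArr D u) t) = \<psi> (Dom J u) t"
        if "u \<in> Arr J" "t \<in> Hom C x (FObj D (Dom J u))" for u t
        unfolding \<psi>_def using nat[OF D.source.Hom_Dom_Cod[OF that(1)] that(2)] by simp
    qed
    from ex1_implies_ex[OF ex] j obtain \<theta> :: "'m + 'u \<Rightarrow> 'm + 'u"
      where \<theta>: "\<And>t. t \<in> Hom C x (FObj D j) \<Longrightarrow> \<theta> (Inl (Comp C (l j) t)) = \<psi> j t"
      by (elim exE conjE) blast
    have "R j g" unfolding R_def using D.source.Ident_in_Hom[OF j] by blast
    hence "\<psi> j g' = Inr a" using \<theta>[OF g] \<theta>[OF g'] eq unfolding \<psi>_def by simp
    hence "R j g'" using ab unfolding \<psi>_def by (simp split: if_splits)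
    then obtain p v w where *: "v \<in> Hom J j p" "w \<in> Hom J j p"
        "Comp C (FArr D v) g = Comp C (FArr D w) g'" unfolding R_def by blast
    \<comment> \<open>The witness for \<open>R j g'\<close> gives two possibly different arrows
      \<open>v\<close> and \<open>w\<close> out of \<open>j\<close>, while a single transition is
      wanted; coequalizing them yields it.\<close>
    obtain y z where z: "z \<in> Hom J p y" "Comp J z v = Comp J z w"
      using filtered_coequalize[OF univ fil *(1,2)] .
    have "Comp C (FArr D (Comp J z v)) g = Comp C (FArr D (Comp J z v)) g'"
      using DC[OF *(1) z(1) g] DC[OF *(2) z(1) g'] *(3) z(2) by simp
    thus "\<exists>k. \<exists>u\<in>Hom J j k. Comp C (FArr D u) g = Comp C (FArr D u) g'"
      using D.source.Comp_in_Hom[OF *(1) z(1)] by blast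
  }
qed

section \<open>Density of the generator\<close>

lemma (in cat_functor) FArr_Comp_Comp:
  "u \<in> Hom A p q \<Longrightarrow> v \<in> Hom A q r \<Longrightarrow> g \<in> Hom B x (FObj F p) \<Longrightarrow>
    Comp B (FArr F (Comp A v u)) g = Comp B (FArr F v) (Comp B (FArr F u) g)"
  using FArr_Comp[of u p q v r] target.assoc[of g x "FObj F p" "FArr F u" "FObj F q" "FArr F v"
    "FObj F r"]
    FArr_in_Hom by simp

lemma cocone_Hom: "cocone J C D c l \<Longrightarrow> j \<in> Obj J \<Longrightarrow> l j \<in> Hom C (FObj D j) c"
  unfolding cocone_def by blast

lemma cocone_Comp:
  assumes "category C" "cat_functor J C D" "cocone J C D c l" "u \<in> Hom J j k"
    "g \<in> Hom C x (FObj D j)"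
  shows "Comp C (l k) (Comp C (FArr D u) g) = Comp C (l j) g"
proof -
  interpret D: cat_functor J C D by fact
  have jk: "j \<in> Obj J" "k \<in> Obj J" using D.source.Hom_Obj[OF assms(4)] .
  have "Comp C (l k) (FArr D u) = l j" using assms(3,4) unfolding cocone_def Hom_iff by blast
  thus ?thesis
    using D.target.assoc[OF assms(5) D.FArr_in_Hom[OF assms(4)] cocone_Hom[OF assms(3) jk(2)]]
      by simp
qed

text \<open>The objects of \<open>comma_over C G x\<close>: an arrow carries its domain, so the pair
  is replaced by the arrow alone.\<close>

definition el :: "('o, 'm) cat \<Rightarrow> 'o set \<Rightarrow> 'o \<Rightarrow> 'm set" where
  "el C G x = {a \<in> Arr C. Dom C a \<in> G \<and> Cod C a = x}"

text \<open>The arrows of \<open>comma_over C G x\<close>: the pair \<open>(a, k)\<close> stands for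
  the arrow \<open>k\<close> from the element \<open>Comp C a k\<close> to the element
  \<open>a\<close>.\<close>

definition el_arr :: "('o, 'm) cat \<Rightarrow> 'o set \<Rightarrow> 'o \<Rightarrow> ('m \<times> 'm) set" where
  "el_arr C G x = {(a, k). a \<in> el C G x \<and> k \<in> Arr C \<and> Dom C k \<in> G \<and> Cod C k = Dom C a}"

text \<open>Density of the generator in elementary form: an arrow out of \<open>x\<close> amounts to
  a compatible assignment on the elements of \<open>x\<close>. Existence comes from the canonical
  colimit, uniqueness from the generator property.\<close>

locale lfmp = category C for C :: "('o, 'm) cat" +
  fixes T :: "'u itself" and G :: "'o set"
  assumes univ: "universe T" and locally_small: "locally_small T C" and small_G: "small T G"
    and G_Obj: "G \<subseteq> Obj C" and fp: "\<And>s. s \<in> G \<Longrightarrow> finitely_presented T C s"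
    and dense_ex: "\<And>x y m. x \<in> Obj C \<Longrightarrow> y \<in> Obj C \<Longrightarrow>
      (\<And>a. a \<in> el C G x \<Longrightarrow> m a \<in> Hom C (Dom C a) y) \<Longrightarrow>
      (\<And>a k. (a, k) \<in> el_arr C G x \<Longrightarrow> Comp C (m a) k = m (Comp C a k)) \<Longrightarrow>
      \<exists>h\<in>Hom C x y. \<forall>a\<in>el C G x. Comp C h a = m a"
    and dense_unique: "\<And>x y h h'. h \<in> Hom C x y \<Longrightarrow> h' \<in> Hom C x y \<Longrightarrow>
      (\<And>a. a \<in> el C G x \<Longrightarrow> Comp C h a = Comp C h' a) \<Longrightarrow> h = h'"
    and multicocomplete: "multicocomplete T C"

lemma canonical_colimit_ex:
  assumes "category C" "x \<in> Obj C" and cat: "category (comma_over C G x)"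
    and col: "is_colimit (comma_over C G x) C canonical_diagram (canonical_cocone C G x)"
    and y: "y \<in> Obj C"
    and m: "\<And>a. a \<in> el C G x \<Longrightarrow> m a \<in> Hom C (Dom C a) y"
    and nat: "\<And>a k. (a, k) \<in> el_arr C G x \<Longrightarrow> Comp C (m a) k = m (Comp C a k)"
  shows "\<exists>h\<in>Hom C x y. \<forall>a\<in>el C G x. Comp C h a = m a"
proof -
  let ?J = "comma_over C G x"
  have O: "Obj ?J = {(s, f). s \<in> G \<and> f \<in> Hom C s x}" by (simp add: comma_over_def)
  have c: "colimit ?J C canonical_diagram x (\<lambda>p\<in>Obj ?J. snd p)"
    using col unfolding canonical_cocone_def is_colimit_iff[OF cat] by simp
  have cc: "cocone ?J C canonical_diagram y (\<lambda>p. m (snd p))"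
    unfolding cocone_def
  proof (intro conjI ballI y)
    fix p assume "p \<in> Obj ?J"
    thus "m (snd p) \<in> Hom C (FObj canonical_diagram p) y"
      using m unfolding O canonical_diagram_def el_def Hom_iff by auto
  next
    fix u assume "u \<in> Arr ?J"
    then obtain s f h s' f' where u: "u = ((s, f), h, (s', f'))" "s \<in> G" "f \<in> Hom C s x" "s' \<in> G"
      "f' \<in> Hom C s' x" "h \<in> Hom C s s'" "Comp C f' h = f"
      unfolding comma_over_def by (cases u) auto
    have "(f', h) \<in> el_arr C G x" using u unfolding el_arr_def el_def Hom_iff by auto
    from nat[OF this] show "Comp C (m (snd (Cod ?J u))) (FArr canonical_diagram u) = m (snd (Dom ?J
      u))"
      using u by (simp add: canonical_diagram_def comma_over_def)
  qed
  have "\<exists>!h. h \<in> Hom C x y \<and> (\<forall>p\<in>Obj ?J. Comp C h ((\<lambda>p\<in>Obj ?J. snd p) p) = m (snd p))"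
    using c cc unfolding colimit_def by simp
  from ex1_implies_ex[OF this] obtain h where h: "h \<in> Hom C x y"
    "\<And>p. p \<in> Obj ?J \<Longrightarrow> Comp C h (snd p) = m (snd p)" by auto
  have "Comp C h a = m a" if "a \<in> el C G x" for a
    using h(2)[of "(Dom C a, a)"] that unfolding O el_def Hom_iff by simp
  thus ?thesis using h(1) by blast
qed

lemma lfmp_of_locally_finitely_multipresentable:
  assumes "universe T" "locally_finitely_multipresentable T C"
  obtains G where "lfmp C T G"
proof -
  from assms(2) obtain G where C: "category C"
    and G: "locally_small T C" "small T G" "generator C G"
    "\<And>s. s \<in> G \<Longrightarrow> finitely_presented T C s" "multicocomplete T C"
    and can: "\<And>x. x \<in> Obj C \<Longrightarrow> filtered T (comma_over C G x)"
      "\<And>x. x \<in> Obj C \<Longrightarrow> is_colimit (comma_over C G x) C canonical_diagram (canonical_cocone C G x)"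
    unfolding locally_finitely_multipresentable_def by (elim conjE exE) simp
  interpret category C by (rule C)
  have "lfmp C T G"
  proof (intro lfmp.intro lfmp_axioms.intro C assms(1) G(1,2,4,5))
    show "G \<subseteq> Obj C" using G(3) unfolding generator_def by blast
    fix x y m
    assume x: "x \<in> Obj C" and r: "y \<in> Obj C"
      "\<And>a. a \<in> el C G x \<Longrightarrow> m a \<in> Hom C (Dom C a) y"
      "\<And>a k. (a, k) \<in> el_arr C G x \<Longrightarrow> Comp C (m a) k = m (Comp C a k)"
    have "category (comma_over C G x)" using can(1)[OF x] unfolding lam_filtered_def by blast
    from canonical_colimit_ex[OF C x this can(2)[OF x] r]
    show "\<exists>h\<in>Hom C x y. \<forall>a\<in>el C G x. Comp C h a = m a" .
  next
    fix x y h h'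
    assume h: "h \<in> Hom C x y" "h' \<in> Hom C x y" "\<And>a. a \<in> el C G x \<Longrightarrow> Comp C h a = Comp C h' a"
    have "\<forall>s\<in>G. \<forall>a\<in>Hom C s x. Comp C h a = Comp C h' a"
      by (auto intro!: h(3) simp: el_def Hom_iff)
    thus "h = h'" using G(3) h(1,2) Hom_Obj[OF h(1)] unfolding generator_def by blast
  qed
  thus thesis by (rule that)
qed

context lfmp
begin

lemma el_iff: "a \<in> el C G x \<longleftrightarrow> a \<in> Hom C (Dom C a) x \<and> Dom C a \<in> G"
  unfolding el_def Hom_iff by blast

lemma el_arrD:
  assumes "(a, k) \<in> el_arr C G x"
  shows "a \<in> el C G x" "k \<in> Hom C (Dom C k) (Dom C a)" "Dom C k \<in> G" "Comp C a k \<in> el C G x"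
    "Dom C (Comp C a k) = Dom C k"
  using assms unfolding el_arr_def el_def Hom_iff by (auto simp: cat_simps)

lemma small_el: "x \<in> Obj C \<Longrightarrow> small T (el C G x)"
proof -
  assume x: "x \<in> Obj C"
  have "el C G x = (\<Union>s\<in>G. Hom C s x)" unfolding el_def Hom_def by blast
  thus ?thesis using x locally_small G_Obj small_G
    unfolding locally_small_def by (auto intro!: small_UNION[OF univ])
qed

lemma small_G_Arr: "small T {k \<in> Arr C. Dom C k \<in> G \<and> Cod C k \<in> G}"
proof -
  have "{k \<in> Arr C. Dom C k \<in> G \<and> Cod C k \<in> G} = (\<Union>s\<in>G. \<Union>s'\<in>G. Hom C s s')" unfolding Hom_def by
    blast
  moreover have "small T (Hom C s s')" if "s \<in> G" "s' \<in> G" for s s'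
    using that locally_small G_Obj unfolding locally_small_def by blast
  ultimately show ?thesis using small_G by (simp add: small_UNION[OF univ])
qed

lemma small_el_arr:
  assumes "x \<in> Obj C"
  shows "small T (el_arr C G x)"
proof (rule small_subset)
  show "el_arr C G x \<subseteq> el C G x \<times> {k \<in> Arr C. Dom C k \<in> G \<and> Cod C k \<in> G}"
    unfolding el_arr_def el_def by auto
  show "small T (el C G x \<times> {k \<in> Arr C. Dom C k \<in> G \<and> Cod C k \<in> G})"
    by (intro small_Sigma[OF univ] small_el assms small_G_Arr)
qed

lemma card_el: "|el C G x| \<le>o |el_arr C G x|"
proof -
  have "inj_on (\<lambda>a. (a, Ident C (Dom C a))) (el C G x)" by (rule inj_onI) simp
  moreover have "(\<lambda>a. (a, Ident C (Dom C a))) ` el C G x \<subseteq> el_arr C G x"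
    unfolding el_arr_def el_def by (auto simp: cat_simps)
  ultimately show ?thesis using card_of_ordLeq by blast
qed

section \<open>Presentability of objects with fewer than \<open>lam\<close> arrows between their
  elements\<close>

context
  fixes J :: "('j, 'k) cat" and D :: "('j, 'k, 'o, 'm) ftor" and c l and lam :: "'l rel" and x
  assumes lam: "index_cardinal T lam" and J: "small_category T J" and fil: "lam_filtered T lam J"
    and D: "cat_functor J C D" and col: "colimit J C D c l"
    and x: "x \<in> Obj C" and card: "|el_arr C G x| <o lam"
begin

interpretation D: cat_functor J C D by (rule D)

lemma cocone_l: "cocone J C D c l"
  using col unfolding colimit_def by simp

lemma fp_factor: "s \<in> G \<Longrightarrow> f \<in> Hom C s c \<Longrightarrow> \<exists>j\<in>Obj J. \<exists>g\<in>Hom C s (FObj D j). Comp C (l j) g = f"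
  by (rule finitely_presented_colimit(1)[OF univ locally_small fp J lam_filtered_imp_filtered[OF
    lam fil] D col])

lemma fp_identify: "s \<in> G \<Longrightarrow> j \<in> Obj J \<Longrightarrow> g \<in> Hom C s (FObj D j) \<Longrightarrow> g' \<in> Hom C s (FObj D j) \<Longrightarrow>
      Comp C (l j) g = Comp C (l j) g' \<Longrightarrow>
      \<exists>k. \<exists>u\<in>Hom J j k. Comp C (FArr D u) g = Comp C (FArr D u) g'"
  by (rule finitely_presented_colimit(2)[OF univ locally_small fp J lam_filtered_imp_filtered[OF
    lam fil] D col])

text \<open>Each element of \<open>x\<close> is finitely presented and factors through some stage.
  There are fewer than \<open>lam\<close> elements and fewer than \<open>lam\<close> compatibility
  conditions, so one stage serves them all, and density glues the pieces to an arrow out of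
  \<open>x\<close>.\<close>

lemma presentable_factor:
  assumes f: "f \<in> Hom C x c"
  shows "\<exists>j\<in>Obj J. \<exists>g\<in>Hom C x (FObj D j). Comp C (l j) g = f"
proof -
  have card': "|el C G x| <o lam" by (rule ordLeq_ordLess_trans[OF card_el card])
  have c: "c \<in> Obj C" by (rule Hom_Obj(2)[OF f])
  have "\<exists>j g. j \<in> Obj J \<and> g \<in> Hom C (Dom C a) (FObj D j) \<and> Comp C (l j) g = Comp C f a"
    if a: "a \<in> el C G x" for a
  proof -
    have "Comp C f a \<in> Hom C (Dom C a) c" using a f Comp_in_Hom unfolding el_iff by blast
    from fp_factor[OF _ this] show ?thesis using a unfolding el_iff by blast
  qed
  then obtain jf gf where jg: "\<And>a. a \<in> el C G x \<Longrightarrow> jf a \<in> Obj J"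
    "\<And>a. a \<in> el C G x \<Longrightarrow> gf a \<in> Hom C (Dom C a) (FObj D (jf a))"
    "\<And>a. a \<in> el C G x \<Longrightarrow> Comp C (l (jf a)) (gf a) = Comp C f a"
    by metis
  obtain y v where y: "y \<in> Obj J" and v: "\<And>a. a \<in> el C G x \<Longrightarrow> v a \<in> Hom J (jf a) y"
    using lam_filtered_upper_bound[where f = jf, OF lam fil card' jg(1)] by blast
  define g1 where "g1 a = Comp C (FArr D (v a)) (gf a)" for a
  have g1: "g1 a \<in> Hom C (Dom C a) (FObj D y)" "Comp C (l y) (g1 a) = Comp C f a"
    if "a \<in> el C G x" for a
  proof -
    show "g1 a \<in> Hom C (Dom C a) (FObj D y)"
      unfolding g1_def using jg(2)[OF that] D.FArr_in_Hom[OF v[OF that]] by (rule Comp_in_Hom)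
    show "Comp C (l y) (g1 a) = Comp C f a"
      unfolding g1_def using cocone_Comp[OF category_axioms D cocone_l v[OF that] jg(2)[OF that]]
        jg(3)[OF that]
      by simp
  qed
  have ly: "l y \<in> Hom C (FObj D y) c" by (rule cocone_Hom[OF cocone_l y])
  \<comment> \<open>The chosen lifts \<open>g1 a\<close> agree along arrows of elements only after
    composition with \<open>l y\<close>. Every member of \<open>el_arr C G x\<close> gives a
    transition that repairs its own condition; these transitions all start at \<open>y\<close> and
    are then merged into one.\<close>
  have "\<exists>k u. u \<in> Hom J y k \<and>
      Comp C (FArr D u) (Comp C (g1 (fst p)) (snd p)) = Comp C (FArr D u) (g1 (Comp C (fst p) (snd
        p)))"
    if p: "p \<in> el_arr C G x" for p
  proof -
    obtain a k where pk: "p = (a, k)" by (cases p)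
    note ak = el_arrD[OF p[unfolded pk]]
    have fa: "a \<in> Hom C (Dom C a) x" using ak(1) unfolding el_iff by blast
    have 1: "Comp C (g1 a) k \<in> Hom C (Dom C k) (FObj D y)"
      by (rule Comp_in_Hom[OF ak(2) g1(1)[OF ak(1)]])
    have 2: "g1 (Comp C a k) \<in> Hom C (Dom C k) (FObj D y)" using g1(1)[OF ak(4)] ak(5) by simp
    have "Comp C (l y) (Comp C (g1 a) k) = Comp C (Comp C (l y) (g1 a)) k"
      using assoc[OF ak(2) g1(1)[OF ak(1)] ly] by simp
    also have "\<dots> = Comp C (l y) (g1 (Comp C a k))"
      using g1(2)[OF ak(1)] g1(2)[OF ak(4)] assoc[OF ak(2) fa f] by simp
    finally have "Comp C (l y) (Comp C (g1 a) k) = Comp C (l y) (g1 (Comp C a k))" .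
    from fp_identify[OF ak(3) y 1 2 this] show ?thesis unfolding pk by auto
  qed
  then obtain K u where u: "\<And>p. p \<in> el_arr C G x \<Longrightarrow> u p \<in> Hom J y (K p)"
    and eq: "\<And>p. p \<in> el_arr C G x \<Longrightarrow>
      Comp C (FArr D (u p)) (Comp C (g1 (fst p)) (snd p)) = Comp C (FArr D (u p)) (g1 (Comp C (fst
        p) (snd p)))"
    by metis
  from lam_filtered_cospan[where u = u and k = K, OF lam fil card y u]
  obtain z w q where z: "z \<in> Obj J" and w: "w \<in> Hom J y z"
    and q: "\<And>p. p \<in> el_arr C G x \<Longrightarrow> q p \<in> Hom J (K p) z"
    and qw: "\<And>p. p \<in> el_arr C G x \<Longrightarrow> Comp J (q p) (u p) = w" by blast
  define m where "m a = Comp C (FArr D w) (g1 a)" for a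
  have m: "m a \<in> Hom C (Dom C a) (FObj D z)" if "a \<in> el C G x" for a
    unfolding m_def by (rule Comp_in_Hom[OF g1(1)[OF that] D.FArr_in_Hom[OF w]])
  have "\<exists>h\<in>Hom C x (FObj D z). \<forall>a\<in>el C G x. Comp C h a = m a"
  proof (rule dense_ex[OF x D.FObj_in_Obj[OF z] m])
    fix a k assume p: "(a, k) \<in> el_arr C G x"
    note ak = el_arrD[OF p]
    have 1: "Comp C (g1 a) k \<in> Hom C (Dom C k) (FObj D y)"
      by (rule Comp_in_Hom[OF ak(2) g1(1)[OF ak(1)]])
    have 2: "g1 (Comp C a k) \<in> Hom C (Dom C k) (FObj D y)" using g1(1)[OF ak(4)] ak(5) by simp
    have "Comp C (m a) k = Comp C (FArr D w) (Comp C (g1 a) k)"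
      unfolding m_def by (rule assoc[OF ak(2) g1(1)[OF ak(1)] D.FArr_in_Hom[OF w]])
    also have "\<dots> = Comp C (FArr D (q (a, k))) (Comp C (FArr D (u (a, k))) (Comp C (g1 a) k))"
      using D.FArr_Comp_Comp[OF u[OF p] q[OF p] 1] qw[OF p] by simp
    also have "\<dots> = m (Comp C a k)"
      unfolding m_def using D.FArr_Comp_Comp[OF u[OF p] q[OF p] 2] qw[OF p] eq[OF p] by simp
    finally show "Comp C (m a) k = m (Comp C a k)" .
  qed
  then obtain g where g: "g \<in> Hom C x (FObj D z)" "\<And>a. a \<in> el C G x \<Longrightarrow> Comp C g a = m a" by blast
  have lz: "l z \<in> Hom C (FObj D z) c" by (rule cocone_Hom[OF cocone_l z])
  have "Comp C (l z) g = f"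
  proof (rule dense_unique[OF Comp_in_Hom[OF g(1) lz] f])
    fix a assume a: "a \<in> el C G x"
    have "a \<in> Hom C (Dom C a) x" using a unfolding el_iff by blast
    from assoc[OF this g(1) lz] have "Comp C (Comp C (l z) g) a = Comp C (l z) (m a)"
      using g(2)[OF a] by simp
    also have "\<dots> = Comp C f a"
      unfolding m_def using cocone_Comp[OF category_axioms D cocone_l w g1(1)[OF a]] g1(2)[OF a]
        by simp
    finally show "Comp C (Comp C (l z) g) a = Comp C f a" .
  qed
  thus ?thesis using z g(1) by blast
qed

text \<open>The two arrows are identified element by element; the transitions that do so are merged
  into one \<open>w\<close>, and elements detect equality.\<close>

lemma presentable_identify:
  assumes j: "j \<in> Obj J" and g: "g \<in> Hom C x (FObj D j)" "g' \<in> Hom C x (FObj D j)"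
    and eq: "Comp C (l j) g = Comp C (l j) g'"
  shows "\<exists>k. \<exists>u\<in>Hom J j k. Comp C (FArr D u) g = Comp C (FArr D u) g'"
proof -
  have card': "|el C G x| <o lam" by (rule ordLeq_ordLess_trans[OF card_el card])
  have lj: "l j \<in> Hom C (FObj D j) c" by (rule cocone_Hom[OF cocone_l j])
  have "\<exists>k u. u \<in> Hom J j k \<and> Comp C (FArr D u) (Comp C g a) = Comp C (FArr D u) (Comp C g' a)"
    if a: "a \<in> el C G x" for a
  proof -
    have ax: "a \<in> Hom C (Dom C a) x" "Dom C a \<in> G" using a unfolding el_iff by blast+
    have "Comp C (l j) (Comp C g a) = Comp C (l j) (Comp C g' a)"
      using assoc[OF ax(1) g(1) lj] assoc[OF ax(1) g(2) lj] eq by simp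
    from fp_identify[OF ax(2) j Comp_in_Hom[OF ax(1) g(1)] Comp_in_Hom[OF ax(1) g(2)] this]
    show ?thesis by blast
  qed
  then obtain K u where u: "\<And>a. a \<in> el C G x \<Longrightarrow> u a \<in> Hom J j (K a)"
    and eq': "\<And>a. a \<in> el C G x \<Longrightarrow> Comp C (FArr D (u a)) (Comp C g a) = Comp C (FArr D (u a)) (Comp C
      g' a)"
    by metis
  from lam_filtered_cospan[where u = u and k = K, OF lam fil card' j u]
  obtain z w q where z: "z \<in> Obj J" and w: "w \<in> Hom J j z"
    and q: "\<And>p. p \<in> el C G x \<Longrightarrow> q p \<in> Hom J (K p) z"
    and qw: "\<And>p. p \<in> el C G x \<Longrightarrow> Comp J (q p) (u p) = w" by blast
  note Dw = D.FArr_in_Hom[OF w]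
  have "Comp C (FArr D w) g = Comp C (FArr D w) g'"
  proof (rule dense_unique[OF Comp_in_Hom[OF g(1) Dw] Comp_in_Hom[OF g(2) Dw]])
    fix a assume a: "a \<in> el C G x"
    have ax: "a \<in> Hom C (Dom C a) x" "Dom C a \<in> G" using a unfolding el_iff by blast+
    have "Comp C (FArr D w) (Comp C g a) = Comp C (FArr D w) (Comp C g' a)"
      using D.FArr_Comp_Comp[OF u[OF a] q[OF a] Comp_in_Hom[OF ax(1) g(1)]]
        D.FArr_Comp_Comp[OF u[OF a] q[OF a] Comp_in_Hom[OF ax(1) g(2)]] eq'[OF a] qw[OF a] by simp
    thus "Comp C (Comp C (FArr D w) g) a = Comp C (Comp C (FArr D w) g') a"
      using assoc[OF ax(1) g(1) Dw] assoc[OF ax(1) g(2) Dw] by simp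
  qed
  thus ?thesis using w by blast
qed

end

text \<open>The functors \<open>Hom C s\<close>, for \<open>s\<close> in the generator, jointly
  detect filtered colimits: if every element of \<open>z\<close> lifts to a stage, essentially
  uniquely, then a cocone \<open>m\<close> prescribes the mediating arrow on the elements of
  \<open>z\<close>, and density produces it.\<close>

lemma dense_colimit:
  fixes J :: "('j, 'k) cat"
  assumes fil: "filtered T J" and E: "cat_functor J C E" and l: "cocone J C E z l"
    and fac: "\<And>s f. s \<in> G \<Longrightarrow> f \<in> Hom C s z \<Longrightarrow> \<exists>j\<in>Obj J. \<exists>g\<in>Hom C s (FObj E j). Comp C (l j) g = f"
    and idt: "\<And>s j g g'. s \<in> G \<Longrightarrow> j \<in> Obj J \<Longrightarrow> g \<in> Hom C s (FObj E j) \<Longrightarrow> g' \<in> Hom C s (FObj E j) \<Longrightarrow>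
      Comp C (l j) g = Comp C (l j) g' \<Longrightarrow>
      \<exists>k. \<exists>u\<in>Hom J j k. Comp C (FArr E u) g = Comp C (FArr E u) g'"
  shows "colimit J C E z l"
  unfolding colimit_def
proof (intro conjI allI impI l)
  fix y m assume m: "cocone J C E y m"
  interpret E: cat_functor J C E by fact
  have y: "y \<in> Obj C" and z: "z \<in> Obj C" using m l unfolding cocone_def by blast+
  note mC = cocone_Comp[OF category_axioms E m] and lC = cocone_Comp[OF category_axioms E l]
  \<comment> \<open>The value that \<open>m\<close> gives to an element of \<open>z\<close> depends
    neither on the stage nor on the lift: two lifts are moved to a common stage and identified at a
    later one.\<close>
  have key: "Comp C (m j) g = Comp C (m k) g'"
    if s: "s \<in> G" and jk: "j \<in> Obj J" "k \<in> Obj J"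
      and g: "g \<in> Hom C s (FObj E j)" and g': "g' \<in> Hom C s (FObj E k)"
      and eq: "Comp C (l j) g = Comp C (l k) g'" for s j k g g'
  proof -
    have e: "|{j, k}| <o natLeq" by (simp add: index_cardinal_finite[OF index_cardinal_natLeq[OF
      univ]])
    obtain p v where v: "p \<in> Obj J" "\<And>i. i \<in> {j, k} \<Longrightarrow> v i \<in> Hom J i p"
      by (rule lam_filtered_upper_bound[OF index_cardinal_natLeq[OF univ] fil e,
        of "\<lambda>i. i"]) (use jk in auto)
    have v': "v j \<in> Hom J j p" "v k \<in> Hom J k p" using v(2) by simp_all
    have 1: "Comp C (FArr E (v j)) g \<in> Hom C s (FObj E p)"
      by (rule Comp_in_Hom[OF g E.FArr_in_Hom[OF v'(1)]])
    have 2: "Comp C (FArr E (v k)) g' \<in> Hom C s (FObj E p)"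
      by (rule Comp_in_Hom[OF g' E.FArr_in_Hom[OF v'(2)]])
    have "Comp C (l p) (Comp C (FArr E (v j)) g) = Comp C (l p) (Comp C (FArr E (v k)) g')"
      using lC[OF v'(1) g] lC[OF v'(2) g'] eq by simp
    from idt[OF s v(1) 1 2 this] obtain q u where u: "u \<in> Hom J p q"
      "Comp C (FArr E u) (Comp C (FArr E (v j)) g) = Comp C (FArr E u) (Comp C (FArr E (v k)) g')"
        by blast
    show ?thesis
      using mC[OF v'(1) g] mC[OF v'(2) g'] mC[OF u(1) 1] mC[OF u(1) 2] u(2) by simp
  qed
  have "\<exists>j g. j \<in> Obj J \<and> g \<in> Hom C (Dom C a) (FObj E j) \<and>
    Comp C (l j) g = a" if a: "a \<in> el C G z" for a
    using fac[of "Dom C a" a] a unfolding el_iff by blast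
  then obtain jf gf where jg: "\<And>a. a \<in> el C G z \<Longrightarrow> jf a \<in> Obj J"
    "\<And>a. a \<in> el C G z \<Longrightarrow> gf a \<in> Hom C (Dom C a) (FObj E (jf a))"
    "\<And>a. a \<in> el C G z \<Longrightarrow> Comp C (l (jf a)) (gf a) = a"
    by metis
  define M where "M a = Comp C (m (jf a)) (gf a)" for a
  have M: "M a \<in> Hom C (Dom C a) y" if "a \<in> el C G z" for a
    unfolding M_def by (rule Comp_in_Hom[OF jg(2)[OF that] cocone_Hom[OF m jg(1)[OF that]]])
  have "\<exists>h\<in>Hom C z y. \<forall>a\<in>el C G z. Comp C h a = M a"
  proof (rule dense_ex[OF z y M])
    fix a k assume p: "(a, k) \<in> el_arr C G z"
    note ak = el_arrD[OF p]
    have gk: "Comp C (gf a) k \<in> Hom C (Dom C k) (FObj E (jf a))"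
      by (rule Comp_in_Hom[OF ak(2) jg(2)[OF ak(1)]])
    have "Comp C (l (jf a)) (Comp C (gf a) k) = Comp C a k"
      using assoc[OF ak(2) jg(2)[OF ak(1)] cocone_Hom[OF l jg(1)[OF ak(1)]]] jg(3)[OF ak(1)] by simp
    hence "Comp C (l (jf a)) (Comp C (gf a) k) = Comp C (l (jf (Comp C a k))) (gf (Comp C a k))"
      using jg(3)[OF ak(4)] by simp
    from key[OF ak(3) jg(1)[OF ak(1)] jg(1)[OF ak(4)] gk jg(2)[OF ak(4), unfolded ak(5)] this]
    show "Comp C (M a) k = M (Comp C a k)"
      unfolding M_def using assoc[OF ak(2) jg(2)[OF ak(1)] cocone_Hom[OF m jg(1)[OF ak(1)]]] by simp
  qed
  then obtain h where h: "h \<in> Hom C z y" "\<And>a. a \<in> el C G z \<Longrightarrow> Comp C h a = M a" by blast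
  show "\<exists>!h. h \<in> Hom C z y \<and> (\<forall>j\<in>Obj J. Comp C h (l j) = m j)"
  proof (rule ex1I)
    have "Comp C h (l j) = m j" if j: "j \<in> Obj J" for j
    proof (rule dense_unique[OF Comp_in_Hom[OF cocone_Hom[OF l j] h(1)] cocone_Hom[OF m j]])
      fix b assume "b \<in> el C G (FObj E j)"
      hence b: "b \<in> Hom C (Dom C b) (FObj E j)" "Dom C b \<in> G" unfolding el_iff by blast+
      have lb: "Comp C (l j) b \<in> Hom C (Dom C b) z"
        by (rule Comp_in_Hom[OF b(1) cocone_Hom[OF l j]])
      hence d: "Dom C (Comp C (l j) b) = Dom C b" by (rule HomD(2))
      hence e: "Comp C (l j) b \<in> el C G z" unfolding el_iff using lb b(2) by simp
      have "Comp C (Comp C h (l j)) b = M (Comp C (l j) b)"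
        using assoc[OF b(1) cocone_Hom[OF l j] h(1)] h(2)[OF e] by simp
      also have "\<dots> = Comp C (m j) b"
        unfolding M_def by (rule key[OF b(2) jg(1)[OF e] j jg(2)[OF e, unfolded d]
          b(1) jg(3)[OF e]])
      finally show "Comp C (Comp C h (l j)) b = Comp C (m j) b" .
    qed
    thus "h \<in> Hom C z y \<and> (\<forall>j\<in>Obj J. Comp C h (l j) = m j)" using h(1) by simp
    fix h' assume h': "h' \<in> Hom C z y \<and> (\<forall>j\<in>Obj J. Comp C h' (l j) = m j)"
    hence h'1: "h' \<in> Hom C z y" by simp
    show "h' = h"
    proof (rule dense_unique[OF h'1 h(1)])
      fix a assume a: "a \<in> el C G z"
      have "Comp C h' a = Comp C (Comp C h' (l (jf a))) (gf a)"
        using assoc[OF jg(2)[OF a] cocone_Hom[OF l jg(1)[OF a]] h'1] jg(3)[OF a] by simp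
      also have "\<dots> = M a" unfolding M_def using h' jg(1)[OF a] by simp
      finally show "Comp C h' a = Comp C h a" using h(2)[OF a] by simp
    qed
  qed
qed

end

section \<open>Right multi-adjoints preserve connected limits and are accessible\<close>

text \<open>The objects of the multi-initial family split into codomains \<open>X i\<close> and
  local units \<open>\<eta> i\<close>; the uniqueness of pairs expresses
  \<open>Hom B b (FObj U a)\<close> as the disjoint sum of the sets
  \<open>Hom A (X i) a\<close>.\<close>

definition adj_family ::
  "('oa, 'ma) cat \<Rightarrow> ('ob, 'mb) cat \<Rightarrow> ('oa, 'ma, 'ob, 'mb) ftor \<Rightarrow> 'ob
    \<Rightarrow> 'i set \<Rightarrow> ('i \<Rightarrow> 'oa) \<Rightarrow> ('i \<Rightarrow> 'mb) \<Rightarrow> bool" where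
  "adj_family A B U b I X \<eta> \<longleftrightarrow>
     (\<forall>i\<in>I. X i \<in> Obj A \<and> \<eta> i \<in> Hom B b (FObj U (X i))) \<and>
     (\<forall>a\<in>Obj A. \<forall>f\<in>Hom B b (FObj U a).
        \<exists>!(i, h). i \<in> I \<and> h \<in> Hom A (X i) a \<and> Comp B (FArr U h) (\<eta> i) = f)"

lemma multi_initial_comma_under:
  "multi_initial (comma_under A B U b) I Y \<longleftrightarrow> adj_family A B U b I (fst \<circ> Y) (snd \<circ> Y)"
  unfolding comma_under_def multi_initial_cat_of_homs adj_family_def
    by (simp add: case_prod_beta Ball_def imp_conjL)

lemma adj_family_Hom:
  assumes "adj_family A B U b I X \<eta>" "i \<in> I"
  shows "X i \<in> Obj A" "\<eta> i \<in> Hom B b (FObj U (X i))"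
  using assms unfolding adj_family_def by simp_all

lemma adj_family_factor:
  assumes "adj_family A B U b I X \<eta>" "a \<in> Obj A" "f \<in> Hom B b (FObj U a)"
  obtains i h where "i \<in> I" "h \<in> Hom A (X i) a" "Comp B (FArr U h) (\<eta> i) = f"
proof -
  have "\<exists>!(i, h). i \<in> I \<and> h \<in> Hom A (X i) a \<and> Comp B (FArr U h) (\<eta> i) = f"
    using assms unfolding adj_family_def by simp
  from ex1_implies_ex[OF this] that show thesis by auto
qed

lemma adj_family_unique:
  assumes "adj_family A B U b I X \<eta>" "a \<in> Obj A" "f \<in> Hom B b (FObj U a)"
    "i \<in> I" "h \<in> Hom A (X i) a" "Comp B (FArr U h) (\<eta> i) = f"
    "i' \<in> I" "h' \<in> Hom A (X i') a" "Comp B (FArr U h') (\<eta> i') = f"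
  shows "i = i'" "h = h'"
proof -
  have "\<exists>!(i, h). i \<in> I \<and> h \<in> Hom A (X i) a \<and> Comp B (FArr U h) (\<eta> i) = f"
    using assms(1-3) unfolding adj_family_def by simp
  from ex1_unique[OF this, of "(i, h)" "(i', h')"] have "(i, h) = (i', h')" using assms(4-9) by simp
  thus "i = i'" "h = h'" by simp_all
qed

lemma right_multi_adjoint_family:
  fixes T :: "'u itself"
  assumes "right_multi_adjoint T A B U" "b \<in> Obj B"
  obtains I :: "'u set" and X \<eta> where "small T I" "adj_family A B U b I X \<eta>"
  using assms unfolding right_multi_adjoint_def has_small_multi_initial_family_def
    multi_initial_comma_under
  by (metis (no_types))

lemma image_cone:
  assumes "cat_functor A B U" "cat_functor J A D" "cone J A D c l"
  shows "cone J B (comp_ftor U D) (FObj U c) (\<lambda>j. FArr U (l j))"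
proof -
  interpret U: cat_functor A B U by fact
  interpret D: cat_functor J A D by fact
  show ?thesis
    unfolding cone_def
  proof (intro conjI ballI)
    show "FObj U c \<in> Obj B" using assms(3) U.FObj_in_Obj unfolding cone_def by blast
    show "FArr U (l j) \<in> Hom B (FObj U c) (FObj (comp_ftor U D) j)" if "j \<in> Obj J" for j
      using assms(3) that U.FArr_in_Hom unfolding cone_def by simp
    fix u assume u: "u \<in> Arr J"
    have "l (Dom J u) \<in> Hom A c (FObj D (Dom J u))"
      using assms(3) u D.source.Dom_in_Obj unfolding cone_def by blast
    from U.FArr_Comp[OF this D.FArr_in_Hom[OF D.source.Hom_Dom_Cod[OF u]]]
    show "Comp B (FArr (comp_ftor U D) u) (FArr U (l (Dom J u))) = FArr U (l (Cod J u))"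
      using assms(3) u unfolding cone_def by simp
  qed
qed

lemma image_cocone_is_cocone:
  assumes "cat_functor A B U" "cat_functor J A D" "cocone J A D c l"
  shows "cocone J B (comp_ftor U D) (FObj U c) (\<lambda>j. FArr U (l j))"
  using image_cone[OF cat_functor_op_cat[OF assms(1)] cat_functor_op_cat[OF assms(2)], of c l]
    assms(3)
  unfolding cone_def cocone_def by simp

lemma cone_Hom: "cone J C D c l \<Longrightarrow> j \<in> Obj J \<Longrightarrow> l j \<in> Hom C c (FObj D j)"
  unfolding cone_def by blast

lemma connected_induct:
  assumes J: "connected_category J" and xy: "x \<in> Obj J" "y \<in> Obj J"
    and step: "\<And>u. u \<in> Arr J \<Longrightarrow> f (Dom J u) = f (Cod J u)"
  shows "f x = f y"
proof -
  have "(x, y) \<in> ({(Dom J f, Cod J f) |f. f \<in> Arr J} \<union> {(Cod J f, Dom J f) |f. f \<in> Arr J})\<^sup>*"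
    using J xy unfolding connected_category_def by blast
  thus ?thesis by induction (auto simp: step)
qed

lemma right_multi_adjoint_connected_limits:
  fixes T :: "'u itself"
  assumes U: "cat_functor A B U" and adj: "right_multi_adjoint T A B U"
  shows "preserves_connected_limits T A B U"
  unfolding preserves_connected_limits_def preserves_limits_of_shape_def
proof (intro allI impI)
  fix J :: "('u, 'u) cat" and D c0
  assume J0: "small_category T J \<and> connected_category J" and D0: "cat_functor J A D \<and>
    is_limit J A D c0"
  interpret U: cat_functor A B U by (rule U)
  interpret D: cat_functor J A D using D0 by simp
  have J: "connected_category J" and D: "cat_functor J A D" using J0 D0 by simp_all
  obtain c l where c0: "c0 = (c, l)" by (cases c0)
  have lim: "limit J A D c l" using D0 unfolding c0 is_limit_iff[OF D.source.category_axioms]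
    by simp
  hence l: "cone J A D c l" unfolding limit_def by simp
  have c: "c \<in> Obj A" using l unfolding cone_def by simp
  have Ul: "cone J B (comp_ftor U D) (FObj U c) (\<lambda>j. FArr U (l j))" by (rule image_cone[OF U D l])
  have "limit J B (comp_ftor U D) (FObj U c) (\<lambda>j. FArr U (l j))"
    unfolding limit_def
  proof (intro conjI allI impI Ul)
    fix b q assume q: "cone J B (comp_ftor U D) b q"
    have b: "b \<in> Obj B" using q unfolding cone_def by simp
    obtain I :: "'u set" and X \<eta> where fam: "adj_family A B U b I X \<eta>"
      using right_multi_adjoint_family[OF adj b] .
    have qj: "q j \<in> Hom B b (FObj U (FObj D j))" if "j \<in> Obj J" for j
      using cone_Hom[OF q that] by simp
    have "\<exists>i h. i \<in> I \<and> h \<in> Hom A (X i) (FObj D j) \<and> Comp B (FArr U h) (\<eta> i) = q j"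
      if "j \<in> Obj J" for j
      using adj_family_factor[OF fam D.FObj_in_Obj[OF that] qj[OF that]] by metis
    then obtain i h where i: "\<And>j. j \<in> Obj J \<Longrightarrow> i j \<in> I"
      and h: "\<And>j. j \<in> Obj J \<Longrightarrow> h j \<in> Hom A (X (i j)) (FObj D j)"
      and ih: "\<And>j. j \<in> Obj J \<Longrightarrow> Comp B (FArr U (h j)) (\<eta> (i j)) = q j" by metis
    \<comment> \<open>Since \<open>q\<close> is a cone,
      \<open>Comp A (FArr D u) (h (Dom J u))\<close> and \<open>h (Cod J u)\<close> both represent
      \<open>q (Cod J u)\<close>; uniqueness forces equal indices as well as equal arrows.\<close>
    have step: "i (Dom J u) = i (Cod J u)"
      "Comp A (FArr D u) (h (Dom J u)) = h (Cod J u)" if u: "u \<in> Arr J" for u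
    proof -
      have d: "Dom J u \<in> Obj J" "Cod J u \<in> Obj J" using u by (simp_all add: D.source.cat_simps)
      note Du = D.FArr_in_Hom[OF D.source.Hom_Dom_Cod[OF u]]
      have k: "Comp A (FArr D u) (h (Dom J u)) \<in> Hom A (X (i (Dom J u))) (FObj D (Cod J u))"
        by (rule U.source.Comp_in_Hom[OF h[OF d(1)] Du])
      have "Comp B (FArr U (Comp A (FArr D u) (h (Dom J u)))) (\<eta> (i (Dom J u))) = Comp B (FArr U
        (FArr D u)) (q (Dom J u))"
        using U.FArr_Comp_Comp[OF h[OF d(1)] Du adj_family_Hom(2)[OF fam i[OF d(1)]]] ih[OF d(1)]
          by simp
      also have "\<dots> = q (Cod J u)" using q u unfolding cone_def by simp
      finally have e: "Comp B (FArr U (Comp A (FArr D u) (h (Dom J u)))) (\<eta> (i (Dom J u))) = q (Cod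
        J u)" .
      show "i (Dom J u) = i (Cod J u)" "Comp A (FArr D u) (h (Dom J u)) = h (Cod J u)"
        by (rule adj_family_unique[OF fam D.FObj_in_Obj[OF d(2)] qj[OF d(2)] i[OF d(1)]
          k e i[OF d(2)] h[OF d(2)] ih[OF d(2)]])+
    qed
    obtain j0 where j0: "j0 \<in> Obj J" using J unfolding connected_category_def by blast
    have const: "i j = i j0" if "j \<in> Obj J" for j
      by (rule connected_induct[OF J that j0, of i]) (rule step(1))
    have "cone J A D (X (i j0)) h"
      unfolding cone_def using adj_family_Hom(1)[OF fam i[OF j0]] h const step(2) by auto
    with lim have ex: "\<exists>!k. k \<in> Hom A (X (i j0)) c \<and> (\<forall>j\<in>Obj J. Comp A (l j) k = h j)"
      unfolding limit_def by simp
    then obtain k where k: "k \<in> Hom A (X (i j0)) c" "\<And>j. j \<in> Obj J \<Longrightarrow> Comp A (l j) k = h j"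
      using ex1_implies_ex[OF ex] by blast
    note \<eta> = adj_family_Hom(2)[OF fam i[OF j0]]
    show "\<exists>!k. k \<in> Hom B b (FObj U c) \<and> (\<forall>j\<in>Obj J. Comp B (FArr U (l j)) k = q j)"
    proof (rule ex1I)
      have "Comp B (FArr U (l j)) (Comp B (FArr U k) (\<eta> (i j0))) = q j" if "j \<in> Obj J" for j
        using U.FArr_Comp_Comp[OF k(1) cone_Hom[OF l that] \<eta>] k(2)[OF that] ih[OF that]
          const[OF that] by simp
      thus "Comp B (FArr U k) (\<eta> (i j0)) \<in> Hom B b (FObj U c) \<and>
          (\<forall>j\<in>Obj J. Comp B (FArr U (l j)) (Comp B (FArr U k) (\<eta> (i j0))) = q j)"
        using U.target.Comp_in_Hom[OF \<eta> U.FArr_in_Hom[OF k(1)]] by simp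
      fix m assume m: "m \<in> Hom B b (FObj U c) \<and> (\<forall>j\<in>Obj J. Comp B (FArr U (l j)) m = q j)"
      hence m1: "m \<in> Hom B b (FObj U c)" by simp
      obtain i' g where g: "i' \<in> I" "g \<in> Hom A (X i') c" "Comp B (FArr U g) (\<eta> i') = m"
        using adj_family_factor[OF fam c m1] .
      \<comment> \<open>A competitor \<open>m\<close> could lie in another summand. Composition with
        any leg keeps its index and lands on \<open>q j\<close>, whose index is known;
        \<open>j0\<close> provides such a leg because \<open>J\<close> is nonempty.\<close>
      have lg: "i' = i j" "Comp A (l j) g = h j" if j: "j \<in> Obj J" for j
      proof -
        have e: "Comp B (FArr U (Comp A (l j) g)) (\<eta> i') = q j"
          using U.FArr_Comp_Comp[OF g(2) cone_Hom[OF l j] adj_family_Hom(2)[OF fam g(1)]]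
            g(3) m j by simp
        show "i' = i j" "Comp A (l j) g = h j"
          by (rule adj_family_unique[OF fam D.FObj_in_Obj[OF j] qj[OF j] g(1)
                U.source.Comp_in_Hom[OF g(2) cone_Hom[OF l j]] e i[OF j] h[OF j] ih[OF j]])+
      qed
      have i': "i' = i j0" by (rule lg(1)[OF j0])
      have "g = k" by (rule ex1_unique[OF ex]) (use g(2) i' lg(2) k in auto)
      thus "m = Comp B (FArr U k) (\<eta> (i j0))" using g(3) i' by simp
    qed
  qed
  hence "limit J B (comp_ftor U D) (FObj U c) (\<lambda>j\<in>Obj J. FArr U (l j))"
    unfolding limit_op_cat[symmetric]
    by (subst colimit_cong[OF category_op_cat[OF D.source.category_axioms],
      of _ "\<lambda>j. FArr U (l j)"]) simp_all
  thus "is_limit J B (comp_ftor U D) (image_cocone J U c0)"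
    unfolding c0 image_cocone_def by (simp add: is_limit_iff[OF D.source.category_axioms])
qed

lemma right_multi_adjoint_accessible:
  fixes T :: "'u itself"
  assumes A: "lfmp A T GA" and B: "lfmp B T GB"
    and U: "cat_functor A B U" and adj: "right_multi_adjoint T A B U"
  shows "accessible T A B U"
proof -
  interpret A: lfmp A T GA by (rule A)
  interpret B: lfmp B T GB by (rule B)
  interpret U: cat_functor A B U by (rule U)
  have "\<exists>(I :: 'u set) X \<eta>. small T I \<and> adj_family A B U b I X \<eta>" if b: "b \<in> GB" for b
  proof -
    have "b \<in> Obj B" using b B.G_Obj by blast
    from right_multi_adjoint_family[OF adj this] show ?thesis by metis
  qed
  then obtain I :: "_ \<Rightarrow> 'u set" and X \<eta> where I: "\<And>b. b \<in> GB \<Longrightarrow> small T (I b)"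
    and fam: "\<And>b. b \<in> GB \<Longrightarrow> adj_family A B U b (I b) (X b) (\<eta> b)" by metis
  \<comment> \<open>A union over the whole small generator and all its multi-initial families, so
    that a single \<open>lam\<close> makes every \<open>X b i\<close> presentable.\<close>
  define S where "S = (\<Union>b\<in>GB. \<Union>i\<in>I b. el_arr A GA (X b i))"
  have "small T S"
    unfolding S_def
    by (intro small_UNION[OF A.univ] B.small_G I A.small_el_arr adj_family_Hom(1)[OF fam])
  from small_regular_cardinal_above[OF A.univ this]
  obtain lam :: "'u rel" where lam: "small_regular_cardinal lam" "|S| <o lam" .
  have ic: "index_cardinal T lam" by (rule index_cardinal_small_regular[OF lam(1)])
  have cardX: "|el_arr A GA (X b i)| <o lam" if "b \<in> GB" "i \<in> I b" for b i
    by (rule ordLeq_ordLess_trans[OF card_of_mono1 lam(2)]) (use that in \<open>auto simp: S_def\<close>)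
  have "preserves_lam_filtered_colimits T lam A B U"
    unfolding preserves_lam_filtered_colimits_def preserves_colimits_of_shape_def
  proof (intro allI impI)
    fix J :: "('u, 'u) cat" and D c0
    assume J0: "small_category T J \<and> lam_filtered T lam J" and D0: "cat_functor J A D \<and>
      is_colimit J A D c0"
    interpret D: cat_functor J A D using D0 by simp
    have J: "small_category T J" "lam_filtered T lam J"
      and D: "cat_functor J A D" using J0 D0 by simp_all
    obtain c l where c0: "c0 = (c, l)" by (cases c0)
    have col: "colimit J A D c l" using D0 unfolding c0 is_colimit_iff[OF D.source.category_axioms]
      by simp
    hence l: "cocone J A D c l" unfolding colimit_def by simp
    have c: "c \<in> Obj A" using l unfolding cocone_def by simp
    have fil: "filtered T J" by (rule lam_filtered_imp_filtered[OF ic J(2)])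
    have UD: "cat_functor J B (comp_ftor U D)" by (rule cat_functor_comp_ftor[OF D U])
    \<comment> \<open>Two levels of presentability meet: \<open>J\<close> is in particular filtered,
      so the colimit in \<open>B\<close> can be tested on finitely presented objects
      \<open>s\<close>, while the \<open>lam\<close>-filteredness is used in \<open>A\<close> on the
      objects \<open>X s i\<close>.\<close>
    have "colimit J B (comp_ftor U D) (FObj U c) (\<lambda>j. FArr U (l j))"
    proof (rule B.dense_colimit[OF fil UD image_cocone_is_cocone[OF U D l]])
      fix s f assume s: "s \<in> GB" and f: "f \<in> Hom B s (FObj U c)"
      obtain i h where h: "i \<in> I s" "h \<in> Hom A (X s i) c" "Comp B (FArr U h) (\<eta> s i) = f"
        using adj_family_factor[OF fam[OF s] c f] .
      note Xi = adj_family_Hom[OF fam[OF s] h(1)]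
      from A.presentable_factor[OF ic J D col Xi(1) cardX[OF s h(1)] h(2)]
      obtain j g where g: "j \<in> Obj J" "g \<in> Hom A (X s i) (FObj D j)" "Comp A (l j) g = h" by blast
      have "Comp B (FArr U g) (\<eta> s i) \<in> Hom B s (FObj (comp_ftor U D) j)"
        using B.Comp_in_Hom[OF Xi(2) U.FArr_in_Hom[OF g(2)]] by simp
      moreover have "Comp B (FArr U (l j)) (Comp B (FArr U g) (\<eta> s i)) = f"
        using U.FArr_Comp_Comp[OF g(2) cocone_Hom[OF l g(1)] Xi(2)] g(3) h(3) by simp
      ultimately show "\<exists>j\<in>Obj J. \<exists>g\<in>Hom B s (FObj (comp_ftor U D) j). Comp B (FArr U (l j)) g = f"
        using g(1) by blast
    next
      fix s j f f'
      assume s: "s \<in> GB" and j: "j \<in> Obj J" and f0: "f \<in> Hom B s (FObj (comp_ftor U D) j)"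
        "f' \<in> Hom B s (FObj (comp_ftor U D) j)"
          and eq: "Comp B (FArr U (l j)) f = Comp B (FArr U (l j)) f'"
      have f: "f \<in> Hom B s (FObj U (FObj D j))" "f' \<in> Hom B s (FObj U (FObj D j))"
        using f0 by simp_all
      note Dj = D.FObj_in_Obj[OF j] and lj = cocone_Hom[OF l j]
      obtain i h where h: "i \<in> I s" "h \<in> Hom A (X s i) (FObj D j)" "Comp B (FArr U h) (\<eta> s i) = f"
        using adj_family_factor[OF fam[OF s] Dj f(1)] .
      obtain i' h' where h': "i' \<in> I s" "h' \<in> Hom A (X s i') (FObj D j)"
        "Comp B (FArr U h') (\<eta> s i') = f'"
        using adj_family_factor[OF fam[OF s] Dj f(2)] .
      note Xi = adj_family_Hom[OF fam[OF s] h(1)] and Xi' = adj_family_Hom[OF fam[OF s] h'(1)]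
      have 1: "Comp B (FArr U (Comp A (l j) h)) (\<eta> s i) = Comp B (FArr U (l j)) f"
        using U.FArr_Comp_Comp[OF h(2) lj Xi(2)] h(3) by simp
      have 2: "Comp B (FArr U (Comp A (l j) h')) (\<eta> s i') = Comp B (FArr U (l j)) f"
        using U.FArr_Comp_Comp[OF h'(2) lj Xi'(2)] h'(3) eq by simp
      \<comment> \<open>\<open>f\<close> and \<open>f'\<close> may a priori belong to different
        summands; after composition with the leg they coincide, so their indices agree and
        \<open>h\<close>, \<open>h'\<close> become parallel arrows with equal image in the
        colimit.\<close>
      note uq = adj_family_unique[OF fam[OF s] c B.Comp_in_Hom[OF f(1) U.FArr_in_Hom[OF lj]]
          h(1) A.Comp_in_Hom[OF h(2) lj] 1 h'(1) A.Comp_in_Hom[OF h'(2) lj] 2]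
      have h'2: "h' \<in> Hom A (X s i) (FObj D j)" using h'(2) uq(1) by simp
      from A.presentable_identify[OF ic J D col Xi(1) cardX[OF s h(1)] j h(2) h'2 uq(2)]
      obtain k u where u: "u \<in> Hom J j k" "Comp A (FArr D u) h = Comp A (FArr D u) h'" by blast
      have "Comp B (FArr U (FArr D u)) f = Comp B (FArr U (FArr D u)) f'"
        using U.FArr_Comp_Comp[OF h(2) D.FArr_in_Hom[OF u(1)] Xi(2)]
          U.FArr_Comp_Comp[OF h'2 D.FArr_in_Hom[OF u(1)] Xi(2)] h(3) h'(3) uq(1) u(2) by simp
      thus "\<exists>k. \<exists>u\<in>Hom J j k. Comp B (FArr (comp_ftor U D) u) f = Comp B (FArr (comp_ftor U D) u)
        f'"
        using u(1) by auto
    qed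
    hence "colimit J B (comp_ftor U D) (FObj U c) (\<lambda>j\<in>Obj J. FArr U (l j))"
      by (subst colimit_cong[OF D.source.category_axioms, of _ "\<lambda>j. FArr U (l j)"]) simp_all
    thus "is_colimit J B (comp_ftor U D) (image_cocone J U c0)"
      unfolding c0 image_cocone_def by (simp add: is_colimit_iff[OF D.source.category_axioms])
  qed
  thus ?thesis unfolding accessible_def using lam(1) by blast
qed

section \<open>Connected limits from multicolimits\<close>

text \<open>A common shape for index categories whose arrows are arrows of \<open>C\<close> between
  the objects \<open>\<phi> x\<close>: cones with apex in the generator, elements, and the comma
  category below \<open>U\<close> are all instances.\<close>

definition over_cat ::
  "('o, 'm) cat \<Rightarrow> ('p \<Rightarrow> 'o) \<Rightarrow> 'p set \<Rightarrow> ('p \<Rightarrow> 'p \<Rightarrow> 'm set) \<Rightarrow> ('p, 'p \<times> 'm \<times> 'p) cat" where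
  "over_cat C \<phi> X H = cat_of_homs X H (\<lambda>x. Ident C (\<phi> x)) (\<lambda>_. Comp C)"

definition over_ftor :: "('p \<Rightarrow> 'o) \<Rightarrow> ('p, 'p \<times> 'm \<times> 'p, 'o, 'm) ftor" where
  "over_ftor \<phi> = \<lparr>FObj = \<phi>, FArr = (\<lambda>(p, h, q). h)\<rparr>"

lemma over_ftor_simps [simp]: "FObj (over_ftor \<phi>) x = \<phi> x" "FArr (over_ftor \<phi>) (p, h, q) = h"
  by (simp_all add: over_ftor_def)

lemma over_cat_simps [simp]:
  "Obj (over_cat C \<phi> X H) = X"
  "(x, h, y) \<in> Arr (over_cat C \<phi> X H) \<longleftrightarrow> x \<in> X \<and> y \<in> X \<and> h \<in> H x y"
  "Dom (over_cat C \<phi> X H) (x, h, y) = x"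
  "Cod (over_cat C \<phi> X H) (x, h, y) = y"
  "Ident (over_cat C \<phi> X H) x = (x, Ident C (\<phi> x), x)"
  "Comp (over_cat C \<phi> X H) (y', g, z) (x, h, y) = (x, Comp C g h, z)"
  by (simp_all add: over_cat_def)

lemma Hom_over_cat:
  "F \<in> Hom (over_cat C \<phi> X H) x y \<longleftrightarrow> x \<in> X \<and> y \<in> X \<and> (\<exists>h\<in>H x y. F = (x, h, y))"
  unfolding over_cat_def by (rule Hom_cat_of_homs)

lemma over_cat_functor:
  assumes "category C" and \<phi>: "\<And>x. x \<in> X \<Longrightarrow> \<phi> x \<in> Obj C"
    and H: "\<And>x y h. x \<in> X \<Longrightarrow> y \<in> X \<Longrightarrow> h \<in> H x y \<Longrightarrow> h \<in> Hom C (\<phi> x) (\<phi> y)"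
    and i: "\<And>x. x \<in> X \<Longrightarrow> Ident C (\<phi> x) \<in> H x x"
    and c: "\<And>x y z f g. x \<in> X \<Longrightarrow> y \<in> X \<Longrightarrow> z \<in> X \<Longrightarrow> f \<in> H x y \<Longrightarrow> g \<in> H y z \<Longrightarrow> Comp C g f \<in> H x z"
  shows "cat_functor (over_cat C \<phi> X H) C (over_ftor \<phi>)"
proof -
  interpret category C by fact
  have "category (over_cat C \<phi> X H)"
    unfolding over_cat_def
  proof (rule category_cat_of_homs)
    show "Comp C f (Ident C (\<phi> x)) = f" if "x \<in> X" "y \<in> X" "f \<in> H x y" for x y f
      using Comp_Ident[OF H[OF that]] .
    show "Comp C (Ident C (\<phi> y)) f = f" if "x \<in> X" "y \<in> X" "f \<in> H x y" for x y f
      using Ident_Comp[OF H[OF that]] .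
    show "Comp C h (Comp C g f) = Comp C (Comp C h g) f"
      if o: "w \<in> X" "x \<in> X" "y \<in> X" "z \<in> X" and "f \<in> H w x" "g \<in> H x y"
        "h \<in> H y z" for w x y z f g h
      using Comp_assoc[OF H[OF o(1,2)] H[OF o(2,3)] H[OF o(3,4)]] that(5-7) .
  qed (use i c in auto)
  thus ?thesis
    by (intro cat_functor.intro category_axioms cat_functor_axioms.intro)
      (auto simp: Hom_over_cat \<phi> intro: H)
qed

lemma cocone_over_cat:
  "cocone (over_cat C \<phi> X H) C (over_ftor \<phi>) y m \<longleftrightarrow> y \<in> Obj C \<and> (\<forall>x\<in>X. m x \<in> Hom C (\<phi> x) y) \<and>
    (\<forall>x\<in>X. \<forall>x'\<in>X. \<forall>h\<in>H x x'. Comp C (m x') h = m x)"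
proof -
  have "(\<forall>u\<in>Arr (over_cat C \<phi> X H). P u) \<longleftrightarrow> (\<forall>x\<in>X. \<forall>x'\<in>X. \<forall>h\<in>H x x'. P (x, h, x'))" for P
    unfolding over_cat_def Arr_cat_of_homs by simp
  thus ?thesis unfolding cocone_def by simp
qed

lemma small_over_cat:
  assumes "universe T" "locally_small T C" "cat_functor (over_cat C \<phi> X H) C (over_ftor \<phi>)"
    "small T X"
    and \<phi>: "\<And>x. x \<in> X \<Longrightarrow> \<phi> x \<in> Obj C"
    and H: "\<And>x y h. x \<in> X \<Longrightarrow> y \<in> X \<Longrightarrow> h \<in> H x y \<Longrightarrow> h \<in> Hom C (\<phi> x) (\<phi> y)"
  shows "small_category T (over_cat C \<phi> X H)"
proof -
  have "small T (H x y)" if "x \<in> X" "y \<in> X" for x y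
  proof (rule small_subset)
    show "H x y \<subseteq> Hom C (\<phi> x) (\<phi> y)" using H[OF that] by blast
    show "small T (Hom C (\<phi> x) (\<phi> y))" using assms(2) \<phi> that unfolding locally_small_def by simp
  qed
  moreover have "category (over_cat C \<phi> X H)" using assms(3) cat_functor.axioms(1) by blast
  ultimately show ?thesis
    unfolding over_cat_def using assms(1,4) by (intro small_category_cat_of_homs) auto
qed

lemma cone_precompose:
  assumes "category C" "cat_functor J C D" "cone J C D c q" "a \<in> Hom C x c"
  shows "cone J C D x (\<lambda>j. Comp C (q j) a)"
proof -
  interpret D: cat_functor J C D by fact
  show ?thesis
    unfolding cone_def
  proof (intro conjI ballI)
    show "x \<in> Obj C" by (rule D.target.Hom_Obj(1)[OF assms(4)])
    show "Comp C (q j) a \<in> Hom C x (FObj D j)" if "j \<in> Obj J" for j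
      by (rule D.target.Comp_in_Hom[OF assms(4) cone_Hom[OF assms(3) that]])
    fix u assume u: "u \<in> Arr J"
    have "Comp C (FArr D u) (q (Dom J u)) = q (Cod J u)"
      using assms(3) u unfolding cone_def by blast
    thus "Comp C (FArr D u) (Comp C (q (Dom J u)) a) = Comp C (q (Cod J u)) a"
      using D.target.assoc[OF assms(4) cone_Hom[OF assms(3) D.source.Dom_in_Obj[OF u]]
          D.FArr_in_Hom[OF D.source.Hom_Dom_Cod[OF u]]] by simp
  qed
qed

lemma cone_cong:
  assumes "category J" "\<And>j. j \<in> Obj J \<Longrightarrow> l j = l' j"
  shows "cone J C D c l \<longleftrightarrow> cone J C D c l'"
  unfolding cone_op_cat[symmetric] by (rule cocone_cong[OF category_op_cat[OF assms(1)]]) (simp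
    add: assms(2))

text \<open>A limit is determined by its elements, which must be the cones with apex in the
  generator; these form a small category. Its colimit would be the limit, but only a multicolimit is
  available, and connectedness of \<open>J\<close> selects one component.\<close>

lemma connected_limit_exists:
  fixes T :: "'u itself" and J :: "('j, 'k) cat"
  assumes C: "lfmp C T G" and J: "small_category T J" "connected_category J"
    and D: "cat_functor J C D"
  shows "\<exists>c l. limit J C D c l"
proof -
  interpret C: lfmp C T G by (rule C)
  interpret D: cat_functor J C D by (rule D)
  define X where "X = {(s, \<alpha>). s \<in> G \<and> cone J C D s \<alpha> \<and> \<alpha> \<in> extensional (Obj J)}"
  define H where "H = (\<lambda>p q. {h \<in> Hom C (fst p) (fst q). \<forall>j\<in>Obj J. Comp C (snd q j) h = snd p j})"
  let ?K = "over_cat C fst X H"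
  have X: "fst p \<in> Obj C" "fst p \<in> G" "cone J C D (fst p) (snd p)" if "p \<in> X" for p
    using that C.G_Obj unfolding X_def by auto
  have XH: "snd p j \<in> Hom C (fst p) (FObj D j)" if "p \<in> X" "j \<in> Obj J" for p j
    by (rule cone_Hom[OF X(3)[OF that(1)] that(2)])
  have HH: "h \<in> Hom C (fst p) (fst q)" "\<And>j. j \<in> Obj J \<Longrightarrow> Comp C (snd q j) h = snd p j"
    if "h \<in> H p q" for h p q
    using that unfolding H_def by auto
  have K: "cat_functor ?K C (over_ftor fst)"
  proof (rule over_cat_functor[OF C.category_axioms X(1) HH(1)])
    show "Ident C (fst x) \<in> H x x" if "x \<in> X" for x
      unfolding H_def using C.Ident_in_Hom[OF X(1)[OF that]] C.Comp_Ident[OF XH[OF that]] by simp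
    fix x y z f g assume x: "x \<in> X" "y \<in> X" "z \<in> X" and f: "f \<in> H x y" and g: "g \<in> H y z"
    have "Comp C (snd z j) (Comp C g f) = snd x j" if j: "j \<in> Obj J" for j
      using C.assoc[OF HH(1)[OF f] HH(1)[OF g] XH[OF x(3) j]] HH(2)[OF g j] HH(2)[OF f j] by simp
    thus "Comp C g f \<in> H x z" unfolding H_def
      using C.Comp_in_Hom[OF HH(1)[OF f] HH(1)[OF g]] by simp
  qed
  have "small T X"
  proof (rule small_subset)
    show "X \<subseteq> (SIGMA s:G. PiE (Obj J) (\<lambda>j. Hom C s (FObj D j)))"
      unfolding X_def cone_def PiE_def by auto
    have "small T (Hom C s (FObj D j))" if "s \<in> G" "j \<in> Obj J" for s j
      using C.locally_small that C.G_Obj D.FObj_in_Obj unfolding locally_small_def by blast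
    thus "small T (SIGMA s:G. PiE (Obj J) (\<lambda>j. Hom C s (FObj D j)))"
      using J(1) unfolding small_category_def
      by (intro small_Sigma[OF C.univ] small_PiE[OF C.univ] C.small_G) simp_all
  qed
  have "small_category T ?K"
    by (rule small_over_cat[OF C.univ C.locally_small K \<open>small T X\<close> X(1) HH(1)])
  from multicocomplete_small[OF C.multicocomplete this K]
  obtain I :: "'u set" and Y L where mcl: "multicolimit ?K C (over_ftor fst) I Y L" .
  have Lc: "Y i \<in> Obj C" "\<And>p. p \<in> X \<Longrightarrow> L i p \<in> Hom C (fst p) (Y i)"
    "\<And>p q h. p \<in> X \<Longrightarrow> q \<in> X \<Longrightarrow> h \<in> H p q \<Longrightarrow> Comp C (L i q) h = L i p" if "i \<in> I" for i
    using multicolimit_cocone[OF mcl that] unfolding cocone_over_cat by simp_all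
  \<comment> \<open>Evaluating all cones at \<open>j\<close> makes the vertex
    \<open>FObj D j\<close> a cocone over the category of cones; hence it selects a component and
    receives the \<open>j\<close>-th projection.\<close>
  have cc: "cocone ?K C (over_ftor fst) (FObj D j) (\<lambda>p. snd p j)" if j: "j \<in> Obj J" for j
    unfolding cocone_over_cat using D.FObj_in_Obj[OF j] XH[OF _ j] HH(2)[OF _ j] by simp
  have "\<exists>i p. i \<in> I \<and> p \<in> Hom C (Y i) (FObj D j) \<and>
    (\<forall>x\<in>X. Comp C p (L i x) = snd x j)" if j: "j \<in> Obj J" for j
    using multicolimit_factor[OF mcl cc[OF j]] by (metis over_cat_simps(1))
  then obtain i p where i: "\<And>j. j \<in> Obj J \<Longrightarrow> i j \<in> I"
    and p: "\<And>j. j \<in> Obj J \<Longrightarrow> p j \<in> Hom C (Y (i j)) (FObj D j)"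
    and pL: "\<And>j x. j \<in> Obj J \<Longrightarrow> x \<in> X \<Longrightarrow> Comp C (p j) (L (i j) x) = snd x j" by metis
  have step: "i (Dom J u) = i (Cod J u)"
    "Comp C (FArr D u) (p (Dom J u)) = p (Cod J u)" if u: "u \<in> Arr J" for u
  proof -
    have d: "Dom J u \<in> Obj J" "Cod J u \<in> Obj J" using u by (simp_all add: D.source.cat_simps)
    note Du = D.FArr_in_Hom[OF D.source.Hom_Dom_Cod[OF u]]
    have k: "Comp C (FArr D u) (p (Dom J u)) \<in> Hom C (Y (i (Dom J u))) (FObj D (Cod J u))"
      by (rule C.Comp_in_Hom[OF p[OF d(1)] Du])
    have e: "Comp C (Comp C (FArr D u) (p (Dom J u))) (L (i (Dom J u)) x) = snd x (Cod J u)"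
      if "x \<in> X" for x
    proof -
      have "Comp C (FArr D u) (snd x (Dom J u)) = snd x (Cod J u)"
        using X(3)[OF that] u unfolding cone_def by blast
      thus ?thesis
        using C.assoc[OF Lc(2)[OF i[OF d(1)] that] p[OF d(1)] Du] pL[OF d(1) that] by simp
    qed
    show "i (Dom J u) = i (Cod J u)" "Comp C (FArr D u) (p (Dom J u)) = p (Cod J u)"
      by (rule multicolimit_unique[OF mcl cc[OF d(2)] i[OF d(2)] p[OF d(2)] _ i[OF d(1)] k],
          simp add: pL[OF d(2)], simp add: e)+
  qed
  obtain j0 where j0: "j0 \<in> Obj J" using J(2) unfolding connected_category_def by blast
  define z where "z = Y (i j0)"
  define l where "l = L (i j0)"
  have const: "i j = i j0" if "j \<in> Obj J" for j
    by (rule connected_induct[OF J(2) that j0, of i]) (rule step(1))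
  have pz: "p j \<in> Hom C z (FObj D j)" "\<And>x. x \<in> X \<Longrightarrow> Comp C (p j) (l x) = snd x j"
    if "j \<in> Obj J" for j
    using p[OF that] pL[OF that] const[OF that] unfolding z_def l_def by simp_all
  have z: "z \<in> Obj C" and l: "\<And>x. x \<in> X \<Longrightarrow> l x \<in> Hom C (fst x) z"
    and lH: "\<And>x y h. x \<in> X \<Longrightarrow> y \<in> X \<Longrightarrow> h \<in> H x y \<Longrightarrow> Comp C (l y) h = l x"
    using Lc[OF i[OF j0]] unfolding z_def l_def by simp_all
  have pcone: "cone J C D z p" unfolding cone_def using z pz(1) step(2) by simp
  \<comment> \<open>An element \<open>a\<close> of the apex of \<open>q\<close> restricts
    \<open>q\<close> to a cone with apex in the generator, that is, to a member of
    \<open>X\<close>.\<close>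
  define \<sigma> where "\<sigma> q a = (Dom C a, \<lambda>j\<in>Obj J. Comp C (q j) a)" for q a
  have \<sigma>: "\<sigma> q a \<in> X" if "cone J C D y q" "a \<in> el C G y" for y q a
  proof -
    have a: "a \<in> Hom C (Dom C a) y" "Dom C a \<in> G" using that(2) unfolding C.el_iff by blast+
    have "cone J C D (Dom C a) (\<lambda>j\<in>Obj J. Comp C (q j) a)"
      using cone_precompose[OF C.category_axioms D that(1) a(1)]
      by (subst (asm) cone_cong[OF D.source.category_axioms,
        of _ "\<lambda>j\<in>Obj J. Comp C (q j) a"]) simp_all
    thus ?thesis unfolding \<sigma>_def X_def using a(2) by simp
  qed
  \<comment> \<open>By density it suffices to prescribe the mediating arrow on elements; the element
    \<open>a\<close> is sent to the leg at its restricted cone.\<close>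
  have med: "\<exists>h\<in>Hom C y z. \<forall>a\<in>el C G y. Comp C h a = l (\<sigma> q a)" if q: "cone J C D y q" for y q
  proof (rule C.dense_ex)
    show "y \<in> Obj C" using q unfolding cone_def by simp
    show "z \<in> Obj C" by (rule z)
    show "l (\<sigma> q a) \<in> Hom C (Dom C a) z" if "a \<in> el C G y" for a
      using l[OF \<sigma>[OF q that]] unfolding \<sigma>_def by simp
    fix a k assume "(a, k) \<in> el_arr C G y"
    note ak = C.el_arrD[OF this]
    have a: "a \<in> Hom C (Dom C a) y" using ak(1) unfolding C.el_iff by blast
    have "k \<in> H (\<sigma> q (Comp C a k)) (\<sigma> q a)"
      unfolding H_def \<sigma>_def using ak(2,5) C.assoc[OF ak(2) a cone_Hom[OF q]] by simp
    thus "Comp C (l (\<sigma> q a)) k = l (\<sigma> q (Comp C a k))" by (rule lH[OF \<sigma>[OF q ak(4)] \<sigma>[OF q ak(1)]])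
  qed
  txt \<open>The endomorphism of \<open>z\<close> that \<open>med\<close> attaches to the cone \<open>p\<close> fixes every \<open>l x\<close>,
    so it is the identity.\<close>
  have self: "l (\<sigma> p g) = g" if g: "g \<in> el C G z" for g
  proof -
    obtain \<theta> where \<theta>: "\<theta> \<in> Hom C z z" "\<And>a. a \<in> el C G z \<Longrightarrow> Comp C \<theta> a = l (\<sigma> p a)"
      using med[OF pcone] by blast
    have \<theta>l: "Comp C \<theta> (l x) = l x" if x: "x \<in> X" for x
    proof -
      have d: "Dom C (l x) = fst x" by (rule HomD(2)[OF l[OF x]])
      have "l x \<in> el C G z" unfolding C.el_iff d using l[OF x] X(2)[OF x] by simp
      moreover have "\<sigma> p (l x) = x"
      proof -
        have "(\<lambda>j\<in>Obj J. Comp C (p j) (l x)) = snd x"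
          by (rule extensionalityI[of _ "Obj J"]) (use x pz(2) in \<open>auto simp: X_def\<close>)
        thus ?thesis unfolding \<sigma>_def d by simp
      qed
      ultimately show ?thesis using \<theta>(2) by simp
    qed
    have "\<theta> = Ident C z"
    proof (rule multicolimit_unique(2)[OF mcl multicolimit_cocone[OF mcl i[OF j0]]
      i[OF j0] _ _ i[OF j0]])
      show "Ident C z \<in> Hom C (Y (i j0)) (Y (i j0))" "\<theta> \<in> Hom C (Y (i j0)) (Y (i j0))"
        using C.Ident_in_Hom[OF z] \<theta>(1) unfolding z_def by simp_all
      show "Comp C (Ident C z) (L (i j0) x) = L (i j0) x" if "x \<in> Obj ?K" for x
        using C.Ident_Comp[OF l[of x]] that unfolding l_def by simp
      show "Comp C \<theta> (L (i j0) x) = L (i j0) x" if "x \<in> Obj ?K" for x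
        using \<theta>l[of x] that unfolding l_def by simp
    qed
    moreover have "g \<in> Hom C (Dom C g) z" using g unfolding C.el_iff by blast
    ultimately show ?thesis using \<theta>(2)[OF g] C.Ident_Comp by simp
  qed
  have "limit J C D z p"
    unfolding limit_def
  proof (intro conjI allI impI pcone)
    fix y q assume q: "cone J C D y q"
    obtain h where h: "h \<in> Hom C y z" "\<And>a. a \<in> el C G y \<Longrightarrow> Comp C h a = l (\<sigma> q a)"
      using med[OF q] by blast
    show "\<exists>!h. h \<in> Hom C y z \<and> (\<forall>j\<in>Obj J. Comp C (p j) h = q j)"
    proof (rule ex1I)
      have "Comp C (p j) h = q j" if j: "j \<in> Obj J" for j
      proof (rule C.dense_unique[OF C.Comp_in_Hom[OF h(1) pz(1)[OF j]] cone_Hom[OF q j]])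
        fix a assume a: "a \<in> el C G y"
        hence "a \<in> Hom C (Dom C a) y" unfolding C.el_iff by blast
        from C.assoc[OF this h(1) pz(1)[OF j]]
        show "Comp C (Comp C (p j) h) a = Comp C (q j) a"
          using h(2)[OF a] pz(2)[OF j \<sigma>[OF q a]] j unfolding \<sigma>_def by simp
      qed
      thus "h \<in> Hom C y z \<and> (\<forall>j\<in>Obj J. Comp C (p j) h = q j)" using h(1) by simp
      fix h' assume h': "h' \<in> Hom C y z \<and> (\<forall>j\<in>Obj J. Comp C (p j) h' = q j)"
      hence h'1: "h' \<in> Hom C y z" by simp
      show "h' = h"
      proof (rule C.dense_unique[OF h'1 h(1)])
        fix a assume a: "a \<in> el C G y"
        hence a': "a \<in> Hom C (Dom C a) y" "Dom C a \<in> G" unfolding C.el_iff by blast+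
        have ha: "Comp C h' a \<in> Hom C (Dom C a) z" by (rule C.Comp_in_Hom[OF a'(1) h'1])
        hence d: "Dom C (Comp C h' a) = Dom C a" by (rule HomD(2))
        \<comment> \<open>By \<open>self\<close>, an element of \<open>z\<close> is recovered from
          its projections. The projections of \<open>Comp C h' a\<close> are those of
          \<open>q\<close> restricted along \<open>a\<close>, whatever the competitor
          \<open>h'\<close> is.\<close>
        have "\<sigma> p (Comp C h' a) = \<sigma> q a"
          unfolding \<sigma>_def d using C.assoc[OF a'(1) h'1 pz(1)] h' by (auto simp: restrict_def)
        moreover have "l (\<sigma> p (Comp C h' a)) = Comp C h' a"
          by (rule self) (use ha a'(2) in \<open>simp add: C.el_iff d\<close>)
        ultimately show "Comp C h' a = Comp C h a" using h(2)[OF a] by simp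
      qed
    qed
  qed
  thus ?thesis by blast
qed

section \<open>Multi-initial families from weakly initial sets\<close>

definition full_subcat :: "('o, 'm) cat \<Rightarrow> 'o set \<Rightarrow> ('o, 'm) cat" where
  "full_subcat C S = C\<lparr>Obj := S, Arr := {f \<in> Arr C. Dom C f \<in> S \<and> Cod C f \<in> S}\<rparr>"

lemma full_subcat_simps [simp]: "Obj (full_subcat C S) = S"
  "Arr (full_subcat C S) = {f \<in> Arr C. Dom C f \<in> S \<and> Cod C f \<in> S}"
  "Dom (full_subcat C S) = Dom C" "Cod (full_subcat C S) = Cod C"
  "Ident (full_subcat C S) = Ident C" "Comp (full_subcat C S) = Comp C"
  by (simp_all add: full_subcat_def)

lemma Hom_full_subcat: "f \<in> Hom (full_subcat C S) x y \<longleftrightarrow> x \<in> S \<and> y \<in> S \<and> f \<in> Hom C x y"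
  unfolding Hom_iff by auto

lemma category_full_subcat:
  assumes "category C" "S \<subseteq> Obj C"
  shows "category (full_subcat C S)"
proof -
  interpret category C by fact
  show ?thesis
    by unfold_locales
      (use assms(2) in \<open>auto simp: Hom_full_subcat Comp_Ident Ident_Comp Comp_assoc intro:
        Ident_in_Hom Comp_in_Hom\<close>)
qed

text \<open>A fragment of the limit of the full subcategory on \<open>S\<close>: a compatible cone
  together with uniqueness for endomorphisms of its apex. This is exactly what splits an
  idempotent-like composite in \<open>component_cone_initial\<close>.\<close>

definition monic_cone :: "('o, 'm) cat \<Rightarrow> 'o set \<Rightarrow> 'o \<Rightarrow> ('o \<Rightarrow> 'm) \<Rightarrow> bool" where
  "monic_cone C S L \<pi> \<longleftrightarrow> L \<in> Obj C \<and> (\<forall>k\<in>S. \<pi> k \<in> Hom C L k) \<and>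
     (\<forall>k\<in>S. \<forall>k'\<in>S. \<forall>u\<in>Hom C k k'. Comp C u (\<pi> k) = \<pi> k') \<and>
     (\<forall>h\<in>Hom C L L. (\<forall>k\<in>S. Comp C (\<pi> k) h = \<pi> k) \<longrightarrow> h = Ident C L)"

context
  fixes E :: "('o, 'm) cat" and T :: "'u itself" and W :: "'o set"
  assumes E: "category E" and univ: "universe T" and W: "W \<subseteq> Obj E" "small T W"
    and weak: "\<And>c. c \<in> Obj E \<Longrightarrow> \<exists>w\<in>W. \<exists>f. f \<in> Hom E w c"
    and cones: "\<And>S. S \<subseteq> Obj E \<Longrightarrow> small T S \<Longrightarrow> connected_category (full_subcat E S) \<Longrightarrow>
      \<exists>L \<pi>. monic_cone E S L \<pi>"
begin

interpretation E: category E by (rule E)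

section \<open>Connected components described by spans\<close>

definition "has_span x y \<longleftrightarrow> (\<exists>z f g. f \<in> Hom E z x \<and> g \<in> Hom E z y)"

lemma connected_star:
  assumes "S \<subseteq> Obj E" "z \<in> S" "\<And>x. x \<in> S \<Longrightarrow> (\<exists>f. f \<in> Hom E x z) \<or> (\<exists>w\<in>S. \<exists>f g. f \<in> Hom E w x \<and>
    g \<in> Hom E w z)"
  shows "connected_category (full_subcat E S)"
proof -
  let ?J = "full_subcat E S"
  let ?R = "{(Dom ?J f, Cod ?J f) |f. f \<in> Arr ?J} \<union> {(Cod ?J f, Dom ?J f) |f. f \<in> Arr ?J}"
  have R: "(x, y) \<in> ?R" "(y, x) \<in> ?R" if "f \<in> Hom E x y" "x \<in> S" "y \<in> S" for f x y
    using that unfolding Hom_iff by (auto 4 4)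
  have z: "(x, z) \<in> ?R\<^sup>*" "(z, x) \<in> ?R\<^sup>*" if x: "x \<in> S" for x
  proof -
    have "(x, z) \<in> ?R\<^sup>* \<and> (z, x) \<in> ?R\<^sup>*"
      using assms(3)[OF x]
    proof (elim disjE exE bexE conjE)
      fix f assume "f \<in> Hom E x z"
      from R[OF this x assms(2)] show ?thesis by (blast intro: r_into_rtrancl)
    next
      fix w f g assume w: "w \<in> S" "f \<in> Hom E w x" "g \<in> Hom E w z"
      from R[OF w(2,1) x] R[OF w(3,1) assms(2)] show ?thesis
        by (meson converse_rtrancl_into_rtrancl r_into_rtrancl)
    qed
    thus "(x, z) \<in> ?R\<^sup>*" "(z, x) \<in> ?R\<^sup>*" by simp_all
  qed
  have "(x, y) \<in> ?R\<^sup>*" if "x \<in> S" "y \<in> S" for x y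
    by (rule rtrancl_trans[OF z(1)[OF that(1)] z(2)[OF that(2)]])
  thus ?thesis
    unfolding connected_category_def using category_full_subcat[OF E assms(1)] assms(2) by auto
qed

text \<open>A cone over the full subcategory on the three objects is compatible with
  \<open>f\<close> and \<open>g\<close> in particular. With such squares spans compose, so zigzags
  can be replaced by single spans.\<close>

lemma cospan_square:
  assumes "f \<in> Hom E x z" "g \<in> Hom E y z"
  obtains r p q where "p \<in> Hom E r x" "q \<in> Hom E r y" "Comp E f p = Comp E g q"
proof -
  have S: "{x, y, z} \<subseteq> Obj E" using E.Hom_Obj assms by blast
  have "connected_category (full_subcat E {x, y, z})"
    by (rule connected_star[OF S, of z]) (use assms E.Ident_in_Hom[of z] S in auto)
  moreover have "small T {x, y, z}" by (rule small_finite[OF univ]) simp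
  ultimately obtain L \<pi> where L: "monic_cone E {x, y, z} L \<pi>" using cones[OF S] by blast
  show thesis
  proof (rule that)
    show "\<pi> x \<in> Hom E L x" "\<pi> y \<in> Hom E L y" using L unfolding monic_cone_def by simp_all
    have "Comp E f (\<pi> x) = \<pi> z" "Comp E g (\<pi> y) = \<pi> z"
      using L assms unfolding monic_cone_def by simp_all
    thus "Comp E f (\<pi> x) = Comp E g (\<pi> y)" by simp
  qed
qed

lemma has_span_of_Hom: "f \<in> Hom E x y \<Longrightarrow> has_span x y" "f \<in> Hom E x y \<Longrightarrow> has_span y x"
  unfolding has_span_def using E.Ident_in_Hom[OF E.Hom_Obj(1)] by blast+

lemma has_span_sym: "has_span x y \<Longrightarrow> has_span y x"
  unfolding has_span_def by blast

lemma has_span_trans: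
  assumes "has_span x y" "has_span y z"
  shows "has_span x z"
proof -
  obtain s f g where 1: "f \<in> Hom E s x" "g \<in> Hom E s y"
    using assms(1) unfolding has_span_def by blast
  obtain t h k where 2: "h \<in> Hom E t y" "k \<in> Hom E t z"
    using assms(2) unfolding has_span_def by blast
  obtain r p q where "p \<in> Hom E r s" "q \<in> Hom E r t" using cospan_square[OF 1(2) 2(1)] .
  hence "Comp E f p \<in> Hom E r x" "Comp E k q \<in> Hom E r z" using E.Comp_in_Hom 1(1) 2(2) by simp_all
  thus ?thesis unfolding has_span_def by blast
qed

text \<open>A connected component is represented by its trace on the weakly initial set
  \<open>W\<close>. The trace is nonempty, and only a small set of traces occurs.\<close>

definition "component c = {w \<in> W. has_span w c}"

lemma component_eq:
  assumes "has_span x y"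
  shows "component x = component y"
proof -
  have "has_span w x \<longleftrightarrow> has_span w y" for w
    by (rule iffI) (fact has_span_trans[OF _ assms],
      fact has_span_trans[OF _ has_span_sym[OF assms]])
  thus ?thesis unfolding component_def by simp
qed

lemma component_witness:
  assumes "c \<in> Obj E"
  obtains w f where "w \<in> component c" "f \<in> Hom E w c"
  using weak[OF assms] has_span_of_Hom(1) unfolding component_def by blast

text \<open>The trace is itself connected: a span between two of its members is extended by a member
  of \<open>W\<close> that maps to its apex, and that member lies in the same component.\<close>

lemma component_cone:
  assumes c: "c \<in> Obj E"
  shows "\<exists>L \<pi>. monic_cone E (component c) L \<pi>"
proof (rule cones)
  show S: "component c \<subseteq> Obj E" unfolding component_def using W(1) by blast
  show "small T (component c)" by (rule small_subset[OF _ W(2)]) (auto simp: component_def)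
  obtain w0 f0 where w0: "w0 \<in> component c" "f0 \<in> Hom E w0 c" using component_witness[OF c] .
  show "connected_category (full_subcat E (component c))"
  proof (rule connected_star[OF S w0(1)])
    fix w assume w: "w \<in> component c"
    have "has_span w w0" using w w0(1) has_span_trans has_span_sym unfolding component_def by blast
    then obtain z f g where z: "f \<in> Hom E z w" "g \<in> Hom E z w0" unfolding has_span_def by blast
    obtain v h where v: "v \<in> W" "h \<in> Hom E v z" using weak[OF E.Hom_Obj(1)[OF z(1)]] by blast
    have 1: "Comp E f h \<in> Hom E v w" "Comp E g h \<in> Hom E v w0"
      using E.Comp_in_Hom[OF v(2)] z by simp_all
    have "has_span v c" using has_span_trans[OF has_span_of_Hom(1)[OF 1(1)]]
      w unfolding component_def by blast
    hence "v \<in> component c" unfolding component_def using v(1) by simp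
    thus "(\<exists>f. f \<in> Hom E w w0) \<or> (\<exists>v\<in>component c. \<exists>f g. f \<in> Hom E v w \<and> g \<in> Hom E v w0)"
      using 1 by blast
  qed
qed

text \<open>Freyd's argument inside one component: some \<open>w0\<close> in the trace maps back to
  the apex \<open>L\<close>, the loop through \<open>w0\<close> is the identity, so every arrow out
  of \<open>L\<close> factors through the leg at \<open>w0\<close> and is one of the composites that
  \<open>indep\<close> identifies.\<close>

lemma component_cone_initial:
  assumes c: "c \<in> Obj E" and L: "monic_cone E (component c) L \<pi>"
  shows "\<exists>!f. f \<in> Hom E L c"
proof -
  have \<pi>: "\<And>k. k \<in> component c \<Longrightarrow> \<pi> k \<in> Hom E L k" and LO: "L \<in> Obj E"
    and nat: "\<And>k k' u. k \<in> component c \<Longrightarrow> k' \<in> component c \<Longrightarrow> u \<in> Hom E k k' \<Longrightarrow> Comp E u (\<pi> k) = \<pi> k'"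
    and mono: "\<And>h. h \<in> Hom E L L \<Longrightarrow> (\<And>k. k \<in> component c \<Longrightarrow> Comp E (\<pi> k) h = \<pi> k) \<Longrightarrow> h = Ident E L"
    using L unfolding monic_cone_def by simp_all
  \<comment> \<open>The two arrows into \<open>c\<close> are completed to a square, whose apex is
    then covered by a member \<open>v\<close> of \<open>W\<close>; both composites equal one that
    passes through the leg at \<open>v\<close>.\<close>
  have indep: "Comp E f (\<pi> w) = Comp E f' (\<pi> w')"
    if w: "w \<in> component c" "w' \<in> component c"
      and f: "f \<in> Hom E w c" "f' \<in> Hom E w' c" for w w' f f'
  proof -
    obtain r p q where r: "p \<in> Hom E r w" "q \<in> Hom E r w'" "Comp E f p = Comp E f' q"
      using cospan_square[OF f] .
    obtain v h where v: "v \<in> W" "h \<in> Hom E v r" using weak[OF E.Hom_Obj(1)[OF r(1)]] by blast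
    have ph: "Comp E p h \<in> Hom E v w" and qh: "Comp E q h \<in> Hom E v w'"
      using E.Comp_in_Hom[OF v(2)] r by simp_all
    have "has_span v c" using has_span_trans[OF has_span_of_Hom(1)[OF ph]]
      w(1) unfolding component_def by blast
    hence vc: "v \<in> component c" unfolding component_def using v(1) by simp
    have "Comp E f (\<pi> w) = Comp E (Comp E f (Comp E p h)) (\<pi> v)"
      using nat[OF vc w(1) ph] E.assoc[OF \<pi>[OF vc] ph f(1)] by simp
    also have "Comp E f (Comp E p h) = Comp E f' (Comp E q h)"
      using E.assoc[OF v(2) r(1) f(1)] E.assoc[OF v(2) r(2) f(2)] r(3) by simp
    also have "Comp E (Comp E f' (Comp E q h)) (\<pi> v) = Comp E f' (\<pi> w')"
      using nat[OF vc w(2) qh] E.assoc[OF \<pi>[OF vc] qh f(2)] by simp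
    finally show ?thesis .
  qed
  obtain w f where w: "w \<in> component c" "f \<in> Hom E w c" using component_witness[OF c] .
  have ex: "Comp E f (\<pi> w) \<in> Hom E L c" by (rule E.Comp_in_Hom[OF \<pi>[OF w(1)] w(2)])
  have "component L = component c" using component_eq[OF has_span_of_Hom(1)[OF ex]] .
  obtain w0 e where w0: "w0 \<in> component L" "e \<in> Hom E w0 L" using component_witness[OF LO] .
  have w0c: "w0 \<in> component c" using w0(1) \<open>component L = component c\<close> by simp
  \<comment> \<open>Each leg \<open>\<pi> k\<close> followed after \<open>e\<close> is an arrow
    between members of the trace. The cone is compatible with it, so the loop fixes all
    legs.\<close>
  have id: "Comp E e (\<pi> w0) = Ident E L"
  proof (rule mono[OF E.Comp_in_Hom[OF \<pi>[OF w0c] w0(2)]])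
    fix k assume k: "k \<in> component c"
    show "Comp E (\<pi> k) (Comp E e (\<pi> w0)) = \<pi> k"
      using nat[OF w0c k E.Comp_in_Hom[OF w0(2) \<pi>[OF k]]] E.assoc[OF \<pi>[OF w0c] w0(2) \<pi>[OF k]]
        by simp
  qed
  show ?thesis
  proof (rule ex1I)
    show "Comp E f (\<pi> w) \<in> Hom E L c" by (rule ex)
    fix h assume h: "h \<in> Hom E L c"
    have "h = Comp E (Comp E h e) (\<pi> w0)"
      using E.assoc[OF \<pi>[OF w0c] w0(2) h] id E.Comp_Ident[OF h] by simp
    also have "\<dots> = Comp E f (\<pi> w)" by (rule indep[OF w0c w(1) E.Comp_in_Hom[OF w0(2) h] w(2)])
    finally show "h = Comp E f (\<pi> w)" .
  qed
qed

lemma has_small_multi_initial_family_of_cones: "has_small_multi_initial_family T E"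
proof -
  \<comment> \<open>The index set of the family consists of the traces; \<open>\<iota>\<close>
    renames them by elements of \<open>'u\<close>, as the definition demands.\<close>
  define V where "V = component ` W"
  have smV: "small T V" unfolding V_def by (rule small_image[OF W(2)])
  then obtain \<iota> :: "'o set \<Rightarrow> 'u" where \<iota>: "inj_on \<iota> V" using small_embedding by blast
  have "\<exists>L \<pi>. monic_cone E v L \<pi>" if "v \<in> V" for v
    using that component_cone W(1) unfolding V_def by blast
  then obtain L \<pi> where L: "\<And>v. v \<in> V \<Longrightarrow> monic_cone E v (L v) (\<pi> v)" by metis
  have LO: "L v \<in> Obj E" if "v \<in> V" for v using L[OF that] unfolding monic_cone_def by simp
  have compV: "component c \<in> V" if c: "c \<in> Obj E" for c
  proof -
    obtain w f where w: "w \<in> component c" using component_witness[OF c] .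
    hence "component w = component c" "w \<in> W" using component_eq unfolding component_def by auto
    thus ?thesis unfolding V_def by blast
  qed
  have compL: "component c = v" if v: "v \<in> V" and f: "f \<in> Hom E (L v) c" for v f c
  proof -
    obtain w where w: "w \<in> W" "v = component w" using v unfolding V_def by blast
    have "w \<in> Obj E" using w(1) W(1) by blast
    from component_cone_initial[OF this] L[OF v] w(2) obtain g where "g \<in> Hom E (L v) w" by blast
    from component_eq[OF has_span_trans[OF has_span_of_Hom(2)[OF f] has_span_of_Hom(1)[OF this]]]
      show ?thesis using w(2) by simp
  qed
  have "multi_initial E (\<iota> ` V) (\<lambda>i. L (inv_into V \<iota> i))"
    unfolding multi_initial_def
  proof (intro conjI ballI)
    show "L (inv_into V \<iota> i) \<in> Obj E" if "i \<in> \<iota> ` V" for i by (rule LO[OF inv_into_into[OF that]])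
    fix c assume c: "c \<in> Obj E"
    have ex1: "\<exists>!f. f \<in> Hom E (L (component c)) c"
      by (rule component_cone_initial[OF c L[OF compV[OF c]]])
    then obtain f where f: "f \<in> Hom E (L (component c)) c" by blast
    show "\<exists>!(i, f). i \<in> \<iota> ` V \<and> f \<in> Hom E (L (inv_into V \<iota> i)) c"
      unfolding ex1_pair_iff
    proof (intro exI conjI allI impI)
      show "\<iota> (component c) \<in> \<iota> ` V" using compV[OF c] by simp
      show "f \<in> Hom E (L (inv_into V \<iota> (\<iota> (component c)))) c" using f \<iota> compV[OF c] by simp
      fix i' f' assume i': "i' \<in> \<iota> ` V \<and> f' \<in> Hom E (L (inv_into V \<iota> i')) c"
      then obtain v where v: "v \<in> V" "i' = \<iota> v" by blast
      have f': "f' \<in> Hom E (L v) c" using i' v \<iota> by simp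
      have "component c = v" by (rule compL[OF v(1) f'])
      thus "i' = \<iota> (component c)" "f' = f" using v(2) ex1_unique[OF ex1 _ f] f' by simp_all
    qed
  qed
  moreover have "small T (\<iota> ` V)" by (rule small_image[OF smV])
  ultimately show ?thesis unfolding has_small_multi_initial_family_def by blast
qed

end

section \<open>Objects as filtered colimits of objects from a small set\<close>

definition el_hom :: "('o, 'm) cat \<Rightarrow> 'm \<Rightarrow> 'm \<Rightarrow> 'm set" where
  "el_hom C a a' = {k \<in> Hom C (Dom C a) (Dom C a'). Comp C a' k = a}"

abbreviation "el_cat C S \<equiv> over_cat C (Dom C) S (el_hom C)"
abbreviation "el_cocone C S \<equiv> cocone (el_cat C S) C (over_ftor (Dom C))"

text \<open>\<open>w\<close> is the component over \<open>x\<close> of the multicolimit of the diagram spanned by \<open>S\<close>, that is,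
  the colimit of this diagram in the slice category over \<open>x\<close>.\<close>

definition local_colimit ::
  "('o, 'm) cat \<Rightarrow> 'm set \<Rightarrow> 'o \<Rightarrow> 'o \<Rightarrow> ('m \<Rightarrow> 'm) \<Rightarrow> 'm \<Rightarrow> bool" where
  "local_colimit C S x w l h \<longleftrightarrow>
     h \<in> Hom C w x \<and> el_cocone C S w l \<and> (\<forall>a\<in>S. Comp C h (l a) = a) \<and>
     (\<forall>y m t. el_cocone C S y m \<and> t \<in> Hom C y x \<and> (\<forall>a\<in>S. Comp C t (m a) = a) \<longrightarrow>
        (\<exists>g\<in>Hom C w y. \<forall>a\<in>S. Comp C g (l a) = m a)) \<and>
     (\<forall>y g g'. g \<in> Hom C w y \<and> g' \<in> Hom C w y \<and> (\<forall>a\<in>S. Comp C g (l a) = Comp C g' (l a)) \<longrightarrow> g = g')"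

text \<open>Diagrams on \<open>G\<close> with at most \<open>|K|\<close> objects are encoded up to isomorphism as sets of triples
  \<open>(source, arrow, target)\<close>, with the objects relabelled by elements of \<open>K\<close>; these form a small
  set.\<close>

definition code_cocone :: "('o, 'm) cat \<Rightarrow> ('u \<times> 'm \<times> 'u) set \<Rightarrow> 'o \<Rightarrow> ('u \<Rightarrow> 'm) \<Rightarrow> bool" where
  "code_cocone C R y m \<longleftrightarrow> y \<in> Obj C \<and>
     (\<forall>(k, h, k')\<in>R. m k \<in> Hom C (Dom C h) y \<and> m k' \<in> Hom C (Cod C h) y \<and> Comp C (m k') h = m k)"

definition code_multicolimit ::
  "('o, 'm) cat \<Rightarrow> ('u \<times> 'm \<times> 'u) set \<Rightarrow> 'i set \<Rightarrow> ('i \<Rightarrow> 'o) \<Rightarrow> ('i \<Rightarrow> 'u \<Rightarrow> 'm) \<Rightarrow> bool" where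
  "code_multicolimit C R I X L \<longleftrightarrow>
     (\<forall>i\<in>I. code_cocone C R (X i) (L i)) \<and>
     (\<forall>y m. code_cocone C R y m \<longrightarrow>
        (\<exists>i\<in>I. \<exists>h\<in>Hom C (X i) y. \<forall>k\<in>fst ` R. Comp C h (L i k) = m k)) \<and>
     (\<forall>y m i i' h h'. code_cocone C R y m \<and> i \<in> I \<and> i' \<in> I \<and> h \<in> Hom C (X i) y \<and>
       h' \<in> Hom C (X i') y \<and>
        (\<forall>k\<in>fst ` R. Comp C h (L i k) = m k) \<and> (\<forall>k\<in>fst ` R. Comp C h' (L i' k) = m k) \<longrightarrow> i = i' \<and>
          h = h')"

definition code :: "('o, 'm) cat \<Rightarrow> 'm set \<Rightarrow> ('m \<Rightarrow> 'u) \<Rightarrow> ('u \<times> 'm \<times> 'u) set" where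
  "code C S e = (\<Union>a\<in>S. \<Union>a'\<in>S. (\<lambda>k. (e a, k, e a')) ` el_hom C a a')"

context lfmp
begin

section \<open>Diagrams of elements, their codes and their local colimits\<close>

lemma el_cat_functor:
  assumes "S \<subseteq> el C G x"
  shows "cat_functor (el_cat C S) C (over_ftor (Dom C))"
proof (rule over_cat_functor[OF category_axioms])
  have Arr: "a \<in> Arr C" if "a \<in> S" for a using assms that unfolding el_def by blast
  show "Dom C a \<in> Obj C" if "a \<in> S" for a using Dom_in_Obj[OF Arr[OF that]] .
  show "k \<in> Hom C (Dom C a) (Dom C b)" if "k \<in> el_hom C a b" for a b k
    using that unfolding el_hom_def by simp
  show "Ident C (Dom C a) \<in> el_hom C a a" if "a \<in> S" for a
    unfolding el_hom_def Hom_iff using Arr[OF that] by (simp add: cat_simps)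
  show "Comp C g f \<in> el_hom C a c" if "c \<in> S" "f \<in> el_hom C a b" "g \<in> el_hom C b c" for a b c f g
  proof -
    have f: "f \<in> Hom C (Dom C a) (Dom C b)" "Comp C b f = a"
      using that(2) unfolding el_hom_def by simp_all
    have g: "g \<in> Hom C (Dom C b) (Dom C c)" "Comp C c g = b"
      using that(3) unfolding el_hom_def by simp_all
    show ?thesis
      unfolding el_hom_def using Comp_in_Hom[OF f(1) g(1)]
        f(2) g(2) assoc[OF f(1) g(1) Hom_Dom_Cod[OF Arr[OF that(1)]]]
      by simp
  qed
qed

lemma el_cocone_id:
  assumes "x \<in> Obj C" "S \<subseteq> el C G x"
  shows "el_cocone C S x (\<lambda>a. a)"
  unfolding cocone_over_cat
proof (intro conjI ballI)
  show "a \<in> Hom C (Dom C a) x" if "a \<in> S" for a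
    using subsetD[OF assms(2) that] unfolding el_iff by simp
qed (use assms(1) in \<open>auto simp: el_hom_def\<close>)

context
  fixes S x and e :: "'m \<Rightarrow> 'u"
  assumes S: "S \<subseteq> el C G x" and e: "inj_on e S"
begin

lemma Ident_el_hom:
  assumes "a \<in> S"
  shows "Ident C (Dom C a) \<in> el_hom C a a"
proof -
  have "a \<in> Arr C" using S assms unfolding el_def by blast
  thus ?thesis unfolding el_hom_def Hom_iff by (simp add: cat_simps)
qed

text \<open>The identity at each element puts its label into the code as a source, so that isolated
  vertices are not lost.\<close>

lemma fst_code: "fst ` code C S e = e ` S"
proof (intro equalityI subsetI)
  fix k assume "k \<in> e ` S"
  then obtain a where a: "a \<in> S" "k = e a" by blast
  have "(e a, Ident C (Dom C a), e a) \<in> code C S e" unfolding code_def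
    using a(1) Ident_el_hom[OF a(1)] by blast
  from imageI[OF this, of fst] show "k \<in> fst ` code C S e" using a(2) by simp
qed (auto simp: code_def)

lemma code_cocone_iff: "code_cocone C (code C S e) y m \<longleftrightarrow> el_cocone C S y (\<lambda>a. m (e a))"
proof -
  have "(\<forall>(k, h, k')\<in>code C S e. P k h k') \<longleftrightarrow>
    (\<forall>a\<in>S. \<forall>a'\<in>S. \<forall>h\<in>el_hom C a a'. P (e a) h (e a'))" for P
    unfolding code_def by auto
  hence "code_cocone C (code C S e) y m \<longleftrightarrow> y \<in> Obj C \<and> (\<forall>a\<in>S. \<forall>a'\<in>S. \<forall>h\<in>el_hom C a a'.
      m (e a) \<in> Hom C (Dom C h) y \<and> m (e a') \<in> Hom C (Cod C h) y \<and> Comp C (m (e a')) h = m (e a))"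
    unfolding code_cocone_def by simp
  also have "\<dots> \<longleftrightarrow> y \<in> Obj C \<and> (\<forall>a\<in>S. \<forall>a'\<in>S. \<forall>h\<in>el_hom C a a'.
      m (e a) \<in> Hom C (Dom C a) y \<and> m (e a') \<in> Hom C (Dom C a') y \<and> Comp C (m (e a')) h = m (e a))"
    by (simp add: el_hom_def Hom_iff)
  also have "\<dots> \<longleftrightarrow> el_cocone C S y (\<lambda>a. m (e a))"
    unfolding cocone_over_cat using Ident_el_hom by blast
  finally show ?thesis .
qed

lemma code_cocone_inv: "el_cocone C S y m \<Longrightarrow> code_cocone C (code C S e) y (\<lambda>k. m (inv_into S e k))"
  unfolding code_cocone_iff using e by (simp add: cocone_over_cat)

lemma code_multicolimit_of_multicolimit:
  assumes M: "multicolimit (el_cat C S) C (over_ftor (Dom C)) I X L"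
  shows "code_multicolimit C (code C S e) I X (\<lambda>i k. L i (inv_into S e k))"
  unfolding code_multicolimit_def
proof (intro conjI ballI allI impI)
  show "code_cocone C (code C S e) (X i) (\<lambda>k. L i (inv_into S e k))" if "i \<in> I" for i
    by (rule code_cocone_inv[OF multicolimit_cocone[OF M that]])
  have key: "(\<forall>k\<in>fst ` code C S e. Comp C h (L i (inv_into S e k)) = m k) \<longleftrightarrow>
      (\<forall>a\<in>S. Comp C h (L i a) = m (e a))" for h i m
    unfolding fst_code using e by simp
  show "\<exists>i\<in>I. \<exists>h\<in>Hom C (X i) y. \<forall>k\<in>fst ` code C S e. Comp C h (L i (inv_into S e k)) = m k"
    if cc: "code_cocone C (code C S e) y m" for y m
  proof -
    obtain i h where ih: "i \<in> I" "h \<in> Hom C (X i) y"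
      "\<And>a. a \<in> Obj (el_cat C S) \<Longrightarrow> Comp C h (L i a) = m (e a)"
      using multicolimit_factor[OF M cc[unfolded code_cocone_iff]] by blast
    have "\<forall>a\<in>S. Comp C h (L i a) = m (e a)" using ih(3) by simp
    thus ?thesis unfolding key using ih(1,2) by blast
  qed
  fix y m i i' h h'
  assume "code_cocone C (code C S e) y m \<and> i \<in> I \<and> i' \<in> I \<and> h \<in> Hom C (X i) y \<and>
    h' \<in> Hom C (X i') y \<and>
    (\<forall>k\<in>fst ` code C S e. Comp C h (L i (inv_into S e k)) = m k) \<and>
    (\<forall>k\<in>fst ` code C S e. Comp C h' (L i' (inv_into S e k)) = m k)"
  hence *: "el_cocone C S y (\<lambda>a. m (e a))" "i \<in> I" "i' \<in> I" "h \<in> Hom C (X i) y"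
    "h' \<in> Hom C (X i') y"
    "\<And>a. a \<in> Obj (el_cat C S) \<Longrightarrow> Comp C h (L i a) = m (e a)"
    "\<And>a. a \<in> Obj (el_cat C S) \<Longrightarrow> Comp C h' (L i' a) = m (e a)"
    unfolding key code_cocone_iff by simp_all
  show "i = i'" "h = h'"
    by (rule multicolimit_unique[OF M *(1) *(3,5,7) *(2,4,6)], simp_all)+
qed

text \<open>The elements in \<open>S\<close> form a cocone with apex \<open>x\<close>, and this
  cocone selects the component. Any cocone that maps to it over \<open>x\<close> selects the same
  component, which makes the component a colimit over \<open>x\<close>.\<close>

lemma local_colimit_of_code:
  assumes x: "x \<in> Obj C" and M: "code_multicolimit C (code C S e) I X L"
  shows "\<exists>i\<in>I. \<exists>l h. local_colimit C S x (X i) l h"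
proof -
  have inv: "inv_into S e (e a) = a" if "a \<in> S" for a using e that by simp
  have fac: "\<exists>i\<in>I. \<exists>h\<in>Hom C (X i) y. \<forall>a\<in>S. Comp C h (L i (e a)) = m a"
    if "el_cocone C S y m" for y m
  proof -
    have "\<exists>i\<in>I. \<exists>h\<in>Hom C (X i) y. \<forall>k\<in>fst ` code C S e. Comp C h (L i k) = m (inv_into S e k)"
      by (rule M[unfolded code_multicolimit_def, THEN conjunct2, THEN conjunct1, rule_format,
            OF code_cocone_inv[OF that]])
    thus ?thesis unfolding fst_code using inv by simp
  qed
  have unq: "i = i' \<and> h = h'"
    if "el_cocone C S y m" "i \<in> I" "i' \<in> I" "h \<in> Hom C (X i) y" "h' \<in> Hom C (X i') y"
      "\<And>a. a \<in> S \<Longrightarrow> Comp C h (L i (e a)) = m a"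
        "\<And>a. a \<in> S \<Longrightarrow> Comp C h' (L i' (e a)) = m a" for y m i i' h h'
  proof -
    have "\<forall>k\<in>fst ` code C S e. Comp C h (L i k) = m (inv_into S e k)"
      "\<forall>k\<in>fst ` code C S e. Comp C h' (L i' k) = m (inv_into S e k)"
      unfolding fst_code using that(6,7) inv by simp_all
    with M[unfolded code_multicolimit_def, THEN conjunct2, THEN conjunct2, rule_format,
        of y "\<lambda>k. m (inv_into S e k)" i i' h h'] code_cocone_inv[OF that(1)] that(2-5)
    show ?thesis by simp
  qed
  obtain i h where i: "i \<in> I" and h: "h \<in> Hom C (X i) x" "\<And>a. a \<in> S \<Longrightarrow> Comp C h (L i (e a)) = a"
    using fac[OF el_cocone_id[OF x S]] by blast
  have l: "el_cocone C S (X i) (\<lambda>a. L i (e a))"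
    using M i unfolding code_multicolimit_def code_cocone_iff by simp
  have lH: "L i (e a) \<in> Hom C (Dom C a) (X i)" if "a \<in> S" for a
    using l that unfolding cocone_over_cat by simp
  have "local_colimit C S x (X i) (\<lambda>a. L i (e a)) h"
    unfolding local_colimit_def
  proof (intro conjI allI impI ballI h l)
    fix y m t
    assume *: "el_cocone C S y m \<and> t \<in> Hom C y x \<and> (\<forall>a\<in>S. Comp C t (m a) = a)"
    then obtain i' g where g: "i' \<in> I" "g \<in> Hom C (X i') y"
      "\<And>a. a \<in> S \<Longrightarrow> Comp C g (L i' (e a)) = m a"
      using fac[of y m] by blast
    have t: "t \<in> Hom C y x" using * by simp
    \<comment> \<open>The cocone \<open>m\<close> could belong to another component
      \<open>i'\<close>; composing with \<open>t\<close> exhibits \<open>i'\<close> as a component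
      over \<open>x\<close>, where uniqueness applies.\<close>
    have "i' = i \<and> Comp C t g = h"
    proof (rule unq[OF el_cocone_id[OF x S] g(1) i Comp_in_Hom[OF g(2) t] h(1) _ h(2)])
      fix a assume a: "a \<in> S"
      have "el_cocone C S (X i') (\<lambda>a. L i' (e a))"
        using M g(1) unfolding code_multicolimit_def code_cocone_iff by simp
      hence "L i' (e a) \<in> Hom C (Dom C a) (X i')" using a unfolding cocone_over_cat by simp
      thus "Comp C (Comp C t g) (L i' (e a)) = a" using assoc[OF _ g(2) t] g(3)[OF a] * a by simp
    qed
    thus "\<exists>g\<in>Hom C (X i) y. \<forall>a\<in>S. Comp C g (L i (e a)) = m a" using g(2,3) by blast
  next
    fix y g g'
    assume *: "g \<in> Hom C (X i) y \<and> g' \<in> Hom C (X i) y \<and>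
      (\<forall>a\<in>S. Comp C g (L i (e a)) = Comp C g' (L i (e a)))"
    hence g: "g \<in> Hom C (X i) y" "g' \<in> Hom C (X i) y" by simp_all
    \<comment> \<open>The common composites with the legs form a cocone of their own;
      \<open>g\<close> and \<open>g'\<close> are two factorizations of it through the same
      component.\<close>
    have cc: "el_cocone C S y (\<lambda>a. Comp C g (L i (e a)))"
      unfolding cocone_over_cat
    proof (intro conjI ballI)
      show "y \<in> Obj C" by (rule Hom_Obj(2)[OF g(1)])
      show "Comp C g (L i (e a)) \<in> Hom C (Dom C a) y" if "a \<in> S" for a
        by (rule Comp_in_Hom[OF lH[OF that] g(1)])
      fix a a' k assume a: "a \<in> S" "a' \<in> S" "k \<in> el_hom C a a'"
      have "Comp C (L i (e a')) k = L i (e a)" using l a unfolding cocone_over_cat by simp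
      moreover have "k \<in> Hom C (Dom C a) (Dom C a')" using a(3) unfolding el_hom_def by simp
      ultimately show "Comp C (Comp C g (L i (e a'))) k = Comp C g (L i (e a))"
        using assoc[OF _ lH[OF a(2)] g(1)] by simp
    qed
    have eq: "Comp C g' (L i (e a)) = Comp C g (L i (e a))" if "a \<in> S" for a using * that by simp
    have "i = i \<and> g = g'" by (rule unq[OF cc i i g refl eq])
    thus "g = g'" by simp
  qed
  thus ?thesis using i by blast
qed

end

section \<open>A small set containing all local colimits of bounded size\<close>

lemma small_el_cat:
  assumes "x \<in> Obj C" "S \<subseteq> el C G x"
  shows "small_category T (el_cat C S)"
proof (rule small_over_cat[OF univ locally_small el_cat_functor[OF assms(2)]])
  show "small T S" by (rule small_subset[OF assms(2) small_el[OF assms(1)]])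
  show "Dom C a \<in> Obj C" if "a \<in> S" for a using assms(2) that G_Obj unfolding el_def by auto
qed (simp add: el_hom_def)

text \<open>A diagram with at most \<open>|K|\<close> elements has a code among the subsets of
  \<open>K \<times> A \<times> K\<close>, with \<open>A\<close> the arrows within the generator.
  There is a small set of codes, and each contributes a small set of components, so \<open>W\<close>
  depends on neither \<open>x\<close> nor \<open>S\<close>.\<close>

lemma small_local_colimits:
  fixes K :: "'u set"
  assumes K: "small T K"
  obtains W where "small T W" "\<And>x S. x \<in> Obj C \<Longrightarrow> S \<subseteq> el C G x \<Longrightarrow> |S| \<le>o |K| \<Longrightarrow>
    \<exists>w\<in>W. \<exists>l h. local_colimit C S x w l h"
proof -
  define A where "A = {k \<in> Arr C. Dom C k \<in> G \<and> Cod C k \<in> G}"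
  define Q where "Q R I X L \<longleftrightarrow> small T I \<and> code_multicolimit C R I X L"
    for R :: "('u \<times> 'm \<times> 'u) set" and I :: "'u set" and X L
  \<comment> \<open>The choice is made for every subset \<open>R\<close>, also for those that admit
    no small multicolimit; these receive an empty index set, which keeps the union \<open>W\<close>
    small.\<close>
  have "\<exists>I X L. small T I \<and> ((\<exists>I X L. Q R I X L) \<longrightarrow> Q R I X L)" for R
  proof (cases "\<exists>I X L. Q R I X L")
    case True
    then obtain I X L where "Q R I X L" by blast
    moreover from this have "small T I" unfolding Q_def by simp
    ultimately show ?thesis by blast
  next
    case False
    thus ?thesis using small_finite[OF univ finite.emptyI] by blast
  qed
  then obtain I X L where smI: "\<And>R. small T (I R)"
    and Q: "\<And>R. \<exists>I X L. Q R I X L \<Longrightarrow> Q R (I R) (X R) (L R)"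
    by metis
  define W where "W = (\<Union>R\<in>Pow (K \<times> A \<times> K). X R ` I R)"
  have smA: "small T A" unfolding A_def by (rule small_G_Arr)
  have "small T (K \<times> A \<times> K)" using small_Sigma[OF univ K small_Sigma[OF univ smA K]] .
  hence "small T W"
    unfolding W_def by (intro small_UNION[OF univ] small_Pow[OF univ] small_image smI)
  moreover have "\<exists>w\<in>W. \<exists>l h. local_colimit C S x w l h"
    if x: "x \<in> Obj C" and S: "S \<subseteq> el C G x" and card: "|S| \<le>o |K|" for x S
  proof -
    obtain e where e: "inj_on e S" "e ` S \<subseteq> K" using card card_of_ordLeq[of S K] by blast
    let ?R = "code C S e"
    have R: "?R \<in> Pow (K \<times> A \<times> K)"
    proof -
      have "el_hom C a a' \<subseteq> A" if "a \<in> S" "a' \<in> S" for a a'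
        using that S unfolding A_def el_hom_def el_def Hom_iff by auto
      thus ?thesis unfolding code_def using e(2) by auto
    qed
    obtain I0 :: "'u set" and X0 L0
      where "small T I0" "multicolimit (el_cat C S) C (over_ftor (Dom C)) I0 X0 L0"
      using multicocomplete_small[OF multicocomplete small_el_cat[OF x S] el_cat_functor[OF S]] .
    hence "Q ?R I0 X0 (\<lambda>i k. L0 i (inv_into S e k))"
      unfolding Q_def using code_multicolimit_of_multicolimit[OF S e(1)] by simp
    with Q[of ?R] have "code_multicolimit C ?R (I ?R) (X ?R) (L ?R)" unfolding Q_def by blast
    from local_colimit_of_code[OF S e(1) x this] show ?thesis unfolding W_def using R by blast
  qed
  ultimately show thesis by (rule that)
qed

text \<open>The index is the poset of sets of at most \<open>|K|\<close> elements of
  \<open>x\<close>. Unions over fewer than \<open>lam\<close> indices stay in it because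
  \<open>lam\<close> is at most \<open>|K|\<close>. Singletons contain all elements and two-element
  sets all compatibility conditions, so density turns a cocone into an arrow out of
  \<open>x\<close>.\<close>

lemma small_colimit_decomposition:
  fixes K :: "'u set" and lam :: "'l rel"
  assumes x: "x \<in> Obj C" and K: "infinite K" and lam: "lam \<le>o |K|"
    and loc: "\<And>S. S \<subseteq> el C G x \<Longrightarrow> |S| \<le>o |K| \<Longrightarrow> \<exists>w\<in>W. \<exists>l h. local_colimit C S x w l h"
  obtains J :: "('m set, 'm set \<times> unit \<times> 'm set) cat" and D l
  where "small_category T J" "lam_filtered T lam J" "cat_functor J C D" "colimit J C D x l"
    "\<And>j. j \<in> Obj J \<Longrightarrow> FObj D j \<in> W"
proof -
  define P where "P = {S. S \<subseteq> el C G x \<and> |S| \<le>o |K|}"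
  have PE: "S \<subseteq> el C G x" if "S \<in> P" for S using that unfolding P_def by simp
  have finP: "S \<in> P" if "S \<subseteq> el C G x" "finite S" for S
  proof -
    have "|S| <o natLeq" using that(2) finite_iff_ordLess_natLeq by blast
    moreover have "natLeq \<le>o |K|" using K infinite_iff_natLeq_ordLeq by blast
    ultimately have "|S| \<le>o |K|" by (rule ordLess_imp_ordLeq[OF ordLess_ordLeq_trans])
    thus ?thesis unfolding P_def using that(1) by simp
  qed
  define J where "J = cat_of_homs P (\<lambda>S S'. if S \<subseteq> S' then {()} else {}) (\<lambda>_. ()) (\<lambda>_ _ _. ())"
  have HJ: "F \<in> Hom J S S' \<longleftrightarrow> S \<in> P \<and> S' \<in> P \<and> S \<subseteq> S' \<and> F = (S, (), S')" for F S S'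
    unfolding J_def Hom_cat_of_homs by auto
  have catJ: "category J"
    unfolding J_def by (rule category_cat_of_homs) (auto split: if_splits)
  have OJ: "Obj J = P" by (simp add: J_def)
  have "\<exists>w l h. w \<in> W \<and> local_colimit C S x w l h" if "S \<in> P" for S
    using loc[of S] that unfolding P_def by blast
  then obtain w l h where w: "\<And>S. S \<in> P \<Longrightarrow> w S \<in> W"
    and lc: "\<And>S. S \<in> P \<Longrightarrow> local_colimit C S x (w S) (l S) (h S)" by metis
  have h: "h S \<in> Hom C (w S) x" "\<And>a. a \<in> S \<Longrightarrow> Comp C (h S) (l S a) = a" if "S \<in> P" for S
    using lc[OF that] unfolding local_colimit_def by simp_all
  have lS: "\<And>a. a \<in> S \<Longrightarrow> l S a \<in> Hom C (Dom C a) (w S)"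
    "\<And>a a' k. a \<in> S \<Longrightarrow> a' \<in> S \<Longrightarrow> k \<in> el_hom C a a' \<Longrightarrow> Comp C (l S a') k = l S a" if "S \<in> P" for S
    using lc[OF that] unfolding local_colimit_def cocone_over_cat by simp_all
  have fac: "\<exists>g\<in>Hom C (w S) y. \<forall>a\<in>S. Comp C g (l S a) = m a"
    if "S \<in> P" "el_cocone C S y m" "t \<in> Hom C y x" "\<And>a. a \<in> S \<Longrightarrow> Comp C t (m a) = a" for S y m t
    using lc[OF that(1)] that(2-4) unfolding local_colimit_def by blast
  have epi: "g = g'" if "S \<in> P" "g \<in> Hom C (w S) y" "g' \<in> Hom C (w S) y"
      "\<And>a. a \<in> S \<Longrightarrow> Comp C g (l S a) = Comp C g' (l S a)" for S y g g'
    using lc[OF that(1)] that(2-4) unfolding local_colimit_def by simp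
  \<comment> \<open>For \<open>S \<subseteq> S'\<close>, the legs of \<open>S'\<close> restrict to a
    cocone on \<open>S\<close> that lies over \<open>x\<close> via \<open>h S'\<close>; the colimit
    property over \<open>x\<close> provides the transition arrow.\<close>
  have "\<exists>g. g \<in> Hom C (w S) (w S') \<and> (\<forall>a\<in>S. Comp C g (l S a) = l S' a)"
    if S: "S \<in> P" "S' \<in> P" "S \<subseteq> S'" for S S'
  proof -
    have wO: "w S' \<in> Obj C" by (rule Hom_Obj(1)[OF h(1)[OF S(2)]])
    have "el_cocone C S (w S') (l S')"
      unfolding cocone_over_cat using lS[OF S(2)] S(3) wO by blast
    moreover have "Comp C (h S') (l S' a) = a" if "a \<in> S" for a
      using h(2)[OF S(2)] S(3) that by blast
    ultimately have "\<exists>g\<in>Hom C (w S) (w S'). \<forall>a\<in>S. Comp C g (l S a) = l S' a"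
      using fac[OF S(1) _ h(1)[OF S(2)]] by simp
    thus ?thesis by blast
  qed
  then obtain tr where tr: "\<And>S S'. S \<in> P \<Longrightarrow> S' \<in> P \<Longrightarrow> S \<subseteq> S' \<Longrightarrow> tr S S' \<in> Hom C (w S) (w S')"
    and trl: "\<And>S S' a. S \<in> P \<Longrightarrow> S' \<in> P \<Longrightarrow> S \<subseteq> S' \<Longrightarrow> a \<in> S \<Longrightarrow> Comp C (tr S S') (l S a) = l S' a"
    by metis
  define D where "D = \<lparr>FObj = w, FArr = (\<lambda>(S, u :: unit, S'). tr S S')\<rparr>"
  have DS: "FObj D S = w S" "FArr D (S, u, S') = tr S S'" for S u S' by (simp_all add: D_def)
  have D: "cat_functor J C D"
  proof (intro cat_functor.intro catJ category_axioms cat_functor_axioms.intro)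
    fix S assume "S \<in> Obj J"
    hence S: "S \<in> P" by (simp add: OJ)
    show wO: "FObj D S \<in> Obj C" unfolding DS by (rule Hom_Obj(1)[OF h(1)[OF S]])
    have "tr S S = Ident C (w S)"
      by (rule epi[OF S tr[OF S S subset_refl] Ident_in_Hom[OF wO[unfolded DS]]])
        (simp add: trl[OF S S subset_refl] Ident_Comp[OF lS(1)[OF S]])
    thus "FArr D (Ident J S) = Ident C (FObj D S)" by (simp add: J_def DS)
  next
    fix F S S' assume "F \<in> Hom J S S'"
    thus "FArr D F \<in> Hom C (FObj D S) (FObj D S')" unfolding HJ using tr by (auto simp: DS)
  next
    fix F F' S S' S'' assume "F \<in> Hom J S S'" "F' \<in> Hom J S' S''"
    hence F: "F = (S, (), S')" "F' = (S', (), S'')" and S: "S \<in> P" "S' \<in> P" "S'' \<in> P"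
      and sub: "S \<subseteq> S'" "S' \<subseteq> S''" unfolding HJ by blast+
    have sub2: "S \<subseteq> S''" using sub by blast
    note t1 = tr[OF S(1,2) sub(1)] and t2 = tr[OF S(2,3) sub(2)]
    have "tr S S'' = Comp C (tr S' S'') (tr S S')"
    proof (rule epi[OF S(1) tr[OF S(1,3) sub2] Comp_in_Hom[OF t1 t2]])
      fix a assume a: "a \<in> S"
      hence a': "a \<in> S'" using sub by blast
      show "Comp C (tr S S'') (l S a) = Comp C (Comp C (tr S' S'') (tr S S')) (l S a)"
        using assoc[OF lS(1)[OF S(1) a] t1 t2] trl[OF S(1,3) sub2 a] trl[OF S(1,2) sub(1) a]
          trl[OF S(2,3) sub(2) a']
        by simp
    qed
    thus "FArr D (Comp J F' F) = Comp C (FArr D F') (FArr D F)" by (simp add: F DS J_def)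
  qed
  have hcone: "Comp C (h S') (tr S S') = h S" if S: "S \<in> P" "S' \<in> P" "S \<subseteq> S'" for S S'
  proof (rule epi[OF S(1) Comp_in_Hom[OF tr[OF S] h(1)[OF S(2)]] h(1)[OF S(1)]])
    fix a assume a: "a \<in> S"
    hence "a \<in> S'" using S(3) by blast
    thus "Comp C (Comp C (h S') (tr S S')) (l S a) = Comp C (h S) (l S a)"
      using assoc[OF lS(1)[OF S(1) a] tr[OF S] h(1)[OF S(2)]] trl[OF S a] h(2)[OF S(1) a]
        h(2)[OF S(2)] by simp
  qed
  have JArr: "(\<forall>F\<in>Arr J. Q F) \<longleftrightarrow> (\<forall>S\<in>P. \<forall>S'\<in>P. S \<subseteq> S' \<longrightarrow> Q (S, (), S'))" for Q
    unfolding J_def Arr_cat_of_homs by auto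
  have DC: "Dom J (S, u, S') = S" "Cod J (S, u, S') = S'" for S u S' by (simp_all add: J_def)
  have cocJ: "cocone J C D y m \<longleftrightarrow> y \<in> Obj C \<and> (\<forall>S\<in>P. m S \<in> Hom C (w S) y) \<and>
      (\<forall>S\<in>P. \<forall>S'\<in>P. S \<subseteq> S' \<longrightarrow> Comp C (m S') (tr S S') = m S)" for y m
    unfolding cocone_def JArr OJ DC DS ..
  have col: "colimit J C D x h"
    unfolding colimit_def
  proof (intro conjI allI impI)
    show "cocone J C D x h" unfolding cocJ using x h(1) hcone by blast
    fix y m assume "cocone J C D y m"
    hence y: "y \<in> Obj C" and m: "\<And>S. S \<in> P \<Longrightarrow> m S \<in> Hom C (w S) y"
      and mtr: "\<And>S S'. S \<in> P \<Longrightarrow> S' \<in> P \<Longrightarrow> S \<subseteq> S' \<Longrightarrow>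
        Comp C (m S') (tr S S') = m S" unfolding cocJ by blast+
    \<comment> \<open>The value on an element is read off at its singleton; \<open>Ml\<close> shows
      that every larger index gives the same value.\<close>
    define M where "M a = Comp C (m {a}) (l {a} a)" for a
    have sing: "{a} \<in> P" if "a \<in> el C G x" for a using finP[of "{a}"] that by simp
    have Ml: "Comp C (m S) (l S a) = M a" if S: "S \<in> P" and a: "a \<in> S" for S a
    proof -
      have aE: "a \<in> el C G x" using PE[OF S] a by blast
      note sg = sing[OF aE]
      have sub: "{a} \<subseteq> S" using a by simp
      show ?thesis
        unfolding M_def using assoc[OF lS(1)[OF sg] tr[OF sg S sub] m[OF S]] mtr[OF sg S sub]
          trl[OF sg S sub]
        by simp
    qed
    have MH: "M a \<in> Hom C (Dom C a) y" if "a \<in> el C G x" for a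
      unfolding M_def by (rule Comp_in_Hom[OF lS(1)[OF sing[OF that]] m[OF sing[OF that]]]) simp
    have "\<exists>k\<in>Hom C x y. \<forall>a\<in>el C G x. Comp C k a = M a"
    proof (rule dense_ex[OF x y MH])
      fix a k assume "(a, k) \<in> el_arr C G x"
      note ak = el_arrD[OF this]
      \<comment> \<open>The smallest index that contains both ends of the arrow \<open>k\<close> of
        elements, so that the legs there are already compatible with \<open>k\<close>.\<close>
      let ?S = "{a, Comp C a k}"
      have S: "?S \<in> P" by (rule finP) (use ak in auto)
      have k: "k \<in> el_hom C (Comp C a k) a" unfolding el_hom_def using ak(2,5) by simp
      have "Comp C (M a) k = Comp C (m ?S) (Comp C (l ?S a) k)"
        using Ml[OF S, of a] assoc[OF ak(2) lS(1)[OF S] m[OF S]] by simp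
      also have "Comp C (l ?S a) k = l ?S (Comp C a k)" by (rule lS(2)[OF S _ _ k]) simp_all
      also have "Comp C (m ?S) (l ?S (Comp C a k)) = M (Comp C a k)" by (rule Ml[OF S]) simp
      finally show "Comp C (M a) k = M (Comp C a k)" .
    qed
    then obtain k where k: "k \<in> Hom C x y" "\<And>a. a \<in> el C G x \<Longrightarrow> Comp C k a = M a" by blast
    show "\<exists>!k. k \<in> Hom C x y \<and> (\<forall>S\<in>Obj J. Comp C k (h S) = m S)"
    proof (rule ex1I)
      have "Comp C k (h S) = m S" if S: "S \<in> P" for S
      proof (rule epi[OF S Comp_in_Hom[OF h(1)[OF S] k(1)] m[OF S]])
        fix a assume a: "a \<in> S"
        hence "a \<in> el C G x" using PE[OF S] by blast
        thus "Comp C (Comp C k (h S)) (l S a) = Comp C (m S) (l S a)"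
          using assoc[OF lS(1)[OF S a] h(1)[OF S] k(1)] h(2)[OF S a] k(2) Ml[OF S a] by simp
      qed
      thus "k \<in> Hom C x y \<and> (\<forall>S\<in>Obj J. Comp C k (h S) = m S)" unfolding OJ using k(1) by simp
      fix k' assume k': "k' \<in> Hom C x y \<and> (\<forall>S\<in>Obj J. Comp C k' (h S) = m S)"
      show "k' = k"
      proof (rule dense_unique[OF _ k(1)])
        show k'1: "k' \<in> Hom C x y" using k' by simp
        fix a assume a: "a \<in> el C G x"
        note sg = sing[OF a]
        have "Comp C k' a = Comp C (Comp C k' (h {a})) (l {a} a)"
          using assoc[OF lS(1)[OF sg] h(1)[OF sg] k'1] h(2)[OF sg] by simp
        also have "\<dots> = M a" unfolding M_def using k' sg OJ by simp
        finally show "Comp C k' a = Comp C k a" using k(2)[OF a] by simp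
      qed
    qed
  qed
  have smP: "small T P"
    by (rule small_subset[OF _ small_Pow[OF univ small_el[OF x]]]) (auto simp: P_def)
  have small: "small_category T J"
    unfolding J_def
    by (rule small_category_cat_of_homs[OF univ catJ[unfolded J_def]
      smP]) (simp add: small_finite[OF univ])
  have fil: "lam_filtered T lam J"
    unfolding lam_filtered_def
  proof (intro conjI catJ allI impI)
    fix I :: "('u, 'u) cat" and F assume "cat_functor I J F \<and> |Arr I| <o lam"
    hence F: "cat_functor I J F" and card: "|Arr I| <o lam" by simp_all
    interpret F: cat_functor I J F by (rule F)
    have "inj_on (Ident I) (Obj I)"
      by (rule inj_onI) (metis F.source.Ident_Arr(2))
    moreover have "Ident I ` Obj I \<subseteq> Arr I" using F.source.Ident_Arr(1) by blast
    ultimately have "|Obj I| \<le>o |Arr I|" using card_of_ordLeq by blast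
    hence cI: "|Obj I| \<le>o |K|"
      by (rule ordLeq_transitive[OF _ ordLeq_transitive[OF ordLess_imp_ordLeq[OF card] lam]])
    have FP: "FObj F i \<in> P" if "i \<in> Obj I" for i using F.FObj_in_Obj[OF that] by (simp add: OJ)
    \<comment> \<open>The union is the apex: at most \<open>|K|\<close> many sets of size at most
      \<open>|K|\<close>, with \<open>K\<close> infinite.\<close>
    define Z where "Z = (\<Union>i\<in>Obj I. FObj F i)"
    have "|Z| \<le>o |K|"
      unfolding Z_def by (rule card_of_UNION_ordLeq_infinite[OF K cI]) (use FP in \<open>auto simp:
        P_def\<close>)
    moreover have "Z \<subseteq> el C G x" unfolding Z_def using FP PE by blast
    ultimately have Z: "Z \<in> P" unfolding P_def by simp
    have sub: "FObj F i \<subseteq> Z" if "i \<in> Obj I" for i unfolding Z_def using that by blast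
    have "cocone I J F Z (\<lambda>i. (FObj F i, (), Z))"
      unfolding cocone_def
    proof (intro conjI ballI)
      show "Z \<in> Obj J" using Z by (simp add: OJ)
      show "(FObj F i, (), Z) \<in> Hom J (FObj F i) Z" if "i \<in> Obj I" for i
        unfolding HJ using FP[OF that] Z sub[OF that] by simp
      fix u assume u: "u \<in> Arr I"
      have "FArr F u = (FObj F (Dom I u), (), FObj F (Cod I u))"
        using F.FArr_in_Hom[OF F.source.Hom_Dom_Cod[OF u]] unfolding HJ by simp
      thus "Comp J (FObj F (Cod I u), (), Z) (FArr F u) = (FObj F (Dom I u), (), Z)"
        by (simp add: J_def)
    qed
    hence "cocone I J F Z (\<lambda>i\<in>Obj I. (FObj F i, (), Z))"
      by (subst (asm) cocone_cong[OF F.source.category_axioms, of _ "\<lambda>i\<in>Obj I. (FObj F i, (),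
        Z)"]) simp_all
    thus "Obj (cocones I J F) \<noteq> {}" unfolding cocones_eq by auto
  qed
  show thesis
    by (rule that[OF small fil D col]) (use w in \<open>simp add: OJ DS\<close>)
qed

end

section \<open>Accessible functors preserving connected limits are right multi-adjoints\<close>

lemma cat_functor_full_subcat:
  assumes "cat_functor E A F" "S \<subseteq> Obj E"
  shows "cat_functor (full_subcat E S) A F"
proof -
  interpret F: cat_functor E A F by fact
  show ?thesis
    by (intro cat_functor.intro category_full_subcat[OF F.source.category_axioms assms(2)]
        F.target.category_axioms cat_functor_axioms.intro)
      (use assms(2) in \<open>auto simp: Hom_full_subcat F.FObj_in_Obj F.FArr_in_Hom F.FArr_Ident
        F.FArr_Comp\<close>)
qed

lemma small_full_subcat:
  assumes "universe T" "category E" "locally_small T E" "S \<subseteq> Obj E" "small T S"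
  shows "small_category T (full_subcat E S)"
proof -
  have "Arr (full_subcat E S) = (\<Union>x\<in>S. \<Union>y\<in>S. Hom E x y)" by (auto simp: Hom_def)
  moreover have "small T (Hom E x y)" if "x \<in> S" "y \<in> S" for x y
    using assms(3,4) that unfolding locally_small_def by blast
  ultimately show ?thesis
    unfolding small_category_def using category_full_subcat[OF assms(2,4)] assms(1,5)
    by (simp add: small_UNION del: full_subcat_simps(2))
qed

lemma comma_under_eq_over_cat:
  "comma_under A B U b = over_cat A fst {p. fst p \<in> Obj A \<and> snd p \<in> Hom B b (FObj U (fst p))}
     (\<lambda>p q. {h \<in> Hom A (fst p) (fst q). Comp B (FArr U h) (snd p) = snd q})"
  unfolding comma_under_def over_cat_def by (simp add: case_prod_beta')

text \<open>The limit is created by the projection to \<open>A\<close>: the underlying connected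
  diagram has a limit \<open>c\<close>, \<open>U\<close> preserves it, and the arrows from
  \<open>b\<close> induce the structure arrow from \<open>b\<close> to \<open>FObj U c\<close>.
  Uniqueness for endomorphisms is inherited from the limit in \<open>A\<close>.\<close>

lemma comma_under_cones:
  fixes T :: "'u itself"
  assumes A: "lfmp A T G" and U: "cat_functor A B U" and pres: "preserves_connected_limits T A B U"
    and b: "b \<in> Obj B"
  defines "E \<equiv> comma_under A B U b"
  shows "category E" "locally_small T E"
    and "S \<subseteq> Obj E \<Longrightarrow> small T S \<Longrightarrow> connected_category (full_subcat E S) \<Longrightarrow> \<exists>L \<pi>. monic_cone E S L \<pi>"
proof -
  interpret A: lfmp A T G by (rule A)
  interpret U: cat_functor A B U by (rule U)
  define X where "X = {p. fst p \<in> Obj A \<and> snd p \<in> Hom B b (FObj U (fst p))}"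
  define H where "H = (\<lambda>p q. {h \<in> Hom A (fst p) (fst q). Comp B (FArr U h) (snd p) = snd q})"
  have Eo: "E = over_cat A fst X H" unfolding E_def X_def H_def by (rule comma_under_eq_over_cat)
  have X: "fst p \<in> Obj A" "snd p \<in> Hom B b (FObj U (fst p))" if "p \<in> X" for p
    using that unfolding X_def by simp_all
  have HH: "h \<in> Hom A (fst p) (fst q)" "Comp B (FArr U h) (snd p) = snd q" if "h \<in> H p q" for h p q
    using that unfolding H_def by simp_all
  have F: "cat_functor E A (over_ftor fst)"
    unfolding Eo
  proof (rule over_cat_functor[OF A.category_axioms X(1) HH(1)])
    show "Ident A (fst p) \<in> H p p" if "p \<in> X" for p
      unfolding H_def using A.Ident_in_Hom[OF X(1)[OF that]] U.FArr_Ident[OF X(1)[OF that]]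
        U.target.Ident_Comp[OF X(2)[OF that]] by simp
    show "Comp A g f \<in> H p r" if "p \<in> X" "f \<in> H p q" "g \<in> H q r" for p q r f g
      unfolding H_def using A.Comp_in_Hom[OF HH(1)[OF that(2)] HH(1)[OF that(3)]]
        U.FArr_Comp_Comp[OF HH(1)[OF that(2)] HH(1)[OF that(3)] X(2)[OF that(1)]] HH(2)[OF that(2)]
          HH(2)[OF that(3)]
      by simp
  qed
  interpret F: cat_functor E A "over_ftor fst" by (rule F)
  show catE: "category E" by (rule F.source.category_axioms)
  have HomE: "u \<in> Hom E p q \<longleftrightarrow> p \<in> X \<and> q \<in> X \<and> (\<exists>h\<in>H p q. u = (p, h, q))" for u p q
    unfolding Eo by (rule Hom_over_cat)
  have ObjE: "Obj E = X" unfolding Eo by simp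
  show lsE: "locally_small T E"
    unfolding locally_small_def
  proof (intro ballI)
    fix p q assume "p \<in> Obj E" "q \<in> Obj E"
    hence "small T (Hom A (fst p) (fst q))"
      using A.locally_small X(1) unfolding locally_small_def ObjE by simp
    hence "small T ((\<lambda>h. (p, h, q)) ` Hom A (fst p) (fst q))" by (rule small_image)
    thus "small T (Hom E p q)" by (rule small_subset[rotated]) (auto simp: HomE H_def)
  qed
  assume S: "S \<subseteq> Obj E" "small T S" and con: "connected_category (full_subcat E S)"
  have SX: "p \<in> X" if "p \<in> S" for p using S(1) that ObjE by blast
  let ?J = "full_subcat E S"
  have J: "small_category T ?J" by (rule small_full_subcat[OF A.univ catE lsE S])
  have D: "cat_functor ?J A (over_ftor fst)" by (rule cat_functor_full_subcat[OF F S(1)])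
  have coneJ: "cone ?J Q D' y m \<longleftrightarrow> y \<in> Obj Q \<and> (\<forall>p\<in>S. m p \<in> Hom Q y (FObj D' p)) \<and>
      (\<forall>p\<in>S. \<forall>q\<in>S. \<forall>h\<in>H p q. Comp Q (FArr D' (p, h, q)) (m p) = m q)" for Q :: "('o2,
        'm2) cat" and D' y m
  proof -
    have "(\<forall>u\<in>Arr ?J. P u) \<longleftrightarrow> (\<forall>p\<in>S. \<forall>q\<in>S. \<forall>h\<in>H p q. P (p, h, q))" for P
      using SX by (auto simp: Eo)
    thus ?thesis unfolding cone_def by (simp add: Eo del: full_subcat_simps(2))
  qed
  obtain c l where lim: "limit ?J A (over_ftor fst) c l"
    using connected_limit_exists[OF A J con D] by blast
  hence lc: "cone ?J A (over_ftor fst) c l" unfolding limit_def by simp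
  have c: "c \<in> Obj A" and l: "\<And>p. p \<in> S \<Longrightarrow> l p \<in> Hom A c (fst p)"
    and lH: "\<And>p q h. p \<in> S \<Longrightarrow> q \<in> S \<Longrightarrow> h \<in> H p q \<Longrightarrow> Comp A h (l p) = l q"
    using lc unfolding coneJ by simp_all
  have limU: "limit ?J B (comp_ftor U (over_ftor fst)) (FObj U c) (\<lambda>p. FArr U (l p))"
    by (rule preserves_connected_limits_small[OF pres J con D lim])
  \<comment> \<open>The second components of the objects in \<open>S\<close> form a cone from
    \<open>b\<close> over the image of the diagram; compatibility is the definition of an arrow in
    the comma category.\<close>
  have "cone ?J B (comp_ftor U (over_ftor fst)) b snd"
    unfolding coneJ using b X(2)[OF SX] HH(2) by simp
  with limU have "\<exists>!m. m \<in> Hom B b (FObj U c) \<and> (\<forall>p\<in>Obj ?J. Comp B (FArr U (l p)) m = snd p)"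
    unfolding limit_def by simp
  from ex1_implies_ex[OF this] obtain m where m: "m \<in> Hom B b (FObj U c)"
    "\<And>p. p \<in> S \<Longrightarrow> Comp B (FArr U (l p)) m = snd p" by auto
  let ?L = "(c, m)"
  have LX: "?L \<in> X" unfolding X_def using c m(1) by simp
  have "monic_cone E S ?L (\<lambda>p. (?L, l p, p))"
    unfolding monic_cone_def
  proof (intro conjI ballI impI)
    show "?L \<in> Obj E" using LX ObjE by simp
    show "(?L, l p, p) \<in> Hom E ?L p" if "p \<in> S" for p
      unfolding HomE using LX SX[OF that] l[OF that] m(2)[OF that] by (simp add: H_def)
    show "Comp E u (?L, l p, p) = (?L, l q, q)" if "p \<in> S" "q \<in> S" "u \<in> Hom E p q" for p q u
      using that(3) lH[OF that(1,2)] unfolding HomE by (auto simp: Eo)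
    fix u assume u: "u \<in> Hom E ?L ?L" and eq: "\<forall>p\<in>S. Comp E (?L, l p, p) u = (?L, l p, p)"
    obtain k where k: "k \<in> Hom A c c" "u = (?L, k, ?L)" using u unfolding HomE H_def by auto
    have lk: "Comp A (l p) k = l p" if "p \<in> S" for p using eq that unfolding k(2) by (auto simp: Eo)
    have ex: "\<exists>!k. k \<in> Hom A c c \<and> (\<forall>p\<in>Obj ?J. Comp A (l p) k = l p)"
      using lim lc unfolding limit_def by simp
    have "k = Ident A c"
      by (rule ex1_unique[OF ex]) (use k(1) lk A.Ident_in_Hom[OF c] A.Comp_Ident[OF l] in simp_all)
    thus "u = Ident E ?L" using k(2) by (simp add: Eo)
  qed
  thus "\<exists>L \<pi>. monic_cone E S L \<pi>" by blast
qed

text \<open>An arrow from \<open>b\<close> to \<open>FObj U x\<close> factors through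
  \<open>FObj U w\<close> for some \<open>w\<close> from the fixed small set \<open>W0\<close>,
  because \<open>x\<close> is a \<open>lam\<close>-filtered colimit of such objects,
  \<open>U\<close> preserves it and \<open>b\<close> is \<open>lam\<close>-presentable.\<close>

lemma solution_set:
  fixes T :: "'u itself"
  assumes A: "lfmp A T GA" and B: "lfmp B T GB" and U: "cat_functor A B U"
    and acc: "accessible T A B U"
    and b: "b \<in> Obj B"
  obtains W where "W \<subseteq> Obj (comma_under A B U b)" "small T W"
    "\<And>p. p \<in> Obj (comma_under A B U b) \<Longrightarrow> \<exists>w\<in>W. \<exists>f. f \<in> Hom (comma_under A B U b) w p"
proof -
  interpret A: lfmp A T GA by (rule A)
  interpret B: lfmp B T GB by (rule B)
  interpret U: cat_functor A B U by (rule U)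
  obtain lam0 :: "'u rel" where lam0: "small_regular_cardinal lam0"
    "preserves_lam_filtered_colimits T lam0 A B U"
    using acc unfolding accessible_def by blast
  have co0: "Card_order lam0" and less0: "lam0 <o |UNIV :: 'u set|"
    using lam0(1) unfolding small_regular_cardinal_def by simp_all
  have F0: "|Field lam0| =o lam0" by (rule card_of_Field_ordIso[OF co0])
  have "small T (Field lam0)" unfolding small_def by (rule ordIso_ordLess_trans[OF F0 less0])
  hence "small T ((Inl :: 'u \<Rightarrow> 'u + ('d \<times> 'd)) ` Field lam0 \<union> Inr ` el_arr B GB b)"
    by (intro small_Un[OF B.univ] small_image B.small_el_arr b)
  hence smS: "small T (Field lam0 <+> el_arr B GB b)" unfolding Plus_def .
  \<comment> \<open>Two demands on \<open>lam\<close>: it must be at least \<open>lam0\<close>, so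
    that \<open>U\<close> preserves \<open>lam\<close>-filtered colimits, and exceed
    \<open>el_arr B GB b\<close>, so that \<open>b\<close> is presentable. The disjoint sum meets
    both at once.\<close>
  obtain lam :: "'u rel" where lam: "small_regular_cardinal lam"
    "|Field lam0 <+> el_arr B GB b| <o lam"
    using small_regular_cardinal_above[OF B.univ smS] .
  have co: "Card_order lam" and less: "lam <o |UNIV :: 'u set|"
    using lam(1) unfolding small_regular_cardinal_def by simp_all
  have ic: "index_cardinal T lam" by (rule index_cardinal_small_regular[OF lam(1)])
  have cardb: "|el_arr B GB b| <o lam" by (rule ordLeq_ordLess_trans[OF card_of_Plus2 lam(2)])
  have "|Field lam0| <o lam" by (rule ordLeq_ordLess_trans[OF card_of_Plus1 lam(2)])
  hence lam0_le: "lam0 \<le>o lam"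
    by (rule ordLess_imp_ordLeq[OF ordIso_ordLess_trans[OF ordIso_symmetric[OF F0]]])
  have F1: "|Field lam| =o lam" by (rule card_of_Field_ordIso[OF co])
  have "small T (Field lam)" unfolding small_def by (rule ordIso_ordLess_trans[OF F1 less])
  from small_infinite_superset[OF B.univ this]
  obtain K :: "'u set" where K: "infinite K" "small T K" "|Field lam| \<le>o |K|" .
  have lamK: "lam \<le>o |K|" by (rule ordIso_ordLeq_trans[OF ordIso_symmetric[OF F1] K(3)])
  obtain W0 where W0: "small T W0" "\<And>x S. x \<in> Obj A \<Longrightarrow> S \<subseteq> el A GA x \<Longrightarrow> |S| \<le>o |K| \<Longrightarrow>
      \<exists>w\<in>W0. \<exists>l h. local_colimit A S x w l h"
    using A.small_local_colimits[OF K(2)] by blast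
  \<comment> \<open>Every object of the small set \<open>W0\<close> is paired with every arrow from
    \<open>b\<close> into its image; local smallness of \<open>B\<close> keeps this small.\<close>
  define W where "W = (SIGMA w:{w \<in> W0. w \<in> Obj A}. Hom B b (FObj U w))"
  have O: "Obj (comma_under A B U b) = {p. fst p \<in> Obj A \<and> snd p \<in> Hom B b (FObj U (fst p))}"
    unfolding comma_under_eq_over_cat by simp
  show thesis
  proof (rule that)
    show "W \<subseteq> Obj (comma_under A B U b)" unfolding W_def O by auto
    have "small T (Hom B b (FObj U w))" if "w \<in> Obj A" for w
      using B.locally_small b U.FObj_in_Obj[OF that] unfolding locally_small_def by simp
    moreover have "small T {w \<in> W0. w \<in> Obj A}" by (rule small_subset[OF _ W0(1)]) auto
    ultimately show "small T W" unfolding W_def by (intro small_Sigma[OF B.univ]) simp_all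
    fix p assume p: "p \<in> Obj (comma_under A B U b)"
    define x f where "x = fst p" and "f = snd p"
    have x: "x \<in> Obj A" and f: "f \<in> Hom B b (FObj U x)" using p unfolding O x_def f_def by simp_all
    obtain J :: "('b set, 'b set \<times> unit \<times> 'b set) cat" and D l where
      J: "small_category T J" "lam_filtered T lam J" and D: "cat_functor J A D"
      and col: "colimit J A D x l" and DW: "\<And>j. j \<in> Obj J \<Longrightarrow> FObj D j \<in> W0"
      using A.small_colimit_decomposition[OF x K(1) lamK W0(2)[OF x]] by blast
    interpret D: cat_functor J A D by (rule D)
    have UD: "cat_functor J B (comp_ftor U D)" by (rule cat_functor_comp_ftor[OF D U])
    have l: "cocone J A D x l" using col unfolding colimit_def by simp
    have "preserves_colimits_of_shape J A B U"
      by (rule preserves_lam_filtered_colimits_small[OF lam0(2) J(1) lam_filtered_mono[OF lam0_le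
        J(2)]])
    moreover have "is_colimit J A D (x, restrict l (Obj J))"
      unfolding is_colimit_iff[OF D.source.category_axioms]
      using col by (subst colimit_cong[OF D.source.category_axioms, of _ l]) simp_all
    ultimately have "is_colimit J B (comp_ftor U D) (image_cocone J U (x, restrict l (Obj J)))"
      using D unfolding preserves_colimits_of_shape_def by simp
    hence "colimit J B (comp_ftor U D) (FObj U x) (\<lambda>j\<in>Obj J. FArr U (restrict l (Obj J) j))"
      by (simp add: image_cocone_def is_colimit_iff[OF D.source.category_axioms])
    hence Ucol: "colimit J B (comp_ftor U D) (FObj U x) (\<lambda>j. FArr U (l j))"
      by (subst (asm) colimit_cong[OF D.source.category_axioms, of _ "\<lambda>j. FArr U (l j)"]) simp_all
    from B.presentable_factor[OF ic J UD Ucol b cardb f]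
    obtain j g where j: "j \<in> Obj J"
      and g: "g \<in> Hom B b (FObj U (FObj D j))" "Comp B (FArr U (l j)) g = f" by auto
    have "(FObj D j, g) \<in> W" unfolding W_def using DW[OF j] D.FObj_in_Obj[OF j] g(1) by simp
    moreover have "((FObj D j, g), l j, p) \<in> Hom (comma_under A B U b) (FObj D j, g) p"
      unfolding comma_under_eq_over_cat Hom_over_cat
      using D.FObj_in_Obj[OF j] g x f cocone_Hom[OF l j] by (simp add: x_def f_def)
    ultimately show "\<exists>w\<in>W. \<exists>f. f \<in> Hom (comma_under A B U b) w p" by blast
  qed
qed

theorem theorem4p4:
  fixes A :: "('oa, 'ma) cat" and B :: "('ob, 'mb) cat"
    and U :: "('oa, 'ma, 'ob, 'mb) ftor"
  assumes "universe TYPE('u)"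
    and "locally_finitely_multipresentable TYPE('u) A"
    and "locally_finitely_multipresentable TYPE('u) B"
    and "cat_functor A B U"
  shows "right_multi_adjoint TYPE('u) A B U \<longleftrightarrow>
    accessible TYPE('u) A B U \<and> preserves_connected_limits TYPE('u) A B U"
proof -
  obtain GA where GA: "lfmp A TYPE('u) GA"
    using lfmp_of_locally_finitely_multipresentable[OF assms(1,2)] .
  obtain GB where GB: "lfmp B TYPE('u) GB"
    using lfmp_of_locally_finitely_multipresentable[OF assms(1,3)] .
  show ?thesis
  proof (intro iffI conjI)
    assume adj: "right_multi_adjoint TYPE('u) A B U"
    show "accessible TYPE('u) A B U" by (rule right_multi_adjoint_accessible[OF GA GB assms(4) adj])
    show "preserves_connected_limits TYPE('u) A B U"
      by (rule right_multi_adjoint_connected_limits[OF assms(4) adj])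
  next
    assume "accessible TYPE('u) A B U \<and> preserves_connected_limits TYPE('u) A B U"
    hence acc: "accessible TYPE('u) A B U"
      and pres: "preserves_connected_limits TYPE('u) A B U" by simp_all
    show "right_multi_adjoint TYPE('u) A B U"
      unfolding right_multi_adjoint_def
    proof
      fix b assume b: "b \<in> Obj B"
      obtain W where W: "W \<subseteq> Obj (comma_under A B U b)" "small TYPE('u) W"
        "\<And>p. p \<in> Obj (comma_under A B U b) \<Longrightarrow> \<exists>w\<in>W. \<exists>f. f \<in> Hom (comma_under A B U b) w p"
        using solution_set[OF GA GB assms(4) acc b] by blast
      show "has_small_multi_initial_family TYPE('u) (comma_under A B U b)"
        by (rule has_small_multi_initial_family_of_cones[OF comma_under_cones(1)[OF GA assms(4)
          pres b]
              assms(1) W comma_under_cones(3)[OF GA assms(4) pres b]])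
    qed
  qed
qed

end
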